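(* There is an absolute constant $C>0$ such that the following hold for all positive integers $n$. (i) For any positive integer $h$, the number of graphs on $n$ labeled vertices that admit an obstacle representation with $h$ obstacles is at most $2^{C h n \log^2 n}$. (ii) For any positive integer $s$, the number of graphs on $n$ labeled vertices that admit an obstacle representation by a set of obstacles having a total of $s$ sides is at most $2^{C(n\log n + s\log s)}$.
   Context: An obstacle representation of a graph $G$ consists of a set $P$ of points in the plane, one for each vertex of $G$, together with a set of closed polygonal obstacles (connected polygonal regions) such that the points of $P$ and the vertices of the obstacles are in general position (no three on a line), and such that two vertices of $G$ are adjacent if and only if the segment connecting the corresponding points does not meet any obstacle. A representation with $h$ obstacles is called an $h$-obstacle representation. The total number of sides of a set of obstacles is the sum of the numbers of sides of the polygonal obstacles. *)

theory Defs
  imports "HOL-Analysis.Analysis"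
begin

type_synonym point = "real ^ 2"

definition labeled_graphs :: "nat \<Rightarrow> nat set set set" where
  "labeled_graphs n = Pow {e. e \<subseteq> {..<n} \<and> card e = 2}"

lemma finite_labeled_graphs: "finite (labeled_graphs n)"
proof -
  have "{e. e \<subseteq> {..<n} \<and> card e = 2} \<subseteq> Pow {..<n}" by auto
  then show ?thesis
    unfolding labeled_graphs_def by (meson finite_Pow_iff finite_lessThan finite_subset)
qed

definition general_position :: "point set \<Rightarrow> bool" where
  "general_position A \<longleftrightarrow>
     (\<forall>a\<in>A. \<forall>b\<in>A. \<forall>c\<in>A. a \<noteq> b \<and> b \<noteq> c \<and> a \<noteq> c \<longrightarrow> \<not> collinear {a, b, c})"

text \<open>
  \<open>polygonal_region R S\<close>: \<open>R\<close> is a closed connected polygonal region and \<open>S\<close> is the set of its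
  sides. A side is encoded as the set of its two endpoints, so that \<open>\<Union>S\<close> is the set of vertices
  and the segment itself is \<open>convex hull e\<close>. Holes are allowed. The condition
  \<open>R = closure (interior R)\<close> excludes lower-dimensional parts.

  On its own, \<open>R\<close> does not determine \<open>S\<close>, because a side may be subdivided. If the vertices are in
  general position (as they are wherever the predicate is used below), then no subdivision is
  possible and \<open>S\<close> is determined by \<open>R\<close>.
\<close>

definition polygonal_region :: "point set \<Rightarrow> point set set \<Rightarrow> bool" where
  "polygonal_region R S \<longleftrightarrow>
     R \<noteq> {} \<and> compact R \<and> connected R \<and> R = closure (interior R) \<and>
     finite S \<and> (\<forall>e\<in>S. card e = 2) \<and>
     (\<forall>e\<in>S. \<forall>e'\<in>S. e \<noteq> e' \<longrightarrow> convex hull e \<inter> convex hull e' = e \<inter> e') \<and>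
     frontier R = (\<Union>e\<in>S. convex hull e)"

definition obstacle_representation ::
    "nat \<Rightarrow> nat set set \<Rightarrow> (nat \<Rightarrow> point) \<Rightarrow> point set set \<Rightarrow> (point set \<Rightarrow> point set set) \<Rightarrow> bool" where
  "obstacle_representation n E p Obs sides \<longleftrightarrow>
     inj_on p {..<n} \<and>
     finite Obs \<and> (\<forall>R\<in>Obs. polygonal_region R (sides R)) \<and>
     general_position (p ` {..<n} \<union> (\<Union>R\<in>Obs. \<Union>(sides R))) \<and>
     (\<forall>u<n. \<forall>v<n. u \<noteq> v \<longrightarrow>
        ({u, v} \<in> E \<longleftrightarrow> (\<forall>R\<in>Obs. closed_segment (p u) (p v) \<inter> R = {})))"

definition admits_obstacles :: "nat \<Rightarrow> nat \<Rightarrow> nat set set \<Rightarrow> bool" where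
  "admits_obstacles n h E \<longleftrightarrow>
     (\<exists>p Obs sides. obstacle_representation n E p Obs sides \<and> card Obs = h)"

definition admits_total_sides :: "nat \<Rightarrow> nat \<Rightarrow> nat set set \<Rightarrow> bool" where
  "admits_total_sides n s E \<longleftrightarrow>
     (\<exists>p Obs sides. obstacle_representation n E p Obs sides \<and> (\<Sum>R\<in>Obs. card (sides R)) = s)"

end

theory Submission
  imports Defs
begin

text \<open>
  Fix the points. The segments that avoid a connected obstacle also avoid the component of
  the complement of all these segments that contains the obstacle, and that component already
  arises from a minimal subset of them, each of which is touched by the component. Such a
  subset has only \<open>O(n log n)\<close> members: direct each segment such that the component is on its left,
  and order the segments at a common tail or head by angle. By the Jordan curve theorem no alternating
  chain in these orders closes up, so the weight of a segment, which counts the segments above it, is at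
  least the sum of the weights of any one above it at its tail and any one above it at its head.
  Hence the weights of the segments at a vertex grow geometrically.

  The obstacle is recovered from the minimal subset and one point of the obstacle, given only the
  set of sign vectors that the points of the plane have with respect to finitely many affine
  functions defined by the \<open>n\<close> points. This set depends only on the signs of polynomially many polynomials of
  bounded degree in the \<open>2n\<close> coordinates, so a Warren-type bound leaves \<open>2 ^ O(n log n)\<close> possibilities. Each
  obstacle contributes a factor \<open>2 ^ O(n (log n)^2)\<close>.

  With \<open>s\<close> sides in total, the graph is determined by the orientations of the triples of the
  at most \<open>n + 2s\<close> points and vertices, and the same bound on sign patterns applies.
\<close>

section \<open>Sign patterns of polynomials\<close>

text \<open>An obstacle may have arbitrarily many sides, so in part (i) its shape cannot be counted.
  What is counted is the face around it, and the difficulty is to describe a face with few bits.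
  Listing all segments that avoid the obstacle would cost about \<open>n ^ 2\<close> bits. A minimal
  list has \<open>O(n log n)\<close> members, and each of them, being one of \<open>n ^ 2\<close>
  pairs, costs \<open>O(log n)\<close> bits; this is where the square of the logarithm comes from.
  The set of sign vectors is shared by all obstacles, so its contribution is not raised to the power
  \<open>h\<close>. Sign vectors are used because the cells on which they are constant are convex,
  and a cell can be left into another one only along the face order. Connectedness in the plane
  thereby becomes reachability in a finite graph that no longer mentions coordinates. The constant
  216 is \<open>24 * 9\<close> and is dictated by part (ii); part (i) would get by with 158.\<close>

definition monom_val :: "nat \<Rightarrow> (nat \<Rightarrow> nat) \<Rightarrow> (nat \<Rightarrow> real) \<Rightarrow> real" where
  "monom_val k \<alpha> x = (\<Prod>i<k. x i ^ \<alpha> i)"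

text \<open>
  \<open>mpoly k d f\<close>: \<open>f\<close> is a polynomial function of the coordinates below \<open>k\<close>, of degree at most \<open>d\<close> in
  each of them separately.
\<close>

inductive mpoly :: "nat \<Rightarrow> nat \<Rightarrow> ((nat \<Rightarrow> real) \<Rightarrow> real) \<Rightarrow> bool" for k d where
  mpoly_monom: "(\<And>i. i < k \<Longrightarrow> \<alpha> i \<le> d) \<Longrightarrow> mpoly k d (\<lambda>x. c * monom_val k \<alpha> x)"
| mpoly_add: "mpoly k d f \<Longrightarrow> mpoly k d g \<Longrightarrow> mpoly k d (\<lambda>x. f x + g x)"

abbreviation expos :: "nat \<Rightarrow> nat \<Rightarrow> (nat \<Rightarrow> nat) set" where
  "expos k d \<equiv> PiE {..<k} (\<lambda>_. {..d})"

lemma finite_expos: "finite (expos k d)"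
  by (intro finite_PiE) auto

lemma card_expos: "card (expos k d) = (d + 1) ^ k"
  by (simp add: card_PiE)

lemma mpoly_coeffs:
  assumes "mpoly k d f"
  shows "\<exists>c. \<forall>x. f x = (\<Sum>\<alpha>\<in>expos k d. c \<alpha> * monom_val k \<alpha> x)"
  using assms
proof induction
  case (mpoly_monom \<alpha> c)
  \<comment> \<open>The index set \<open>expos k d\<close> contains only extensional
    functions.\<close>
  let ?a = "restrict \<alpha> {..<k}"
  have a: "?a \<in> expos k d" using mpoly_monom by auto
  show ?case
  proof (intro exI allI)
    fix x
    have "(\<Sum>\<beta>\<in>expos k d. (if \<beta> = ?a then c else 0) * monom_val k \<beta> x)
        = (\<Sum>\<beta>\<in>expos k d. if \<beta> = ?a then c * monom_val k ?a x else 0)"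
      by (intro sum.cong) auto
    also have "\<dots> = c * monom_val k ?a x"
      using a by (simp add: finite_expos)
    also have "monom_val k ?a x = monom_val k \<alpha> x"
      by (simp add: monom_val_def)
    finally show "c * monom_val k \<alpha> x
        = (\<Sum>\<beta>\<in>expos k d. (if \<beta> = ?a then c else 0) * monom_val k \<beta> x)" by (rule sym)
  qed
next
  case (mpoly_add f g)
  then obtain c1 c2 where "\<And>x. f x = (\<Sum>\<alpha>\<in>expos k d. c1 \<alpha> * monom_val k \<alpha> x)"
    "\<And>x. g x = (\<Sum>\<alpha>\<in>expos k d. c2 \<alpha> * monom_val k \<alpha> x)" by blast
  then show ?case
    by (intro exI[of _ "\<lambda>\<alpha>. c1 \<alpha> + c2 \<alpha>"]) (simp add: sum.distrib algebra_simps)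
qed

lemma mpoly_mono: "mpoly k d f \<Longrightarrow> d \<le> e \<Longrightarrow> k \<le> l \<Longrightarrow> mpoly l e f"
proof (induction rule: mpoly.induct)
  case (mpoly_monom \<alpha> c)
  let ?b = "\<lambda>i. if i < k then \<alpha> i else 0"
  have eq: "(\<lambda>x. c * monom_val k \<alpha> x) = (\<lambda>x. c * monom_val l ?b x)"
  proof
    fix x :: "nat \<Rightarrow> real"
    have "(\<Prod>i<l. x i ^ ?b i) = (\<Prod>i<k. x i ^ ?b i)"
      using mpoly_monom by (intro prod.mono_neutral_right) auto
    then show "c * monom_val k \<alpha> x = c * monom_val l ?b x"
      by (simp add: monom_val_def)
  qed
  show ?case unfolding eq
    by (rule mpoly.mpoly_monom) (use mpoly_monom in \<open>force\<close>)
next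
  case (mpoly_add f g)
  then show ?case by (auto intro: mpoly.mpoly_add)
qed

lemma mpoly_const: "mpoly k d (\<lambda>x. c)"
  using mpoly_monom[of k "\<lambda>_. 0" d c] by (simp add: monom_val_def)

lemma mpoly_var: "i < k \<Longrightarrow> d \<ge> 1 \<Longrightarrow> mpoly k d (\<lambda>x. x i)"
proof -
  assume i: "i < k" and d: "d \<ge> 1"
  have "monom_val k (\<lambda>j. if j = i then 1 else 0) x = x i" for x
  proof -
    have "(\<Prod>j<k. x j ^ (if j = i then 1 else 0)) = (\<Prod>j<k. if j = i then x i else 1)"
      by (intro prod.cong) auto
    then show ?thesis using i by (simp add: monom_val_def)
  qed
  then show ?thesis
    using mpoly_monom[of k "\<lambda>j. if j = i then 1 else 0" d 1] d by simp
qed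

lemma mpoly_mult: "mpoly k d f \<Longrightarrow> mpoly k e g \<Longrightarrow> mpoly k (d + e) (\<lambda>x. f x * g x)"
proof (induction rule: mpoly.induct)
  case (mpoly_monom \<alpha> c)
  from mpoly_monom(2) show ?case
  proof (induction rule: mpoly.induct)
    case (mpoly_monom \<beta> b)
    have "mpoly k (d + e) (\<lambda>x. (c * b) * monom_val k (\<lambda>i. \<alpha> i + \<beta> i) x)"
      using mpoly_monom \<open>\<And>i. i < k \<Longrightarrow> \<alpha> i \<le> d\<close>
      by (intro mpoly.mpoly_monom) (simp add: add_mono)
    moreover have "(\<lambda>x. (c * b) * monom_val k (\<lambda>i. \<alpha> i + \<beta> i) x)
        = (\<lambda>x. c * monom_val k \<alpha> x * (b * monom_val k \<beta> x))"
      by (simp add: monom_val_def power_add prod.distrib fun_eq_iff)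
    ultimately show ?case by simp
  next
    case (mpoly_add g1 g2)
    from mpoly.mpoly_add[OF mpoly_add(3,4)] show ?case by (simp add: algebra_simps)
  qed
next
  case (mpoly_add f1 f2)
  from mpoly.mpoly_add[OF mpoly_add.IH] mpoly_add.prems show ?case
    by (simp add: algebra_simps)
qed

lemma mpoly_diff: "mpoly k d f \<Longrightarrow> mpoly k d g \<Longrightarrow> mpoly k d (\<lambda>x. f x - g x)"
proof -
  assume f: "mpoly k d f" and g: "mpoly k d g"
  have "mpoly k (0 + d) (\<lambda>x. (- 1) * g x)"
    by (intro mpoly_mult mpoly_const g)
  from mpoly_add[OF f this[simplified]] show ?thesis by simp
qed

lemma mpoly_sum: "finite A \<Longrightarrow> (\<And>a. a \<in> A \<Longrightarrow> mpoly k d (f a)) \<Longrightarrow> mpoly k d (\<lambda>x. \<Sum>a\<in>A. f a x)"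
  by (induction rule: finite_induct) (auto intro: mpoly_const mpoly_add)

lemma mpoly_prod:
  "finite A \<Longrightarrow> (\<And>a. a \<in> A \<Longrightarrow> mpoly k d (f a)) \<Longrightarrow> mpoly k (card A * d) (\<lambda>x. \<Prod>a\<in>A. f a x)"
proof (induction rule: finite_induct)
  case empty
  then show ?case by (simp add: mpoly_const)
next
  case (insert a A)
  have "mpoly k (d + card A * d) (\<lambda>x. f a x * (\<Prod>a\<in>A. f a x))"
    by (intro mpoly_mult) (use insert in auto)
  then show ?case using insert by simp
qed

lemma mpoly_power: "mpoly k d f \<Longrightarrow> mpoly k (n * d) (\<lambda>x. f x ^ n)"
  using mpoly_prod[of "{..<n}" k d "\<lambda>_. f"] by simp

lemma mpoly_cong: "mpoly k d f \<Longrightarrow> (\<And>i. i < k \<Longrightarrow> x i = y i) \<Longrightarrow> f x = f y"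
  by (induction rule: mpoly.induct) (auto simp: monom_val_def)

lemma mpoly_continuous: "mpoly k d f \<Longrightarrow> continuous_on UNIV f"
proof (induction rule: mpoly.induct)
  case (mpoly_monom \<alpha> c)
  have "continuous_on UNIV (\<lambda>x :: nat \<Rightarrow> real. x i)" for i
    by (rule continuous_on_product_coordinates)
  then show ?case unfolding monom_val_def by (intro continuous_intros)
qed (auto intro: continuous_intros)

lemma mpoly_partial_derivative:
  assumes "mpoly k d f" "i < k"
  shows "\<exists>f'. mpoly k d f' \<and> (\<forall>x. ((\<lambda>t. f (x(i := t))) has_real_derivative f' x) (at (x i)))"
  using assms(1)
proof induction
  case (mpoly_monom \<alpha> c)
  \<comment> \<open>For \<open>\<alpha> i = 0\<close> the exponent truncates to 0, and the factor
    \<open>real (\<alpha> i)\<close> removes the term.\<close>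
  let ?f' = "\<lambda>x. (c * real (\<alpha> i)) * monom_val k (\<alpha>(i := \<alpha> i - 1)) x"
  have "mpoly k d ?f'"
    by (rule mpoly.mpoly_monom) (use mpoly_monom assms(2) in \<open>auto intro: order_trans[OF diff_le_self]\<close>)
  moreover have "((\<lambda>t. c * monom_val k \<alpha> (x(i := t))) has_real_derivative ?f' x) (at (x i))" for x
  proof -
    let ?A = "{..<k} - {i}"
    have split: "{..<k} = insert i ?A" using assms(2) by auto
    have 1: "monom_val k \<alpha> (x(i := t)) = t ^ \<alpha> i * (\<Prod>j\<in>?A. x j ^ \<alpha> j)" for t
      unfolding monom_val_def by (subst split, subst prod.insert) auto
    have 2: "monom_val k (\<alpha>(i := \<alpha> i - 1)) x = x i ^ (\<alpha> i - 1) * (\<Prod>j\<in>?A. x j ^ \<alpha> j)"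
      unfolding monom_val_def by (subst split, subst prod.insert) auto
    show ?thesis unfolding 1 2
      by (auto intro!: derivative_eq_intros simp: algebra_simps)
  qed
  ultimately show ?case by blast
next
  case (mpoly_add f g)
  then obtain f' g' where "mpoly k d f'" "mpoly k d g'"
    "\<And>x. ((\<lambda>t. f (x(i := t))) has_real_derivative f' x) (at (x i))"
    "\<And>x. ((\<lambda>t. g (x(i := t))) has_real_derivative g' x) (at (x i))" by blast
  then show ?case
    by (intro exI[of _ "\<lambda>x. f' x + g' x"]) (auto intro: mpoly.mpoly_add DERIV_add simp del: fun_upd_apply)
qed

section \<open>Linear dependence and non-vanishing of polynomials\<close>

lemma homogeneous_system_solution:
  fixes A :: "'j \<Rightarrow> 'i \<Rightarrow> real"
  assumes "finite J" "finite I" "card J < card I"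
  shows "\<exists>c. (\<exists>i\<in>I. c i \<noteq> 0) \<and> (\<forall>j\<in>J. (\<Sum>i\<in>I. A j i * c i) = 0)"
  using assms
proof (induction J arbitrary: I A rule: finite_induct)
  case empty
  then have "I \<noteq> {}" by auto
  then show ?case by (intro exI[of _ "\<lambda>_. 1"]) auto
next
  case (insert j J)
  show ?case
  proof (cases "\<forall>i\<in>I. A j i = 0")
    case True
    have "card J < card I" using insert by simp
    from insert.IH[OF \<open>finite I\<close> this] obtain c where
      "\<exists>i\<in>I. c i \<noteq> 0" "\<forall>j\<in>J. (\<Sum>i\<in>I. A j i * c i) = 0" by blast
    then show ?thesis using True by (intro exI[of _ c]) auto
  next
    case False
    then obtain i0 where i0: "i0 \<in> I" "A j i0 \<noteq> 0" by blast
    let ?I = "I - {i0}"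
    \<comment> \<open>Gaussian elimination: equation \<open>j\<close> is solved for the unknown
      \<open>i0\<close>, which is then eliminated from the other equations.\<close>
    let ?A = "\<lambda>j' i. A j' i - A j' i0 * A j i / A j i0"
    have "card J < card ?I" using insert i0 by simp
    from insert.IH[of ?I ?A, OF _ this] insert obtain c where
      c: "\<exists>i\<in>?I. c i \<noteq> 0" "\<forall>j\<in>J. (\<Sum>i\<in>?I. ?A j i * c i) = 0" by auto
    define c' where "c' = c(i0 := - (\<Sum>i\<in>?I. A j i * c i) / A j i0)"
    have split: "(\<Sum>i\<in>I. A j' i * c' i) = A j' i0 * c' i0 + (\<Sum>i\<in>?I. A j' i * c i)" for j'
      using i0 insert by (simp add: sum.remove c'_def)
    have "(\<Sum>i\<in>I. A j' i * c' i) = 0" if "j' \<in> J" for j'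
    proof -
      have "0 = (\<Sum>i\<in>?I. ?A j' i * c i)" using c that by simp
      also have "\<dots> = (\<Sum>i\<in>?I. A j' i * c i) - (\<Sum>i\<in>?I. A j' i0 / A j i0 * (A j i * c i))"
        by (simp add: sum_subtractf algebra_simps)
      also have "\<dots> = (\<Sum>i\<in>I. A j' i * c' i)"
        unfolding split sum_distrib_left[symmetric] by (simp add: c'_def)
      finally show ?thesis by simp
    qed
    moreover have "(\<Sum>i\<in>I. A j i * c' i) = 0"
      unfolding split using i0 by (simp add: c'_def)
    moreover have "\<exists>i\<in>I. c' i \<noteq> 0" using c by (auto simp: c'_def)
    ultimately show ?thesis by blast
  qed
qed

text \<open>Each function has \<open>(d + 1) ^ k\<close> coefficients, so the vanishing of all
  coefficients of a combination is a homogeneous system with fewer equations than unknowns.\<close>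

lemma mpoly_linear_dependence:
  assumes "finite I" "\<And>i. i \<in> I \<Longrightarrow> mpoly k d (f i)" "(d + 1) ^ k < card I"
  shows "\<exists>c. (\<exists>i\<in>I. c i \<noteq> 0) \<and> (\<forall>x. (\<Sum>i\<in>I. c i * f i x) = 0)"
proof -
  have "\<forall>i\<in>I. \<exists>m. \<forall>x. f i x = (\<Sum>\<alpha>\<in>expos k d. m \<alpha> * monom_val k \<alpha> x)"
    using mpoly_coeffs assms by blast
  then obtain m where m: "\<And>i x. i \<in> I \<Longrightarrow> f i x = (\<Sum>\<alpha>\<in>expos k d. m i \<alpha> * monom_val k \<alpha> x)"
    by metis
  obtain c where c: "\<exists>i\<in>I. c i \<noteq> 0" "\<forall>\<alpha>\<in>expos k d. (\<Sum>i\<in>I. m i \<alpha> * c i) = 0"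
    using homogeneous_system_solution[OF finite_expos assms(1), of k d "\<lambda>\<alpha> i. m i \<alpha>"]
    assms(3) card_expos by auto
  have "(\<Sum>i\<in>I. c i * f i x) = 0" for x
  proof -
    have "(\<Sum>i\<in>I. c i * f i x) = (\<Sum>i\<in>I. \<Sum>\<alpha>\<in>expos k d. c i * m i \<alpha> * monom_val k \<alpha> x)"
      by (intro sum.cong) (auto simp: m sum_distrib_left mult.assoc)
    also have "\<dots> = (\<Sum>\<alpha>\<in>expos k d. \<Sum>i\<in>I. c i * m i \<alpha> * monom_val k \<alpha> x)"
      by (rule sum.swap)
    also have "\<dots> = (\<Sum>\<alpha>\<in>expos k d. (\<Sum>i\<in>I. m i \<alpha> * c i) * monom_val k \<alpha> x)"
      by (intro sum.cong refl) (simp add: sum_distrib_left mult_ac)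
    also have "\<dots> = 0" using c by simp
    finally show ?thesis .
  qed
  with c show ?thesis by blast
qed

lemma expos_Suc_sum:
  "(\<Sum>\<alpha>\<in>expos (Suc k) d. F \<alpha>) = (\<Sum>\<alpha>\<in>expos k d. \<Sum>a\<le>d. F (\<alpha>(k := a)))"
proof -
  have eq: "expos (Suc k) d = (\<lambda>(a, \<alpha>). \<alpha>(k := a)) ` ({..d} \<times> expos k d)"
    by (simp add: lessThan_Suc PiE_insert_eq)
  have inj: "inj_on (\<lambda>(a, \<alpha>). \<alpha>(k := a)) ({..d} \<times> expos k d)"
    using inj_combinator[of k "{..<k}" "\<lambda>_. {..d}"] by simp
  show ?thesis
    unfolding eq by (subst sum.reindex[OF inj], subst sum.swap) (simp add: sum.cartesian_product split_def)
qed

text \<open>Values for the first \<open>k\<close> variables are chosen such that the coefficient of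
  one power of the last variable survives; the remaining univariate polynomial has finitely many
  roots. Infinite sets \<open>Z i\<close> allow the values to be taken from a short
  interval.\<close>

lemma nonzero_coeffs_nonvanishing:
  assumes "\<exists>\<alpha>\<in>expos k d. c \<alpha> \<noteq> 0" "\<And>i. i < k \<Longrightarrow> infinite (Z i)"
  shows "\<exists>x. (\<forall>i<k. x i \<in> Z i) \<and> (\<Sum>\<alpha>\<in>expos k d. c \<alpha> * monom_val k \<alpha> x) \<noteq> 0"
  using assms
proof (induction k arbitrary: c)
  case 0
  then show ?case by (auto simp: monom_val_def)
next
  case (Suc k)
  from Suc.prems(1) obtain \<alpha>0 where a0: "\<alpha>0 \<in> expos (Suc k) d" "c \<alpha>0 \<noteq> 0" by blast
  have "expos (Suc k) d = (\<lambda>(a, \<alpha>). \<alpha>(k := a)) ` ({..d} \<times> expos k d)"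
    by (simp add: lessThan_Suc PiE_insert_eq)
  with a0 obtain \<alpha>1 a1 where a1: "\<alpha>1 \<in> expos k d" "a1 \<le> d" "\<alpha>0 = \<alpha>1(k := a1)" by auto
  have "\<exists>\<alpha>\<in>expos k d. c (\<alpha>(k := a1)) \<noteq> 0" using a0 a1 by blast
  from Suc.IH[OF this] Suc.prems(2) obtain x where x: "\<forall>i<k. x i \<in> Z i"
    "(\<Sum>\<alpha>\<in>expos k d. c (\<alpha>(k := a1)) * monom_val k \<alpha> x) \<noteq> 0"
    by (auto simp del: fun_upd_apply)
  define b where "b a = (\<Sum>\<alpha>\<in>expos k d. c (\<alpha>(k := a)) * monom_val k \<alpha> x)" for a
  have fin: "finite {z. (\<Sum>a\<le>d. b a * z ^ a) = 0}"
    using Transcendental.polyfun_rootbound[of b a1 d] x a1 by (simp add: b_def)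
  obtain z where z: "z \<in> Z k" "(\<Sum>a\<le>d. b a * z ^ a) \<noteq> 0"
  proof -
    have "infinite (Z k)" using Suc.prems(2)[of k] by simp
    then have "\<not> Z k \<subseteq> {z. (\<Sum>a\<le>d. b a * z ^ a) = 0}" using fin finite_subset by blast
    then show ?thesis using that by blast
  qed
  have mv: "monom_val (Suc k) (\<alpha>(k := a)) (x(k := z)) = monom_val k \<alpha> x * z ^ a" for \<alpha> a
    by (simp add: monom_val_def lessThan_Suc mult.commute)
  have "(\<Sum>\<alpha>\<in>expos (Suc k) d. c \<alpha> * monom_val (Suc k) \<alpha> (x(k := z)))
      = (\<Sum>\<alpha>\<in>expos k d. \<Sum>a\<le>d. c (\<alpha>(k := a)) * (monom_val k \<alpha> x * z ^ a))"
    by (simp add: expos_Suc_sum mv)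
  also have "\<dots> = (\<Sum>a\<le>d. \<Sum>\<alpha>\<in>expos k d. c (\<alpha>(k := a)) * (monom_val k \<alpha> x * z ^ a))"
    by (rule sum.swap)
  also have "\<dots> = (\<Sum>a\<le>d. b a * z ^ a)"
    by (simp add: b_def sum_distrib_right mult.assoc)
  finally have "(\<Sum>\<alpha>\<in>expos (Suc k) d. c \<alpha> * monom_val (Suc k) \<alpha> (x(k := z))) \<noteq> 0"
    using z by simp
  moreover have "\<forall>i<Suc k. (x(k := z)) i \<in> Z i" using x z by (auto simp: less_Suc_eq)
  ultimately show ?case by blast
qed


text \<open>
  A dimension count gives a nontrivial relation between the products of powers of the \<open>P i\<close>, of a
  new variable \<open>s\<close> and of the separating form \<open>\<psi> = (\<Sum>i<k. s ^ i * x i)\<close>. For a suitable value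
  \<open>\<epsilon>\<close> of \<open>P\<close> and a suitable \<open>s\<close> this is a nonzero univariate polynomial that vanishes at the value of
  \<open>\<psi>\<close> at each preimage of \<open>\<epsilon>\<close>. This replaces Bezout's theorem.
\<close>

lemma card_common_preimages_le:
  assumes k: "1 \<le> k" and D: "k \<le> D"
    and P: "\<And>i. i < k \<Longrightarrow> mpoly k D (P i)" and \<rho>: "0 < \<rho>"
    and pre: "\<And>\<epsilon>. (\<And>i. i < k \<Longrightarrow> 0 < \<epsilon> i \<and> \<epsilon> i < \<rho>) \<Longrightarrow>
      \<exists>Y. finite Y \<and> card Y = M \<and> (\<forall>y\<in>Y. \<forall>i<k. P i y = \<epsilon> i) \<and>
        (\<forall>y\<in>Y. \<forall>y'\<in>Y. y \<noteq> y' \<longrightarrow> (\<exists>i<k. y i \<noteq> y' i))"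
  shows "M \<le> ((k + 2) * D) ^ (k + 1)"
proof -
  \<comment> \<open>\<open>T\<close> balances the count: the products have degree at most
    \<open>N\<close> in each variable, hence at most \<open>(N + 1) ^ (k + 1)\<close> monomials.
    This is at most \<open>T * (T + 1) ^ (k + 1)\<close>, against \<open>(T + 1) ^ (k + 2)\<close>
    products.\<close>
  define T where "T = ((k + 2) * D) ^ (k + 1)"
  define I where "I = expos k T \<times> {..T} \<times> {..T}"
  \<comment> \<open>The coordinate with index \<open>k\<close> serves as the new variable
    \<open>s\<close>; each \<open>P i\<close> depends only on the coordinates below
    \<open>k\<close>.\<close>
  define \<psi> where "\<psi> = (\<lambda>x :: nat \<Rightarrow> real. \<Sum>i<k. x k ^ i * x i)"
  define f where "f = (\<lambda>(\<alpha>, a, b) x. (\<Prod>i<k. P i x ^ \<alpha> i) * x k ^ a * \<psi> x ^ b)"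
  define N where "N = (k + 2) * D * T"
  have D1: "1 \<le> D" using k D by simp
  have mono: "mpoly (k + 1) e g" if "mpoly (k + 1) e' g" "e' \<le> e" for e e' g
    using mpoly_mono[OF that] by simp
  have \<psi>: "mpoly (k + 1) D \<psi>"
    unfolding \<psi>_def
  proof (rule mpoly_sum)
    fix i assume i: "i \<in> {..<k}"
    have "mpoly (k + 1) (i * 1 + 1) (\<lambda>x. x k ^ i * x i)"
      by (intro mpoly_mult mpoly_power mpoly_var) (use i in auto)
    then show "mpoly (k + 1) D (\<lambda>x. x k ^ i * x i)"
      by (rule mono) (use i D in simp)
  qed simp
  have f: "mpoly (k + 1) N (f j)" if j_mem: "j \<in> I" for j
  proof -
    obtain \<alpha> a b where j: "j = (\<alpha>, a, b)" "\<alpha> \<in> expos k T" "a \<le> T" "b \<le> T"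
      using j_mem by (auto simp: I_def)
    have "mpoly (k + 1) (T * D) (\<lambda>x. P i x ^ \<alpha> i)" if "i \<in> {..<k}" for i
    proof (rule mono[OF mpoly_power])
      show "mpoly (k + 1) D (P i)" using P[of i] that mpoly_mono[of k D "P i" D "k + 1"] by simp
      show "\<alpha> i * D \<le> T * D" using j that by (auto simp: PiE_iff)
    qed
    then have 1: "mpoly (k + 1) (k * (T * D)) (\<lambda>x. \<Prod>i<k. P i x ^ \<alpha> i)"
      using mpoly_prod[of "{..<k}" "k + 1" "T * D" "\<lambda>i x. P i x ^ \<alpha> i"] by simp
    have 2: "mpoly (k + 1) (T * D) (\<lambda>x. x k ^ a)"
      by (rule mono[OF mpoly_power[OF mpoly_var[of _ _ 1]]]) (use j mult_le_mono[of a T 1 D] D1 in auto)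
    have 3: "mpoly (k + 1) (T * D) (\<lambda>x. \<psi> x ^ b)"
      by (rule mono[OF mpoly_power[OF \<psi>]]) (use j in simp)
    have "N = k * (T * D) + T * D + T * D" by (simp add: N_def algebra_simps)
    with mpoly_mult[OF mpoly_mult[OF 1 2] 3] show ?thesis by (simp add: f_def j)
  qed
  have finI: "finite I" by (simp add: I_def finite_expos)
  have cardI: "card I = (T + 1) ^ (k + 2)"
    by (simp add: I_def card_cartesian_product card_PiE algebra_simps)
  have "1 \<le> (k + 2) * D" using D1 by (simp add: add_leD2)
  moreover have "(k + 2) * D * (T + 1) = N + (k + 2) * D" unfolding N_def distrib_left by simp
  ultimately have "N + 1 \<le> (k + 2) * D * (T + 1)" by linarith
  then have "(N + 1) ^ (k + 1) \<le> ((k + 2) * D * (T + 1)) ^ (k + 1)" by (rule power_mono) simp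
  also have "\<dots> = T * (T + 1) ^ (k + 1)" by (simp only: power_mult_distrib T_def)
  also have "\<dots> < (T + 1) * (T + 1) ^ (k + 1)" by (intro mult_strict_right_mono) auto
  also have "\<dots> = card I" unfolding cardI by (simp flip: power_Suc)
  finally have "(N + 1) ^ (k + 1) < card I" .
  then have "\<exists>c. (\<exists>j\<in>I. c j \<noteq> 0) \<and> (\<forall>x. (\<Sum>j\<in>I. c j * f j x) = 0)"
    by (intro mpoly_linear_dependence[OF finI]) (use f in auto)
  then obtain c where c': "(\<exists>j\<in>I. c j \<noteq> 0) \<and> (\<forall>x. (\<Sum>j\<in>I. c j * f j x) = 0)"
    by (rule exE)
  then have c0: "\<exists>j\<in>I. c j \<noteq> 0" and c: "\<And>x. (\<Sum>j\<in>I. c j * f j x) = 0" by simp_all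
  from c0 obtain \<alpha>0 a0 b0 where abc: "\<alpha>0 \<in> expos k T" "a0 \<le> T" "b0 \<le> T" "c (\<alpha>0, a0, b0) \<noteq> 0"
    by (auto simp: I_def)
  have "\<exists>\<alpha>\<in>expos k T. c (\<alpha>, a0, b0) \<noteq> 0" using abc by blast
  \<comment> \<open>This choice keeps the coefficient of \<open>s ^ a0 * \<psi> ^ b0\<close> nonzero
    after the substitution of \<open>\<epsilon> i\<close> for \<open>P i\<close>.\<close>
  from nonzero_coeffs_nonvanishing[OF this, of "\<lambda>_. {0<..<\<rho>}"] \<rho> obtain \<epsilon> where
    \<epsilon>: "\<forall>i<k. \<epsilon> i \<in> {0<..<\<rho>}" "(\<Sum>\<alpha>\<in>expos k T. c (\<alpha>, a0, b0) * monom_val k \<alpha> \<epsilon>) \<noteq> 0"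
    by (auto simp: infinite_Ioo)
  with pre[of \<epsilon>] obtain Y where Y: "finite Y" "card Y = M" "\<And>y i. y \<in> Y \<Longrightarrow> i < k \<Longrightarrow> P i y = \<epsilon> i"
    "\<And>y y'. y \<in> Y \<Longrightarrow> y' \<in> Y \<Longrightarrow> y \<noteq> y' \<Longrightarrow> \<exists>i<k. y i \<noteq> y' i" by auto
  define bs where "bs a = (\<Sum>\<alpha>\<in>expos k T. c (\<alpha>, a, b0) * monom_val k \<alpha> \<epsilon>)" for a
  have fin1: "finite {s. (\<Sum>a\<le>T. bs a * s ^ a) = 0}"
    using Transcendental.polyfun_rootbound[of bs a0 T] abc \<epsilon> by (simp add: bs_def)
  have fin2: "finite {s. (\<Sum>i<k. (y i - y' i) * s ^ i) = 0}" if yy: "y \<in> Y" "y' \<in> Y" "y \<noteq> y'" for y y'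
  proof -
    obtain i where "i < k" "y i \<noteq> y' i" using Y(4)[OF yy] by blast
    moreover have "{..<k} = {..k - 1}" using k by auto
    ultimately show ?thesis
      using Transcendental.polyfun_rootbound[of "\<lambda>i. y i - y' i" i "k - 1"] by simp
  qed
  \<comment> \<open>The value of \<open>s\<close> must neither annihilate the coefficient of
    \<open>\<psi> ^ b0\<close> nor give two points of \<open>Y\<close> the same value of
    \<open>\<psi>\<close>.\<close>
  let ?bad = "{s. (\<Sum>a\<le>T. bs a * s ^ a) = 0} \<union>
    (\<Union>y\<in>Y. \<Union>y'\<in>Y - {y}. {s. (\<Sum>i<k. (y i - y' i) * s ^ i) = 0})"
  have "finite ?bad"
    using fin1 fin2 Y(1) by (intro finite_UnI finite_UN_I) auto
  from ex_new_if_finite[OF infinite_UNIV_char_0 this] obtain s where s: "s \<notin> ?bad" by (rule exE)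
  define \<tau> where "\<tau> y = \<psi> (y(k := s))" for y
  have \<tau>_eq: "\<tau> y = (\<Sum>i<k. y i * s ^ i)" for y
    by (simp add: \<tau>_def \<psi>_def mult.commute)
  have inj: "inj_on \<tau> Y"
  proof (rule inj_onI, rule ccontr)
    fix y y' assume "y \<in> Y" "y' \<in> Y" "\<tau> y = \<tau> y'" "y \<noteq> y'"
    then show False using s
      by (auto simp: \<tau>_eq left_diff_distrib sum_subtractf)
  qed
  define e where "e b = (\<Sum>\<alpha>\<in>expos k T. \<Sum>a\<le>T. c (\<alpha>, a, b) * monom_val k \<alpha> \<epsilon> * s ^ a)" for b
  have "e b0 = (\<Sum>a\<le>T. bs a * s ^ a)"
    unfolding e_def bs_def by (subst sum.swap) (simp add: sum_distrib_right)
  then have e0: "e b0 \<noteq> 0" using s by simp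
  have root: "(\<Sum>b\<le>T. e b * \<tau> y ^ b) = 0" if y: "y \<in> Y" for y
  proof -
    have fe: "f (\<alpha>, a, b) (y(k := s)) = monom_val k \<alpha> \<epsilon> * s ^ a * \<tau> y ^ b" for \<alpha> a b
    proof -
      have "P i (y(k := s)) = \<epsilon> i" if "i < k" for i
        using mpoly_cong[OF P[OF that], of "y(k := s)" y] Y(3)[OF y that] by simp
      then show ?thesis by (simp add: f_def monom_val_def \<tau>_def)
    qed
    have "0 = (\<Sum>j\<in>I. c j * f j (y(k := s)))" using c by simp
    also have "\<dots> = (\<Sum>\<alpha>\<in>expos k T. \<Sum>a\<le>T. \<Sum>b\<le>T. c (\<alpha>, a, b) * f (\<alpha>, a, b) (y(k := s)))"
      by (simp add: I_def sum.cartesian_product split_def)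
    also have "\<dots> = (\<Sum>\<alpha>\<in>expos k T. \<Sum>b\<le>T. \<Sum>a\<le>T. c (\<alpha>, a, b) * f (\<alpha>, a, b) (y(k := s)))"
      by (intro sum.cong refl sum.swap)
    also have "\<dots> = (\<Sum>b\<le>T. \<Sum>\<alpha>\<in>expos k T. \<Sum>a\<le>T. c (\<alpha>, a, b) * f (\<alpha>, a, b) (y(k := s)))"
      by (rule sum.swap)
    also have "\<dots> = (\<Sum>b\<le>T. e b * \<tau> y ^ b)"
      by (simp add: fe e_def sum_distrib_right mult.assoc)
    finally show ?thesis by simp
  qed
  have "M = card (\<tau> ` Y)" using card_image[OF inj] Y by simp
  also have "\<dots> \<le> card {t. (\<Sum>b\<le>T. e b * t ^ b) = 0}"
    using Transcendental.polyfun_rootbound[of e b0 T] e0 abc root by (intro card_mono) auto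
  also have "\<dots> \<le> T" using Transcendental.polyfun_rootbound[of e b0 T] e0 abc by simp
  finally show ?thesis by (simp add: T_def)
qed

section \<open>Counting sign cells by critical points\<close>

lemma compact_box:
  "compact {y :: nat \<Rightarrow> real. (\<forall>i<k. \<bar>y i\<bar> \<le> R) \<and> (\<forall>i\<ge>k. y i = 0)}" (is "compact ?B")
proof -
  \<comment> \<open>Points are functions on all natural numbers with the product topology; with the
    coordinates from \<open>k\<close> on fixed at 0, the box is a product of compact sets.\<close>
  have "?B = PiE UNIV (\<lambda>i. if i < k then {-R..R} else {0})"
    by (auto simp: PiE_iff abs_le_iff) (metis atLeastAtMost_iff minus_le_iff singletonD not_less)+
  moreover have "compactin (product_topology (\<lambda>i. euclidean) UNIV)
      (PiE UNIV (\<lambda>i. if i < k then {-R..R} else {0 :: real}))"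
    by (subst compactin_PiE) auto
  ultimately show ?thesis
    by (simp add: euclidean_product_topology flip: compactin_euclidean_iff)
qed

lemma card_strict_sign_cells_le:
  assumes k: "1 \<le> k" and T: "finite T" and q: "\<And>t. t \<in> T \<Longrightarrow> mpoly k d (q t)"
    and X: "finite X" and nz: "\<And>x t. x \<in> X \<Longrightarrow> t \<in> T \<Longrightarrow> q t x \<noteq> 0"
    and sep: "\<And>x x'. x \<in> X \<Longrightarrow> x' \<in> X \<Longrightarrow> x \<noteq> x' \<Longrightarrow> \<exists>t\<in>T. sgn (q t x) \<noteq> sgn (q t x')"
  shows "card X \<le> ((k + 2) * (2 * (card T * d + 2 * k))) ^ (k + 1)"
proof (cases "X = {}")
  case False
  define D where "D = 2 * (card T * d + k * 2)"
  obtain R where R: "0 < R" "\<And>x i. x \<in> X \<Longrightarrow> i < k \<Longrightarrow> \<bar>x i\<bar> < R"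
  proof -
    have "finite ((\<lambda>(x, i). \<bar>x i\<bar>) ` (X \<times> {..<k}))" using X by simp
    then obtain B where "\<forall>b\<in>(\<lambda>(x, i). \<bar>x i\<bar>) ` (X \<times> {..<k}). b \<le> B"
      by (metis bdd_above.unfold bdd_above_finite)
    then show ?thesis using that[of "\<bar>B\<bar> + 1"] by force
  qed
  txt \<open>
    \<open>G\<close> vanishes on the walls of the cells and of the box of radius \<open>R\<close>. Therefore, for every small \<open>\<epsilon>\<close>,
    each cell contains an interior maximum of \<open>G x - (\<Sum>i<k. \<epsilon> i * x i)\<close>, where the gradient of \<open>G\<close> is \<open>\<epsilon>\<close>.
  \<close>
  define Pr where "Pr = (\<lambda>x. (\<Prod>t\<in>T. q t x) * (\<Prod>i<k. R\<^sup>2 - x i * x i))"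
  define G where "G = (\<lambda>x. (Pr x)\<^sup>2)"
  have "mpoly k 2 (\<lambda>x. R\<^sup>2 - x i * x i)" if "i < k" for i
    using mpoly_diff[OF mpoly_const mpoly_mult[OF mpoly_var[of i k 1] mpoly_var[of i k 1]]] that by (simp add: numeral_2_eq_2)
  then have "mpoly k (card T * d + k * 2) Pr"
    unfolding Pr_def using mpoly_prod[of "{..<k}" k 2 "\<lambda>i x. R\<^sup>2 - x i * x i"]
    by (intro mpoly_mult mpoly_prod T q) auto
  from mpoly_power[OF this, of 2] have G: "mpoly k D G" by (simp add: G_def D_def)
  from mpoly_partial_derivative[OF G] obtain P where P: "\<And>i. i < k \<Longrightarrow> mpoly k D (P i)"
    "\<And>i x. i < k \<Longrightarrow> ((\<lambda>t. G (x(i := t))) has_real_derivative P i x) (at (x i))" by metis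
  have box_pos: "R\<^sup>2 - a * a > 0" if "\<bar>a\<bar> < R" for a
  proof -
    have "\<bar>a\<bar> * \<bar>a\<bar> < R * R" using that by (intro mult_strict_mono') auto
    then show ?thesis by (simp add: power2_eq_square)
  qed
  have Gpos: "0 < G x" if "x \<in> X" for x
  proof -
    have "R\<^sup>2 - x i * x i \<noteq> 0" if "i < k" for i using box_pos[OF R(2)[OF \<open>x \<in> X\<close> that]] by simp
    then have "Pr x \<noteq> 0" unfolding Pr_def using nz[OF that] T by (auto simp: prod_zero_iff)
    then show ?thesis by (simp add: G_def)
  qed
  define \<eta> where "\<eta> = Min (G ` X)"
  have \<eta>: "0 < \<eta>" "\<And>x. x \<in> X \<Longrightarrow> \<eta> \<le> G x" using X False Gpos by (auto simp: \<eta>_def)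
  \<comment> \<open>On the box the linear form is at most \<open>k * R * \<rho>\<close> in absolute
    value. It therefore shifts differences by at most \<open>2 * k * R * \<rho>\<close>, less than
    the smallest value \<open>\<eta>\<close> of \<open>G\<close> on \<open>X\<close>.\<close>
  define \<rho> where "\<rho> = \<eta> / (2 * k * R + 1)"
  have "0 < 2 * k * R + 1" using R(1) by (simp add: add_nonneg_pos)
  then have \<rho>: "0 < \<rho>" "2 * k * R * \<rho> < \<eta>" using \<eta>
    by (simp_all add: \<rho>_def pos_divide_less_eq)
  have "\<exists>Y. finite Y \<and> card Y = card X \<and> (\<forall>y\<in>Y. \<forall>i<k. P i y = \<epsilon> i) \<and>
        (\<forall>y\<in>Y. \<forall>y'\<in>Y. y \<noteq> y' \<longrightarrow> (\<exists>i<k. y i \<noteq> y' i))"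
    if \<epsilon>: "\<And>i. i < k \<Longrightarrow> 0 < \<epsilon> i \<and> \<epsilon> i < \<rho>" for \<epsilon>
  proof -
    define L where "L y = (\<Sum>i<k. \<epsilon> i * y i)" for y
    have "\<exists>y. (\<forall>i<k. P i y = \<epsilon> i) \<and> (\<forall>t\<in>T. sgn (q t y) = sgn (q t x)) \<and> (\<forall>i\<ge>k. y i = 0)"
      if x: "x \<in> X" for x
    proof -
      \<comment> \<open>Truncation moves the representative into the compact box without changing
        the value of any polynomial.\<close>
      define x0 where "x0 i = (if i < k then x i else 0)" for i
      define B where "B = {y :: nat \<Rightarrow> real. (\<forall>i<k. \<bar>y i\<bar> \<le> R) \<and> (\<forall>i\<ge>k. y i = 0)}"
      define K where "K = B \<inter> {y. \<forall>t\<in>T. 0 \<le> sgn (q t x) * q t y}"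
      have qx0: "q t x0 = q t x" if "t \<in> T" for t
        by (rule mpoly_cong[OF q[OF that]]) (simp add: x0_def)
      have Gx0: "G x0 = G x"
        by (rule mpoly_cong[OF G]) (simp add: x0_def)
      have x0K: "x0 \<in> K" using R(2)[OF x]
        by (auto simp: K_def B_def qx0) (auto simp: x0_def less_imp_le sgn_real_def)
      have "closed {y. \<forall>t\<in>T. 0 \<le> sgn (q t x) * q t y}"
      proof -
        have "closed {y. 0 \<le> sgn (q t x) * q t y}" if "t \<in> T" for t
          by (intro closed_Collect_le continuous_intros mpoly_continuous[OF q[OF that]])
        then have "closed (\<Inter>t\<in>T. {y. 0 \<le> sgn (q t x) * q t y})" by auto
        then show ?thesis by (simp add: Collect_ball_eq)
      qed
      then have "compact K" unfolding K_def B_def using compact_box by (intro compact_Int_closed)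
      moreover have Lm: "mpoly k (0 + 1) L" unfolding L_def
        by (intro mpoly_sum mpoly_mult mpoly_const mpoly_var) auto
      then have "continuous_on K (\<lambda>y. G y - L y)"
        using continuous_on_subset[OF mpoly_continuous[OF G] subset_UNIV]
          continuous_on_subset[OF mpoly_continuous[OF Lm] subset_UNIV] by (intro continuous_on_diff)
      ultimately obtain y where y: "y \<in> K" "\<And>w. w \<in> K \<Longrightarrow> G w - L w \<le> G y - L y"
        using continuous_attains_sup[of K "\<lambda>y. G y - L y"] x0K by blast
      have Labs: "\<bar>L w\<bar> \<le> k * R * \<rho>" if "w \<in> B" for w
      proof -
        have "\<bar>L w\<bar> \<le> (\<Sum>i<k. \<bar>\<epsilon> i * w i\<bar>)" unfolding L_def by (rule sum_abs)
        also have "\<dots> \<le> (\<Sum>i<k. \<rho> * R)"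
        proof (rule sum_mono)
          fix i assume "i \<in> {..<k}"
          then have "\<bar>\<epsilon> i\<bar> \<le> \<rho>" "\<bar>w i\<bar> \<le> R" using \<epsilon>[of i] that by (auto simp: B_def)
          then show "\<bar>\<epsilon> i * w i\<bar> \<le> \<rho> * R" using \<rho>(1) by (simp add: abs_mult mult_mono)
        qed
        finally show ?thesis by (simp add: mult_ac)
      qed
      \<comment> \<open>Positivity of \<open>G\<close> at the maximum point puts this point off all
        walls, hence into the interior of the cell and of the box.\<close>
      have "G x0 - L x0 \<le> G y - L y" using y x0K by blast
      moreover have "\<bar>L x0\<bar> \<le> k * R * \<rho>" "\<bar>L y\<bar> \<le> k * R * \<rho>"
        using Labs x0K y by (auto simp: K_def)
      ultimately have "G y > 0" using \<rho>(2) \<eta>(2)[OF x] Gx0 by (simp add: abs_le_iff)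
      then have Pr: "Pr y \<noteq> 0" by (simp add: G_def)
      have qy: "0 < sgn (q t x) * q t y" if "t \<in> T" for t
      proof -
        have "q t y \<noteq> 0" using Pr that T by (auto simp: Pr_def)
        moreover have "sgn (q t x) \<noteq> 0" using nz[OF x that] by (simp add: sgn_zero_iff)
        moreover have "0 \<le> sgn (q t x) * q t y" using y that by (auto simp: K_def)
        ultimately show ?thesis by (metis less_eq_real_def mult_eq_0_iff)
      qed
      have yR: "\<bar>y i\<bar> < R" if "i < k" for i
      proof -
        have "R\<^sup>2 - y i * y i \<noteq> 0" using Pr that by (auto simp: Pr_def)
        moreover have "\<bar>y i\<bar> \<le> R" using y that by (auto simp: K_def B_def)
        ultimately show ?thesis
          by (metis abs_mult_self_eq eq_iff_diff_eq_0 less_eq_real_def power2_eq_square)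
      qed
      have "P i y = \<epsilon> i" if i: "i < k" for i
      proof -
        have ev: "eventually (\<lambda>s. y(i := s) \<in> K) (nhds (y i))"
        proof -
          have 1: "eventually (\<lambda>s. 0 < sgn (q t x) * q t (y(i := s))) (nhds (y i))" if t: "t \<in> T" for t
          proof -
            obtain q' where "((\<lambda>s. q t (y(i := s))) has_real_derivative q' y) (at (y i))"
              using mpoly_partial_derivative[OF q[OF t] i] by blast
            then have "isCont (\<lambda>s. sgn (q t x) * q t (y(i := s))) (y i)"
              by (intro continuous_intros DERIV_isCont)
            then have "((\<lambda>s. sgn (q t x) * q t (y(i := s))) \<longlongrightarrow> sgn (q t x) * q t y) (nhds (y i))"
              using tendsto_at_iff_tendsto_nhds[of "\<lambda>s. sgn (q t x) * q t (y(i := s))" "y i"]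
              by (simp add: isCont_def del: fun_upd_apply)
            from order_tendstoD(1)[OF this qy[OF t]] show ?thesis .
          qed
          then have "eventually (\<lambda>s. \<forall>t\<in>T. 0 < sgn (q t x) * q t (y(i := s))) (nhds (y i))"
            using T by (intro eventually_ball_finite) auto
          moreover have "eventually (\<lambda>s. s \<in> {-R<..<R}) (nhds (y i))"
            using yR[OF i] by (intro eventually_nhds_in_open) (auto simp: abs_less_iff)
          ultimately show ?thesis
          proof eventually_elim
            case (elim s)
            have "y \<in> B" using y by (simp add: K_def)
            then have "y(i := s) \<in> B" using elim(2) i by (auto simp: B_def abs_le_iff)
            then show ?case using elim(1) by (auto simp: K_def less_imp_le simp del: fun_upd_apply)
          qed
        qed
        then obtain \<delta> where \<delta>: "0 < \<delta>" "\<And>s. dist s (y i) < \<delta> \<Longrightarrow> y(i := s) \<in> K"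
          by (auto simp: eventually_nhds_metric)
        have Ld: "((\<lambda>s. L (y(i := s))) has_real_derivative \<epsilon> i) (at (y i))"
        proof -
          have "L (y(i := s)) = \<epsilon> i * s + (\<Sum>j\<in>{..<k} - {i}. \<epsilon> j * y j)" for s
            unfolding L_def using i by (simp add: sum.remove)
          then show ?thesis by (auto intro!: derivative_eq_intros)
        qed
        have "((\<lambda>s. G (y(i := s)) - L (y(i := s))) has_real_derivative P i y - \<epsilon> i) (at (y i))"
          by (intro DERIV_diff P(2) i Ld)
        moreover have "\<forall>s. \<bar>y i - s\<bar> < \<delta> \<longrightarrow> G (y(i := s)) - L (y(i := s)) \<le> G (y(i := y i)) - L (y(i := y i))"
          using y(2) \<delta>(2) by (simp add: dist_real_def abs_minus_commute del: fun_upd_apply)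
        ultimately have "P i y - \<epsilon> i = 0" using \<delta>(1) DERIV_local_max by blast
        then show ?thesis by simp
      qed
      moreover have "sgn (q t y) = sgn (q t x)" if "t \<in> T" for t
        using qy[OF that] nz[OF x that] by (auto simp: sgn_real_def zero_less_mult_iff split: if_splits)
      moreover have "\<forall>i\<ge>k. y i = 0" using y by (simp add: K_def B_def)
      ultimately show ?thesis by blast
    qed
    then obtain y where y: "\<And>x i. x \<in> X \<Longrightarrow> i < k \<Longrightarrow> P i (y x) = \<epsilon> i"
      "\<And>x t. x \<in> X \<Longrightarrow> t \<in> T \<Longrightarrow> sgn (q t (y x)) = sgn (q t x)"
      "\<And>x i. x \<in> X \<Longrightarrow> k \<le> i \<Longrightarrow> y x i = 0" by metis
    have inj: "inj_on y X"
      by (rule inj_onI) (metis sep y(2))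
    have "\<exists>i<k. y x i \<noteq> y x' i" if "x \<in> X" "x' \<in> X" "y x \<noteq> y x'" for x x'
      using that y(3) by (metis ext not_less)
    then show ?thesis
      using X y(1) card_image[OF inj] by (intro exI[of _ "y ` X"]) auto
  qed
  from card_common_preimages_le[OF k _ P(1) \<rho>(1) this] have "card X \<le> ((k + 2) * D) ^ (k + 1)"
    by (simp add: D_def)
  then show ?thesis by (simp add: D_def mult.commute)
qed simp

text \<open>Zero signs are avoided by replacing each polynomial by two, shifted by
  \<open>\<delta>\<close> and \<open>- \<delta>\<close>, where \<open>\<delta>\<close> is below all
  nonzero absolute values at the representatives. The degree stays the same and the number of
  polynomials doubles.\<close>

lemma card_sign_patterns_le:
  assumes k: "1 \<le> k" and T: "finite T" and p: "\<And>t. t \<in> T \<Longrightarrow> mpoly k d (p t)"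
  shows "finite (range (\<lambda>x. \<lambda>t\<in>T. sgn (p t x)))"
    and "card (range (\<lambda>x. \<lambda>t\<in>T. sgn (p t x))) \<le> ((k + 2) * (2 * (2 * card T * d + 2 * k))) ^ (k + 1)"
proof -
  let ?pat = "\<lambda>x. \<lambda>t\<in>T. sgn (p t x)"
  have "range ?pat \<subseteq> PiE T (\<lambda>_. {-1, 0, 1})" by (auto simp: sgn_real_def split: if_splits)
  then show fin: "finite (range ?pat)"
    using T by (metis finite_PiE finite.emptyI finite.insertI finite_subset)
  obtain X where X: "inj_on ?pat X" "?pat ` X = range ?pat"
    using subset_image_inj[of "range ?pat" ?pat UNIV] by auto
  have finX: "finite X" using fin X by (metis finite_imageD)
  let ?V = "{v \<in> (\<lambda>(x, t). \<bar>p t x\<bar>) ` (X \<times> T). v \<noteq> 0}"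
  obtain \<delta> where \<delta>: "0 < \<delta>" "\<And>x t. x \<in> X \<Longrightarrow> t \<in> T \<Longrightarrow> p t x \<noteq> 0 \<Longrightarrow> \<delta> < \<bar>p t x\<bar>"
  proof -
    have finV: "finite (insert 1 ?V)" using finX T by simp
    let ?m = "Min (insert 1 ?V)"
    have "0 < ?m" using finV by (subst Min_gr_iff) auto
    moreover have "?m \<le> \<bar>p t x\<bar>" if "x \<in> X" "t \<in> T" "p t x \<noteq> 0" for x t
      using finV that by (intro Min_le) auto
    ultimately show ?thesis using that[of "?m / 2"] by force
  qed
  define q where "q = (\<lambda>(t, b) x. p t x - (if b then \<delta> else - \<delta>))"
  have "card X \<le> ((k + 2) * (2 * (card (T \<times> (UNIV :: bool set)) * d + 2 * k))) ^ (k + 1)"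
  proof (rule card_strict_sign_cells_le[OF k])
    show "mpoly k d (q s)" if "s \<in> T \<times> UNIV" for s
      using that p by (auto simp: q_def intro: mpoly_diff mpoly_const)
    show "q s x \<noteq> 0" if "x \<in> X" "s \<in> T \<times> UNIV" for x s
      using \<delta>(2)[of x "fst s"] \<delta>(1) that by (cases "p (fst s) x = 0") (auto simp: q_def split: if_splits)
    show "\<exists>s\<in>T \<times> UNIV. sgn (q s x) \<noteq> sgn (q s x')" if x: "x \<in> X" "x' \<in> X" "x \<noteq> x'" for x x'
    proof -
      have "?pat x \<noteq> ?pat x'" using X x by (auto dest: inj_onD)
      then obtain t where t: "t \<in> T" "sgn (p t x) \<noteq> sgn (p t x')"
        by (auto simp: fun_eq_iff restrict_def split: if_splits)
      \<comment> \<open>The two shifted signs agree if \<open>p t y\<close> is nonzero and cancel if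
        it is zero.\<close>
      have *: "sgn (p t y) = (sgn (q (t, True) y) + sgn (q (t, False) y)) / 2" if "y \<in> X" for y
        using \<delta>(2)[of y t] \<delta>(1) that t by (auto simp: q_def sgn_real_def split: if_splits)
      have "sgn (q (t, True) x) \<noteq> sgn (q (t, True) x') \<or> sgn (q (t, False) x) \<noteq> sgn (q (t, False) x')"
        using t(2) *[OF x(1)] *[OF x(2)] by auto
      then show ?thesis using t by blast
    qed
  qed (use T finX in auto)
  also have "card (T \<times> (UNIV :: bool set)) = 2 * card T" by (simp add: card_cartesian_product)
  finally show "card (range ?pat) \<le> ((k + 2) * (2 * (2 * card T * d + 2 * k))) ^ (k + 1)"
    using card_image[OF X(1)] X(2) by simp
qed

section \<open>Edges that bound a face\<close>

definition cross :: "complex \<Rightarrow> complex \<Rightarrow> real" where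
  "cross a b = Re a * Im b - Im a * Re b"

lemma cross_simps [simp]:
  "cross 0 b = 0" "cross a 0 = 0" "cross a a = 0"
  "cross (a + a') b = cross a b + cross a' b" "cross a (b + b') = cross a b + cross a b'"
  "cross (a - a') b = cross a b - cross a' b" "cross a (b - b') = cross a b - cross a b'"
  "cross (- a) b = - cross a b" "cross a (- b) = - cross a b"
  "cross (r *\<^sub>R a) b = r * cross a b" "cross a (r *\<^sub>R b) = r * cross a b"
  by (simp_all add: cross_def algebra_simps)

lemma cross_commute: "cross a b = - cross b a"
  by (simp add: cross_def)

lemma cross_eq_0_imp_multiple:
  assumes "cross d y = 0" "d \<noteq> 0"
  shows "y = ((d \<bullet> y) / (d \<bullet> d)) *\<^sub>R d"
proof -
  \<comment> \<open>Expansion in the orthogonal vectors \<open>d\<close> and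
    \<open>\<i> * d\<close>.\<close>
  have "(d \<bullet> d) *\<^sub>R y = (d \<bullet> y) *\<^sub>R d + cross d y *\<^sub>R (\<i> * d)"
    by (rule complex_eqI) (simp_all add: inner_complex_def cross_def algebra_simps)
  then have "(d \<bullet> d) *\<^sub>R y = (d \<bullet> y) *\<^sub>R d" using assms(1) by simp
  then have "(1 / (d \<bullet> d)) *\<^sub>R ((d \<bullet> d) *\<^sub>R y) = (1 / (d \<bullet> d)) *\<^sub>R ((d \<bullet> y) *\<^sub>R d)" by simp
  then show ?thesis using assms(2) by simp
qed

text \<open>Cramer's rule in the basis \<open>a\<close>, \<open>b\<close>.\<close>

lemma cross_basis_expansion:
  assumes "cross a b \<noteq> 0"
  shows "y = (cross y b / cross a b) *\<^sub>R a + (cross a y / cross a b) *\<^sub>R b"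
proof -
  have "cross a b *\<^sub>R y = cross y b *\<^sub>R a + cross a y *\<^sub>R b"
    by (rule complex_eqI) (simp_all add: cross_def algebra_simps)
  then have "y = (1 / cross a b) *\<^sub>R (cross y b *\<^sub>R a + cross a y *\<^sub>R b)"
    using assms by (metis divide_self_if scaleR_one scaleR_scaleR times_divide_eq_left mult_1)
  then show ?thesis by (simp add: scaleR_add_right divide_inverse mult.commute)
qed

text \<open>
  An arc in \<open>K\<close> closes the hook \<open>V\<close> to a Jordan curve. The two translates of \<open>V\<close> by small multiples of
  \<open>\<plusminus>t\<close> avoid this curve and are both joined to \<open>F\<close>, so the two sides of the curve near the corner
  \<open>p\<close> lie in the same component of its complement.
\<close>

lemma jordan_hook:
  fixes p x y :: complex
  assumes xy: "cross (x - p) (y - p) \<noteq> 0"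
    and V: "V = closed_segment p x \<union> closed_segment p y"
    and K: "compact K" "path_connected K" "K \<inter> V = {x, y}"
    and Kx: "0 < \<rho>" "\<And>w. w \<in> K \<Longrightarrow> dist w x < \<rho> \<Longrightarrow> cross (x - p) (w - p) = 0"
    and Ky: "\<And>w. w \<in> K \<Longrightarrow> dist w y < \<rho> \<Longrightarrow> cross (y - p) (w - p) = 0"
    and F: "connected F" "F \<inter> V = {}" "F \<inter> K = {}" "0 < e0"
    and Fx: "\<And>e. 0 < e \<Longrightarrow> e < e0 \<Longrightarrow> x + e *\<^sub>R (x - p + (y - p)) \<in> F"
    and Fy: "\<And>e. 0 < e \<Longrightarrow> e < e0 \<Longrightarrow> y - e *\<^sub>R (x - p + (y - p)) \<in> F"
  shows False
proof -
  define a b t where "a = x - p" and "b = y - p" and "t = a + b"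
  have ab: "cross a b \<noteq> 0" using xy by (simp add: a_def b_def)
  have nz: "a \<noteq> 0" "b \<noteq> 0" using ab by auto
  have xp: "x = p + a" and yp: "y = p + b" by (simp_all add: a_def b_def)
  \<comment> \<open>Affine coordinates with origin \<open>p\<close> and axes \<open>a\<close>,
    \<open>b\<close>; the hook consists of the unit intervals on the two axes.\<close>
  define A where "A w = cross (w - p) b / cross a b" for w
  define B where "B w = cross a (w - p) / cross a b" for w
  have expand: "w = p + A w *\<^sub>R a + B w *\<^sub>R b" for w
    using cross_basis_expansion[OF ab, of "w - p"] by (simp add: A_def B_def algebra_simps)
  have AB [simp]: "A (p + r *\<^sub>R a + s *\<^sub>R b) = r" "B (p + r *\<^sub>R a + s *\<^sub>R b) = s" for r s
    using ab by (simp_all add: A_def B_def)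
  have segx: "closed_segment p x = {w. B w = 0 \<and> 0 \<le> A w \<and> A w \<le> 1}"
  proof (intro set_eqI iffI)
    fix w assume "w \<in> closed_segment p x"
    then obtain u where "0 \<le> u" "u \<le> 1" "w = p + u *\<^sub>R a + 0 *\<^sub>R b"
      unfolding closed_segment_def xp by (auto simp: algebra_simps)
    then show "w \<in> {w. B w = 0 \<and> 0 \<le> A w \<and> A w \<le> 1}" by (simp only: AB mem_Collect_eq)
  next
    fix w assume "w \<in> {w. B w = 0 \<and> 0 \<le> A w \<and> A w \<le> 1}"
    then show "w \<in> closed_segment p x"
      using expand[of w] unfolding closed_segment_def xp
      by (auto simp: algebra_simps intro!: exI[of _ "A w"])
  qed
  have segy: "closed_segment p y = {w. A w = 0 \<and> 0 \<le> B w \<and> B w \<le> 1}"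
  proof (intro set_eqI iffI)
    fix w assume "w \<in> closed_segment p y"
    then obtain u where "0 \<le> u" "u \<le> 1" "w = p + 0 *\<^sub>R a + u *\<^sub>R b"
      unfolding closed_segment_def yp by (auto simp: algebra_simps)
    then show "w \<in> {w. A w = 0 \<and> 0 \<le> B w \<and> B w \<le> 1}" by (simp only: AB mem_Collect_eq)
  next
    fix w assume "w \<in> {w. A w = 0 \<and> 0 \<le> B w \<and> B w \<le> 1}"
    then show "w \<in> closed_segment p y"
      using expand[of w] unfolding closed_segment_def yp
      by (auto simp: algebra_simps intro!: exI[of _ "B w"])
  qed
  have Ap [simp]: "A p = 0" "B p = 0" by (simp_all add: A_def B_def)
  have Ax [simp]: "A x = 1" "B x = 0" using ab by (simp_all add: A_def B_def xp)
  have Ay [simp]: "A y = 0" "B y = 1" using ab by (simp_all add: A_def B_def yp)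
  have ne: "x \<noteq> y" "x \<noteq> p" "y \<noteq> p" using Ax Ay Ap by (metis zero_neq_one)+
  have xK: "x \<in> K" "y \<in> K" using K(3) by auto
  obtain g where g: "arc g" "path_image g \<subseteq> K" "pathstart g = y" "pathfinish g = x"
    using K(2) xK ne unfolding path_connected_arcwise by metis
  define f where "f = linepath x p +++ linepath p y"
  have pf: "path_image f = V"
    unfolding f_def V by (simp add: path_image_join closed_segment_commute)
  have "w = p" if "w \<in> closed_segment p x" "w \<in> closed_segment p y" for w
    using that expand[of w] by (simp add: segx segy)
  then have arcf: "arc f" unfolding f_def
    using ne by (intro arc_join) (auto simp: closed_segment_commute)
  define c where "c = f +++ g"
  define C where "C = path_image c"
  have C: "C = V \<union> path_image g"
    unfolding C_def c_def using g pf by (subst path_image_join) (auto simp: f_def)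
  have "simple_path c" unfolding c_def
  proof (rule simple_path_join_loop[OF arcf g(1)])
    show "path_image f \<inter> path_image g \<subseteq> {pathstart f, pathstart g}"
      using K(3) g pf by (auto simp: f_def)
  qed (use g in \<open>auto simp: f_def\<close>)
  moreover have "pathfinish c = pathstart c" by (simp add: c_def f_def g)
  ultimately have J: "open (inside C)" "open (outside C)" "inside C \<inter> outside C = {}"
    "inside C \<union> outside C = - C" "frontier (inside C) = C" "frontier (outside C) = C"
    using Jordan_inside_outside unfolding C_def by blast+
  have pV: "p \<in> V" by (simp add: V)
  have png: "p \<notin> path_image g"
  proof
    assume "p \<in> path_image g"
    then have "p \<in> K \<inter> V" using g(2) pV by (intro IntI subsetD[of _ K])
    then show False using K(3) ne by simp
  qed
  have "open (- path_image g)"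
    using g(1) by (simp add: arc_imp_path closed_path_image open_Compl)
  then obtain d0 where d0: "0 < d0" "ball p d0 \<inter> path_image g = {}"
    using png openE[of "- path_image g" p] by (metis Compl_iff disjoint_eq_subset_Compl)
  define d where "d = min d0 (min (norm a) (norm b))"
  have d: "0 < d" "d \<le> norm a" "d \<le> norm b" "ball p d \<inter> path_image g = {}"
    using d0 nz by (auto simp: d_def)
  define r where "r = min \<rho> (min (norm a) (norm b))"
  have r: "0 < r" "r \<le> \<rho>" "r \<le> norm a" "r \<le> norm b" using Kx nz by (auto simp: r_def)
  have Krx: "B w = 0 \<and> 0 < A w" if "w \<in> K" "dist w x < r" for w
  proof -
    have B0: "B w = 0" using Kx(2)[of w] that r by (simp add: B_def a_def)
    then have "w - x = (A w - 1) *\<^sub>R a" using expand[of w] by (simp add: xp algebra_simps)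
    then have "\<bar>A w - 1\<bar> * norm a < norm a" using that r by (simp add: dist_norm)
    then have "\<bar>A w - 1\<bar> < 1" using nz by simp
    then show ?thesis using B0 by auto
  qed
  have Kry: "A w = 0 \<and> 0 < B w" if "w \<in> K" "dist w y < r" for w
  proof -
    have A0: "A w = 0" using Ky[of w] that r cross_commute[of b "w - p"] by (simp add: A_def b_def)
    then have "w - y = (B w - 1) *\<^sub>R b" using expand[of w] by (simp add: yp algebra_simps)
    then have "\<bar>B w - 1\<bar> * norm b < norm b" using that r by (simp add: dist_norm)
    then have "\<bar>B w - 1\<bar> < 1" using nz by simp
    then show ?thesis using A0 by auto
  qed
  \<comment> \<open>Away from \<open>x\<close> and \<open>y\<close> the distance between
    \<open>K\<close> and the hook is bounded below. Near them \<open>K\<close> lies on the positive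
    half-axes, which the translates do not meet.\<close>
  define K1 where "K1 = K - ball x r - ball y r"
  have "compact K1" unfolding K1_def using K(1) by (intro compact_diff open_ball)
  moreover have "closed V" by (simp add: V closed_Un)
  moreover have "w = x \<or> w = y" if "w \<in> K" "w \<in> V" for w using that K(3) by blast
  then have "K1 \<inter> V = {}" using r by (fastforce simp: K1_def)
  ultimately obtain d1 where d1: "0 < d1" "\<And>w v. w \<in> K1 \<Longrightarrow> v \<in> V \<Longrightarrow> d1 \<le> dist w v"
    using separate_compact_closed by metis
  define e where "e = min (e0 / 2) (min (d1 / (2 * norm t + 1)) (d / (2 * norm t + 1)))"
  have nt: "0 < 2 * norm t + 1" by (simp add: add_nonneg_pos)
  have e: "0 < e" "e < e0" using F(4) d1 d nt by (auto simp: e_def min_def)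
  have et: "e * norm t < d1" "e * norm t < d"
  proof -
    have *: "e * norm t < s" if "0 < s" "e \<le> s / (2 * norm t + 1)" for s
    proof -
      have "e * (2 * norm t + 1) \<le> s" using that nt by (simp add: pos_le_divide_eq)
      moreover have "e * norm t < e * (2 * norm t + 1)"
        using e(1) by (intro mult_strict_left_mono) (auto simp: add_nonneg_pos)
      ultimately show ?thesis by simp
    qed
    show "e * norm t < d1" using d1(1) by (intro *) (auto simp: e_def)
    show "e * norm t < d" using d(1) by (intro *) (auto simp: e_def)
  qed
  define Vs where "Vs s = (\<lambda>w. w + s *\<^sub>R t) ` V" for s :: real
  have ABs: "A (w + s *\<^sub>R t) = A w + s" "B (w + s *\<^sub>R t) = B w + s" for w s
    using ab by (simp_all add: A_def B_def t_def field_simps)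
  have Vcond: "(B w = 0 \<and> 0 \<le> A w \<and> A w \<le> 1) \<or> (A w = 0 \<and> 0 \<le> B w \<and> B w \<le> 1)" if "w \<in> V" for w
    using that by (auto simp: V segx segy)
  have conV: "connected V" unfolding V
    by (intro connected_Un) auto
  have conVs: "connected (Vs s)" for s unfolding Vs_def
    by (intro connected_continuous_image continuous_intros conV)
  have VsC: "Vs s \<inter> C = {}" if s: "s = e \<or> s = - e" for s
  proof -
    have False if w: "w \<in> V" and mem: "w + s *\<^sub>R t \<in> C" for w
    proof -
      have notV: "w + s *\<^sub>R t \<notin> V"
        using Vcond[OF w] Vcond[of "w + s *\<^sub>R t"] s e(1) by (auto simp: ABs)
      then have inK: "w + s *\<^sub>R t \<in> K" using mem C g by auto
      have "\<not> dist (w + s *\<^sub>R t) x < r" using Krx[OF inK] Vcond[OF w] s e(1) by (auto simp: ABs)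
      moreover have "\<not> dist (w + s *\<^sub>R t) y < r" using Kry[OF inK] Vcond[OF w] s e(1) by (auto simp: ABs)
      ultimately have "w + s *\<^sub>R t \<in> K1" using inK by (auto simp: K1_def dist_commute)
      from d1(2)[OF this w] have "d1 \<le> e * norm t" using s e(1) by (auto simp: dist_norm)
      then show False using et by simp
    qed
    then show ?thesis by (auto simp: Vs_def)
  qed
  \<comment> \<open>Near the corner the complement of the hook is the union of the open quadrant
    \<open>P\<close> and the half-discs \<open>N1\<close> and \<open>N2\<close>. One translate leads
    into \<open>P\<close>, the other into both half-discs.\<close>
  define P where "P = ball p d \<inter> {w. 0 < A w} \<inter> {w. 0 < B w}"
  define N1 where "N1 = ball p d \<inter> {w. A w < 0}"
  define N2 where "N2 = ball p d \<inter> {w. B w < 0}"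
  have Aaff: "A ((1 - u) *\<^sub>R v + u *\<^sub>R w) = (1 - u) * A v + u * A w"
    "B ((1 - u) *\<^sub>R v + u *\<^sub>R w) = (1 - u) * B v + u * B w" for u v w
    using ab by (simp_all add: A_def B_def field_simps)
  have cvx: "convex {w. 0 < A w}" "convex {w. 0 < B w}" "convex {w. A w < 0}" "convex {w. B w < 0}"
    unfolding convex_alt by (auto simp: Aaff)
      (smt (verit, best) mult_nonneg_nonneg mult_pos_pos mult_nonneg_nonpos mult_pos_neg)+
  have con: "connected P" "connected N1" "connected N2"
    unfolding P_def N1_def N2_def by (intro convex_connected convex_Int convex_ball cvx)+
  have pt: "p + e *\<^sub>R t \<in> P" "p - e *\<^sub>R t \<in> N1" "p - e *\<^sub>R t \<in> N2"
    using et(2) e(1) ABs[of p e] ABs[of p "- e"] by (auto simp: P_def N1_def N2_def dist_norm)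
  have xt: "x + e *\<^sub>R t \<in> F" "y - e *\<^sub>R t \<in> F"
    using Fx[OF e] Fy[OF e] by (auto simp: t_def a_def b_def)
  have inVs: "p + e *\<^sub>R t \<in> Vs e" "x + e *\<^sub>R t \<in> Vs e" "p - e *\<^sub>R t \<in> Vs (- e)" "y - e *\<^sub>R t \<in> Vs (- e)"
    unfolding Vs_def by (auto simp: V intro!: image_eqI[of _ _ p] image_eqI[of _ _ x] image_eqI[of _ _ y])
  define S where "S = (((F \<union> Vs e) \<union> P) \<union> Vs (- e)) \<union> N1 \<union> N2"
  have conS: "connected S" unfolding S_def
    by (intro connected_Un F con conVs) (use pt xt inVs in blast)+
  have ballV: "w \<notin> C" if "w \<in> ball p d" "w \<notin> V" for w
    using that C d(4) by auto
  have FC: "F \<inter> C = {}" unfolding C using F(2,3) g(2) by (simp add: Int_Un_distrib) (metis Int_mono bot.extremum_uniqueI order_refl)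
  have PNC: "P \<inter> C = {}" "N1 \<inter> C = {}" "N2 \<inter> C = {}"
    using ballV Vcond by (fastforce simp: P_def N1_def N2_def)+
  have "S \<inter> C = {}"
    unfolding S_def by (simp add: Int_Un_distrib2 VsC FC PNC)
  then have SC: "S \<subseteq> inside C \<union> outside C" unfolding J(4) by (simp add: disjoint_eq_subset_Compl)
  have ballS: "w \<in> S" if "w \<in> ball p d" "w \<notin> C" for w
  proof (rule ccontr)
    assume "w \<notin> S"
    then have "w \<notin> P" "w \<notin> N1" "w \<notin> N2" by (auto simp: S_def)
    then have AB0: "0 \<le> A w" "0 \<le> B w" "A w = 0 \<or> B w = 0"
      using that by (auto simp: P_def N1_def N2_def)
    have "w \<in> V"
    proof (cases "A w = 0")
      case True
      then have "w - p = B w *\<^sub>R b" using expand[of w] by (simp add: algebra_simps)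
      then have "norm (w - p) = B w * norm b" using AB0 by simp
      then have "B w * norm b < norm b" using that(1) d(3) by (simp add: dist_norm norm_minus_commute)
      then have "B w < 1" using nz by simp
      then show ?thesis using True AB0 by (auto simp: V segy)
    next
      case False
      then have "B w = 0" using AB0 by simp
      then have "w - p = A w *\<^sub>R a" using expand[of w] by (simp add: algebra_simps)
      then have "norm (w - p) = A w * norm a" using AB0 by simp
      then have "A w * norm a < norm a" using that(1) d(2) by (simp add: dist_norm norm_minus_commute)
      then have "A w < 1" using nz by simp
      then show ?thesis using \<open>B w = 0\<close> AB0 by (auto simp: V segx)
    qed
    then show False using that C by simp
  qed
  have pC: "p \<in> C" using pV C by simp
  \<comment> \<open>The corner is a frontier point of both sides of the curve, so the small ball
    contains points of both; yet off the curve the ball lies in the connected set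
    \<open>S\<close>.\<close>
  have "p \<in> closure (inside C)" "p \<in> closure (outside C)"
    using pC J(5,6) by (auto simp: frontier_def)
  then obtain w1 w2 where w: "w1 \<in> inside C" "w1 \<in> ball p d" "w2 \<in> outside C" "w2 \<in> ball p d"
    using d(1) unfolding closure_approachable by (metis dist_commute mem_ball)
  then have "w1 \<in> S" "w2 \<in> S" using ballS J(4) by blast+
  then show False
    using connectedD[OF conS J(1,2)] SC J(3) w by blast
qed

section \<open>Edges touched by a connected region\<close>

abbreviation tip :: "bool \<Rightarrow> complex \<times> complex \<Rightarrow> complex" where
  "tip b e \<equiv> (if b then fst e else snd e)"

abbreviation sg :: "bool \<Rightarrow> real" where "sg b \<equiv> (if b then 1 else - 1)"

text \<open>\<open>True\<close> selects the tail and \<open>False\<close> the head, so that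
  statements about a common end are proved once for both. The factor \<open>sg\<close> compensates
  for the arm at the head running against the edge.\<close>

definition arm :: "bool \<Rightarrow> complex \<times> complex \<Rightarrow> complex" where
  "arm b e = tip (\<not> b) e - tip b e"

abbreviation seg :: "complex \<times> complex \<Rightarrow> complex set" where
  "seg e \<equiv> closed_segment (fst e) (snd e)"

text \<open>
  The edges are directed such that the region \<open>F\<close> touches each edge \<open>e\<close> from the left at the point \<open>z e\<close>,
  and such that all of them point into the half-plane of \<open>w\<close>.
\<close>

locale touched_edges =
  fixes S :: "(complex \<times> complex) set" and F :: "complex set"
    and z :: "complex \<times> complex \<Rightarrow> complex" and w :: complex
  assumes fin: "finite S"
    and conF: "connected F"
    and avoid: "\<And>e. e \<in> S \<Longrightarrow> F \<inter> seg e = {}"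
    and zin: "\<And>e. e \<in> S \<Longrightarrow> z e \<in> open_segment (fst e) (snd e)"
    and zout: "\<And>e e'. e \<in> S \<Longrightarrow> e' \<in> S \<Longrightarrow> e \<noteq> e' \<Longrightarrow> z e \<notin> seg e'"
    and touch: "\<And>e. e \<in> S \<Longrightarrow> \<exists>\<rho>>0. \<forall>y. dist y (z e) < \<rho> \<longrightarrow> 0 < cross (snd e - fst e) (y - z e) \<longrightarrow> y \<in> F"
    and gp: "\<And>e e' b. e \<in> S \<Longrightarrow> e' \<in> S \<Longrightarrow> e \<noteq> e' \<Longrightarrow> tip b e = tip b e' \<Longrightarrow> cross (arm b e) (arm b e') \<noteq> 0"
    and pos: "\<And>e. e \<in> S \<Longrightarrow> 0 < w \<bullet> (snd e - fst e)"
begin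

text \<open>
  \<open>a\<close> leaves the common tail (\<open>b = True\<close>) or enters the common head (\<open>b = False\<close>) on the side of \<open>e\<close>
  on which \<open>F\<close> touches \<open>e\<close>.
\<close>

definition up :: "bool \<Rightarrow> complex \<times> complex \<Rightarrow> complex \<times> complex \<Rightarrow> bool" where
  "up b e a \<longleftrightarrow> e \<in> S \<and> a \<in> S \<and> tip b e = tip b a \<and> 0 < sg b * cross (arm b e) (arm b a)"

lemma dir_arm: "snd e - fst e = sg b *\<^sub>R arm b e"
  by (simp add: arm_def)

lemma arm_flip: "arm (\<not> b) e = - arm b e"
  by (simp add: arm_def)

lemma tip_flip: "tip (\<not> b) e = tip b e + arm b e"
  by (simp add: arm_def)

lemma arm_nz: "e \<in> S \<Longrightarrow> arm b e \<noteq> 0"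
  using pos[of e] by (auto simp: arm_def)

lemma segD: "y \<in> seg e \<Longrightarrow> \<exists>s. 0 \<le> s \<and> s \<le> 1 \<and> y = tip b e + s *\<^sub>R arm b e"
proof -
  assume "y \<in> seg e"
  then obtain u where u: "0 \<le> u" "u \<le> 1" "y = (1 - u) *\<^sub>R fst e + u *\<^sub>R snd e"
    by (auto simp: closed_segment_def)
  show ?thesis
  proof (cases b)
    case True
    then show ?thesis using u by (intro exI[of _ u]) (auto simp: arm_def algebra_simps)
  next
    case False
    then show ?thesis using u by (intro exI[of _ "1 - u"]) (auto simp: arm_def algebra_simps)
  qed
qed

lemma zD: "e \<in> S \<Longrightarrow> \<exists>s. 0 < s \<and> s < 1 \<and> z e = tip b e + s *\<^sub>R arm b e"
proof -
  assume e: "e \<in> S"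
  then have zo: "z e \<in> open_segment (fst e) (snd e)" by (rule zin)
  then have "z e \<in> seg e" "z e \<noteq> fst e" "z e \<noteq> snd e" by (auto simp: open_segment_def)
  with segD[of "z e" e b] obtain s where s: "0 \<le> s" "s \<le> 1" "z e = tip b e + s *\<^sub>R arm b e" by blast
  have "s \<noteq> 0" "s \<noteq> 1" using s \<open>z e \<noteq> fst e\<close> \<open>z e \<noteq> snd e\<close>
    by (auto simp: arm_def split: if_splits)
  then show ?thesis using s by (intro exI[of _ s]) auto
qed

lemma tip_in_seg: "tip b e \<in> seg e"
  by auto

lemma arm_segment_subset: "e \<in> S \<Longrightarrow> closed_segment (tip b e) (z e) \<subseteq> seg e"
  using zin[of e] by (intro closed_segment_subset) (auto simp: open_segment_def)

lemma arm_segments_disjoint: "e \<in> S \<Longrightarrow> closed_segment (tip b e) (z e) \<inter> closed_segment (tip (\<not> b) e) (z e) = {z e}"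
proof -
  assume e: "e \<in> S"
  have "closed_segment (fst e) (z e) \<inter> closed_segment (z e) (snd e) = {z e}"
    using zin[OF e] by (intro Int_closed_segment) (auto simp: open_segment_def)
  then show ?thesis by (auto simp: closed_segment_commute)
qed

lemma tip_notin_other_arm: "e \<in> S \<Longrightarrow> tip b e \<notin> closed_segment (tip (\<not> b) e) (z e)"
proof
  assume e: "e \<in> S" and "tip b e \<in> closed_segment (tip (\<not> b) e) (z e)"
  then have "tip b e \<in> closed_segment (tip b e) (z e) \<inter> closed_segment (tip (\<not> b) e) (z e)"
    by (intro IntI ends_in_segment)
  then have "tip b e = z e" unfolding arm_segments_disjoint[OF e] by simp
  then show False using zin[OF e] by (cases b) (auto simp: open_segment_def)
qed

lemma segs_meet_at_tip:
  assumes "e \<in> S" "a \<in> S" "e \<noteq> a" "tip b e = tip b a" "y \<in> seg e" "y \<in> seg a"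
  shows "y = tip b e"
proof -
  obtain s t where "y = tip b e + s *\<^sub>R arm b e" "y = tip b a + t *\<^sub>R arm b a"
    using segD assms by blast
  then have eq: "s *\<^sub>R arm b e = t *\<^sub>R arm b a" using assms(4) by simp
  have "cross (arm b e) (s *\<^sub>R arm b e) = cross (arm b e) (t *\<^sub>R arm b a)" by (simp only: eq)
  then have "t = 0" using gp[OF assms(1-4)] by simp
  then show ?thesis using \<open>y = tip b a + t *\<^sub>R arm b a\<close> assms(4) by simp
qed

lemma touch_pt:
  assumes "e \<in> S" "0 < cross (snd e - fst e) v"
  shows "\<exists>\<delta>>0. \<forall>t. 0 < t \<longrightarrow> t < \<delta> \<longrightarrow> z e + t *\<^sub>R v \<in> F"
proof -
  obtain \<rho> where \<rho>: "0 < \<rho>" "\<And>y. dist y (z e) < \<rho> \<Longrightarrow> 0 < cross (snd e - fst e) (y - z e) \<Longrightarrow> y \<in> F"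
    using touch[OF assms(1)] by blast
  have "z e + t *\<^sub>R v \<in> F" if t: "0 < t" "t < \<rho> / (norm v + 1)" for t
  proof (rule \<rho>(2))
    have "t * (norm v + 1) < \<rho>" using t by (simp add: pos_less_divide_eq add_nonneg_pos)
    moreover have "t * norm v \<le> t * (norm v + 1)" using t by (intro mult_left_mono) auto
    ultimately have "t * norm v < \<rho>" by linarith
    then show "dist (z e + t *\<^sub>R v) (z e) < \<rho>" using t by (simp add: dist_norm)
    show "0 < cross (snd e - fst e) (z e + t *\<^sub>R v - z e)"
      using mult_pos_pos[OF t(1) assms(2)] by simp
  qed
  moreover have "0 < \<rho> / (norm v + 1)" using \<rho> by (simp add: add_nonneg_pos)
  ultimately show ?thesis by blast
qed

text \<open>Supplies the condition of \<open>jordan_hook\<close> that the closing set runs along the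
  lines of the hook near the two ends of the hook.\<close>

lemma isolated:
  assumes "e \<in> S"
  shows "\<exists>\<rho>>0. \<forall>y\<in>\<Union>(seg ` S). dist y (z e) < \<rho> \<longrightarrow> y \<in> seg e"
proof -
  define X where "X = \<Union>(seg ` (S - {e}))"
  have "closed X" unfolding X_def using fin by (intro closed_Union) auto
  then have "open (- X)" by (rule open_Compl)
  moreover have "z e \<in> - X" using zout[OF assms] by (auto simp: X_def)
  ultimately obtain \<rho> where \<rho>: "0 < \<rho>" "ball (z e) \<rho> \<subseteq> - X" by (rule openE)
  have "y \<in> seg e" if "y \<in> \<Union>(seg ` S)" "dist y (z e) < \<rho>" for y
  proof -
    have "y \<notin> X" using that(2) \<rho>(2) by (metis ComplD dist_commute mem_ball subsetD)
    then show ?thesis using that(1) unfolding X_def by blast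
  qed
  then show ?thesis using \<rho>(1) by blast
qed

text \<open>\<open>F\<close> touches \<open>e\<close> from within the angle between \<open>e\<close>
  and \<open>a\<close>, but touches \<open>a\<close> from outside this angle. A set \<open>K\<close>
  that joins the two touching points and meets the hook nowhere else would close the hook to a curve
  with the connected \<open>F\<close> on both of its sides.\<close>

lemma no_loop:
  assumes u: "up b e a"
    and V: "V = closed_segment (tip b e) (z e) \<union> closed_segment (tip b e) (z a)"
    and K: "compact K" "path_connected K" "K \<subseteq> \<Union>(seg ` S)" "K \<inter> V = {z e, z a}"
  shows False
proof -
  let ?p = "tip b e"
  have ea: "e \<in> S" "a \<in> S" "tip b a = ?p" "0 < sg b * cross (arm b e) (arm b a)"
    using u by (auto simp: up_def)
  obtain s where s: "0 < s" "s < 1" "z e = ?p + s *\<^sub>R arm b e" using zD[OF ea(1)] by blast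
  obtain t where t: "0 < t" "t < 1" "z a = ?p + t *\<^sub>R arm b a" using zD[OF ea(2), of b] ea(3) by auto
  define v where "v = z e - ?p + (z a - ?p)"
  have v: "v = s *\<^sub>R arm b e + t *\<^sub>R arm b a" by (simp add: v_def s t)
  have "0 < cross (snd e - fst e) v"
    using mult_pos_pos[OF t(1) ea(4)] unfolding v dir_arm[of e b] by (simp add: mult_ac)
  from touch_pt[OF ea(1) this] obtain d1 where d1: "0 < d1" "\<And>r. 0 < r \<Longrightarrow> r < d1 \<Longrightarrow> z e + r *\<^sub>R v \<in> F" by blast
  have "0 < cross (snd a - fst a) (- v)"
    using mult_pos_pos[OF s(1) ea(4)] cross_commute[of "arm b a" "arm b e"] unfolding v dir_arm[of a b] by (simp add: mult_ac)
  from touch_pt[OF ea(2) this] obtain d2 where d2: "0 < d2" "\<And>r. 0 < r \<Longrightarrow> r < d2 \<Longrightarrow> z a - r *\<^sub>R v \<in> F" by auto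
  obtain r1 where r1: "0 < r1" "\<And>y. y \<in> \<Union>(seg ` S) \<Longrightarrow> dist y (z e) < r1 \<Longrightarrow> y \<in> seg e"
    using isolated[OF ea(1)] by blast
  obtain r2 where r2: "0 < r2" "\<And>y. y \<in> \<Union>(seg ` S) \<Longrightarrow> dist y (z a) < r2 \<Longrightarrow> y \<in> seg a"
    using isolated[OF ea(2)] by blast
  show False
  proof (rule jordan_hook[OF _ V K(1,2,4), of "min r1 r2" F "min d1 d2"])
    show "cross (z e - ?p) (z a - ?p) \<noteq> 0" using s t ea(4) by auto
    show "cross (z e - ?p) (y - ?p) = 0" if "y \<in> K" "dist y (z e) < min r1 r2" for y
    proof -
      have "y \<in> seg e" using r1(2)[of y] that K(3) by auto
      then obtain q where "y = ?p + q *\<^sub>R arm b e" using segD by blast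
      then show ?thesis by (simp add: s)
    qed
    show "cross (z a - ?p) (y - ?p) = 0" if "y \<in> K" "dist y (z a) < min r1 r2" for y
    proof -
      have "y \<in> seg a" using r2(2)[of y] that K(3) by auto
      then obtain q where "y = ?p + q *\<^sub>R arm b a" using segD[of y a b] ea(3) by auto
      then show ?thesis by (simp add: t)
    qed
    show "F \<inter> V = {}"
      using arm_segment_subset[OF ea(1), of b] arm_segment_subset[OF ea(2), of b] ea(3) avoid[OF ea(1)] avoid[OF ea(2)]
      unfolding V by auto
    show "F \<inter> K = {}" using K(3) avoid by blast
    show "z e + r *\<^sub>R (z e - ?p + (z a - ?p)) \<in> F" if "0 < r" "r < min d1 d2" for r
      using d1(2)[of r] that unfolding v_def by simp
    show "z a - r *\<^sub>R (z e - ?p + (z a - ?p)) \<in> F" if "0 < r" "r < min d1 d2" for r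
      using d2(2)[of r] that unfolding v_def by simp
  qed (use r1 r2 d1 d2 conF in auto)
qed

text \<open>\<open>e0\<close> and \<open>e2\<close> start at different ends of \<open>e1\<close> and
  lie on opposite sides of its line.\<close>

lemma zigzag_disjoint:
  assumes "up b e0 e1" "up (\<not> b) e1 e2"
  shows "seg e0 \<inter> seg e2 = {}"
proof (rule ccontr)
  assume "\<not> ?thesis"
  then obtain y where y: "y \<in> seg e0" "y \<in> seg e2" by blast
  have S1: "e1 \<in> S" using assms by (simp add: up_def)
  have t1: "tip b e0 = tip b e1" "tip (\<not> b) e2 = tip b e1 + arm b e1"
    using assms tip_flip[of b e1] by (auto simp: up_def)
  have c1: "0 < sg b * cross (arm b e0) (arm b e1)" using assms by (simp add: up_def)
  have c2: "0 < sg b * cross (arm b e1) (arm (\<not> b) e2)"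
    using assms(2) unfolding up_def arm_flip[of b e1] by auto
  obtain s where s: "0 \<le> s" "y = tip b e1 + s *\<^sub>R arm b e0" using segD[OF y(1), of b] t1 by auto
  obtain t where t: "0 \<le> t" "y = tip b e1 + arm b e1 + t *\<^sub>R arm (\<not> b) e2" using segD[OF y(2), of "\<not> b"] t1 by metis
  have eq: "s *\<^sub>R arm b e0 = arm b e1 + t *\<^sub>R arm (\<not> b) e2" using s t by (simp add: algebra_simps)
  have "cross (arm b e1) (s *\<^sub>R arm b e0) = cross (arm b e1) (arm b e1 + t *\<^sub>R arm (\<not> b) e2)"
    by (simp only: eq)
  then have "s * (sg b * cross (arm b e0) (arm b e1)) + t * (sg b * cross (arm b e1) (arm (\<not> b) e2)) = 0"
    using cross_commute[of "arm b e0" "arm b e1"] by (simp add: algebra_simps)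
  moreover have "0 \<le> s * (sg b * cross (arm b e0) (arm b e1))" "0 \<le> t * (sg b * cross (arm b e1) (arm (\<not> b) e2))"
    using s t c1 c2 by (simp_all add: less_imp_le del: if_split)
  ultimately have "s * (sg b * cross (arm b e0) (arm b e1)) = 0" "t * (sg b * cross (arm b e1) (arm (\<not> b) e2)) = 0"
    by linarith+
  then have "s = 0" "t = 0" using c1 c2 by (metis less_irrefl mult_eq_0_iff)+
  then show False using eq arm_nz[OF S1] by simp
qed

text \<open>Both \<open>a\<close> and \<open>c\<close> lie on the side of \<open>e\<close> that
  \<open>F\<close> touches. If they met, the three edges would contain the boundary of a triangle.
  \<open>F\<close> enters this triangle next to \<open>e\<close> and, since it touches
  \<open>a\<close> from the far side, also lies outside, although it cannot cross the
  boundary.\<close>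

lemma valley_arms_disjoint:
  assumes "up b e a" "up (\<not> b) e c"
  shows "closed_segment (tip b e) (z a) \<inter> closed_segment (tip (\<not> b) e) (z c) = {}"
proof (rule ccontr)
  assume "\<not> ?thesis"
  then obtain y where y: "y \<in> closed_segment (tip b e) (z a)" "y \<in> closed_segment (tip (\<not> b) e) (z c)" by blast
  let ?p = "tip b e" and ?q = "tip (\<not> b) e"
  have mem: "e \<in> S" "a \<in> S" "c \<in> S" and ta: "tip b a = ?p" and tc: "tip (\<not> b) c = ?q"
    using assms by (auto simp: up_def)
  have ca: "0 < sg b * cross (arm b e) (arm b a)" using assms by (simp add: up_def)
  have cc: "0 < sg b * cross (arm b e) (arm (\<not> b) c)"
    using assms(2) unfolding up_def arm_flip[of b e] by auto
  have ya: "y \<in> seg a" and yc: "y \<in> seg c"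
    using y arm_segment_subset[OF mem(2), of b] arm_segment_subset[OF mem(3), of "\<not> b"] ta tc by auto
  obtain s where s: "0 \<le> s" "y = ?p + s *\<^sub>R arm b a" using segD[OF ya, of b] ta by auto
  obtain t where t: "0 \<le> t" "y = ?p + arm b e + t *\<^sub>R arm (\<not> b) c"
    using segD[OF yc, of "\<not> b"] tc tip_flip[of b e] by metis
  have "s \<noteq> 0"
  proof
    assume "s = 0"
    then have eq: "arm b e + t *\<^sub>R arm (\<not> b) c = 0" using s t by simp
    have "cross (arm b e) (arm b e + t *\<^sub>R arm (\<not> b) c) = 0" by (simp only: eq cross_simps)
    then have "t = 0" using cc by auto
    then show False using eq arm_nz[OF mem(1)] by simp
  qed
  then have s0: "0 < s" using s by simp
  define H where "H = convex hull {?p, ?q, y}"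
  have front: "frontier H = closed_segment ?p ?q \<union> closed_segment ?q y \<union> closed_segment y ?p"
    unfolding H_def by (rule frontier_of_triangle) simp
  have "closed_segment ?p ?q \<subseteq> seg e" by (auto simp: closed_segment_commute)
  moreover have "closed_segment ?q y \<subseteq> seg c"
    using yc tip_in_seg[of "\<not> b" c] tc by (intro closed_segment_subset) auto
  moreover have "closed_segment y ?p \<subseteq> seg a"
    using ya tip_in_seg[of b a] ta by (intro closed_segment_subset) auto
  ultimately have FH: "F \<inter> frontier H = {}" using avoid mem unfolding front by blast
  obtain m where m: "0 < m" "m < 1" "z e = ?p + m *\<^sub>R arm b e" using zD[OF mem(1)] by blast
  have "0 < cross (snd e - fst e) (y - z e)"
    using mult_pos_pos[OF s0 ca] unfolding dir_arm[of e b] m s by (simp add: mult_ac)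
  from touch_pt[OF mem(1) this] obtain d where d: "0 < d" "\<And>r. 0 < r \<Longrightarrow> r < d \<Longrightarrow> z e + r *\<^sub>R (y - z e) \<in> F"
    by blast
  define r where "r = min (d / 2) 1"
  have r: "0 < r" "r < d" "r \<le> 1" using d by (auto simp: r_def)
  have "z e \<in> H"
  proof -
    have "closed_segment ?p ?q \<subseteq> H" unfolding H_def
      by (intro closed_segment_subset convex_convex_hull hull_inc) auto
    moreover have "z e \<in> closed_segment ?p ?q"
      using zin[OF mem(1)] by (auto simp: open_segment_def closed_segment_commute)
    ultimately show ?thesis by blast
  qed
  moreover have "y \<in> H" unfolding H_def by (intro hull_inc) auto
  moreover have "z e + r *\<^sub>R (y - z e) = (1 - r) *\<^sub>R z e + r *\<^sub>R y" by (simp add: algebra_simps)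
  ultimately have "z e + r *\<^sub>R (y - z e) \<in> H"
    using r convexD_alt[of H "z e" y r] by (simp add: H_def convex_convex_hull)
  then have 1: "F \<inter> H \<noteq> {}" using d(2)[OF r(1,2)] by blast
  have "0 < cross (snd a - fst a) (- arm b e)"
    using ca cross_commute[of "arm b a" "arm b e"] unfolding dir_arm[of a b] by simp
  from touch_pt[OF mem(2) this] obtain d' where d': "0 < d'" "\<And>r. 0 < r \<Longrightarrow> r < d' \<Longrightarrow> z a - r *\<^sub>R arm b e \<in> F"
    by auto
  let ?y' = "z a - (d' / 2) *\<^sub>R arm b e"
  have "?y' \<notin> H"
  proof
    assume yH: "?y' \<in> H"
    \<comment> \<open>This functional is nonpositive on the triangle, but positive at the points of
      \<open>F\<close> next to \<open>z a\<close>.\<close>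
    let ?L = "\<lambda>x. sg b * cross (arm b a) (x - ?p)"
    have "H \<subseteq> {x. ?L x \<le> 0}" unfolding H_def
    proof (rule hull_minimal)
      have "?L ?q \<le> 0" using ca cross_commute[of "arm b a" "arm b e"] tip_flip[of b e] by (auto split: if_splits)
      then show "{?p, ?q, y} \<subseteq> {x. ?L x \<le> 0}" by (auto simp: s split: if_splits)
      show "convex {x. ?L x \<le> 0}"
      proof -
        have *: "?L ((1 - u) *\<^sub>R x + u *\<^sub>R x') = (1 - u) * ?L x + u * ?L x'" for u x x'
          by (simp add: algebra_simps)
        show ?thesis unfolding convex_alt
        proof (intro ballI allI impI)
          fix x x' u assume "x \<in> {x. ?L x \<le> 0}" "x' \<in> {x. ?L x \<le> 0}" "0 \<le> (u::real) \<and> u \<le> 1"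
          then have "(1 - u) * ?L x \<le> 0" "u * ?L x' \<le> 0" by (simp_all add: mult_nonneg_nonpos del: if_split)
          then show "(1 - u) *\<^sub>R x + u *\<^sub>R x' \<in> {x. ?L x \<le> 0}" using *[of u x x'] by (simp del: if_split)
        qed
      qed
    qed
    then have "?L ?y' \<le> 0" using yH by blast
    moreover obtain k where "z a = ?p + k *\<^sub>R arm b a" using zD[OF mem(2), of b] ta by auto
    then have "?L ?y' = (d' / 2) * (sg b * cross (arm b e) (arm b a))"
      using cross_commute[of "arm b a" "arm b e"] by (simp add: algebra_simps)
    moreover have "0 < (d' / 2) * (sg b * cross (arm b e) (arm b a))"
      by (rule mult_pos_pos[OF _ ca]) (use d'(1) in simp)
    ultimately show False by linarith
  qed
  then have 2: "F - H \<noteq> {}" using d'(2)[of "d' / 2"] d'(1) by auto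
  show False using connected_Int_frontier[OF conF 1 2] FH by simp
qed

lemma up_irrefl: "\<not> up b e e"
  by (simp add: up_def)

lemma up_distinct: "up b e a \<Longrightarrow> e \<noteq> a"
  by (auto simp: up_irrefl)

section \<open>Alternating chains of edges\<close>

lemma path_connected_chain:
  assumes "\<And>i. a \<le> i \<Longrightarrow> i \<le> a + n \<Longrightarrow> path_connected (V i)"
    and "\<And>i. a \<le> i \<Longrightarrow> i < a + n \<Longrightarrow> V i \<inter> V (Suc i) \<noteq> {}"
  shows "path_connected (\<Union>i\<in>{a..a + n}. V i)"
  using assms
proof (induction n)
  case 0
  from 0(1)[of a] show ?case by auto
next
  case (Suc n)
  have "{a..a + Suc n} = insert (Suc (a + n)) {a..a + n}" by auto
  then have eq: "(\<Union>i\<in>{a..a + Suc n}. V i) = (\<Union>i\<in>{a..a + n}. V i) \<union> V (Suc (a + n))" by auto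
  have "V (a + n) \<inter> V (Suc (a + n)) \<noteq> {}" using Suc.prems(2)[of "a + n"] by simp
  then have "(\<Union>i\<in>{a..a + n}. V i) \<inter> V (Suc (a + n)) \<noteq> {}" by fastforce
  moreover have "path_connected (\<Union>i\<in>{a..a + n}. V i)"
    using Suc.prems by (intro Suc.IH) auto
  moreover have "path_connected (V (Suc (a + n)))" using Suc.prems(1) by simp
  ultimately show ?case unfolding eq by (intro path_connected_Un)
qed

context
  fixes ed :: "nat \<Rightarrow> complex \<times> complex" and bb :: "nat \<Rightarrow> bool" and l m :: nat
  assumes bb: "\<And>i. bb (Suc i) = (\<not> bb i)"
    and dn: "\<And>i. i < l \<Longrightarrow> i < m \<Longrightarrow> up (bb i) (ed (Suc i)) (ed i)"
    and upw: "\<And>i. l \<le> i \<Longrightarrow> i < m \<Longrightarrow> up (bb i) (ed i) (ed (Suc i))"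
begin

text \<open>The chain descends for \<open>l\<close> steps and ascends afterwards, so that pure
  ascents and pairs of ascents from one edge are treated together. The hooks link the touching
  points of successive edges through their common ends.\<close>

definition hook :: "nat \<Rightarrow> complex set" where
  "hook i = closed_segment (tip (bb i) (ed i)) (z (ed i)) \<union> closed_segment (tip (bb i) (ed i)) (z (ed (Suc i)))"

lemma chain_step:
  assumes "i < m"
  shows "ed i \<in> S" "ed (Suc i) \<in> S" "tip (bb i) (ed i) = tip (bb i) (ed (Suc i))" "ed i \<noteq> ed (Suc i)"
    "up (bb i) (ed (Suc i)) (ed i) \<or> up (bb i) (ed i) (ed (Suc i))"
proof -
  show d: "up (bb i) (ed (Suc i)) (ed i) \<or> up (bb i) (ed i) (ed (Suc i))"
    using dn upw assms by (meson not_less)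
  then show "ed i \<in> S" "ed (Suc i) \<in> S" "tip (bb i) (ed i) = tip (bb i) (ed (Suc i))" "ed i \<noteq> ed (Suc i)"
    using up_distinct unfolding up_def by (metis, metis, metis, metis)
qed

text \<open>Of the four half-edges the outer two are the only pair without a common edge or end.
  They are separated by \<open>zigzag_disjoint\<close> if the chain goes on in the same direction,
  and by \<open>valley_arms_disjoint\<close> at its lowest edge.\<close>

lemma hook_consecutive:
  assumes "Suc i < m"
  shows "hook i \<inter> hook (Suc i) = {z (ed (Suc i))}"
proof -
  let ?b = "bb i" and ?e0 = "ed i" and ?e1 = "ed (Suc i)" and ?e2 = "ed (Suc (Suc i))"
  have b1: "bb (Suc i) = (\<not> ?b)" by (rule bb)
  have i: "i < m" using assms by simp
  note s0 = chain_step[OF i] and s1 = chain_step[OF assms, unfolded b1]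
  define A0 where "A0 = closed_segment (tip ?b ?e1) (z ?e0)"
  define A1 where "A1 = closed_segment (tip ?b ?e1) (z ?e1)"
  define B1 where "B1 = closed_segment (tip (\<not> ?b) ?e1) (z ?e1)"
  define B2 where "B2 = closed_segment (tip (\<not> ?b) ?e1) (z ?e2)"
  have h: "hook i = A0 \<union> A1" "hook (Suc i) = B1 \<union> B2"
    unfolding hook_def A0_def A1_def B1_def B2_def b1 using s0(3) by simp_all
  have sub: "A0 \<subseteq> seg ?e0" "A1 \<subseteq> seg ?e1" "B1 \<subseteq> seg ?e1" "B2 \<subseteq> seg ?e2"
    using arm_segment_subset[OF s0(1), of ?b] arm_segment_subset[OF s0(2), of ?b]
      arm_segment_subset[OF s1(1), of "\<not> ?b"] arm_segment_subset[OF s1(2), of "\<not> ?b"] s0(3) s1(3)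
    unfolding A0_def A1_def B1_def B2_def by auto
  have 11: "A1 \<inter> B1 = {z ?e1}" unfolding A1_def B1_def by (rule arm_segments_disjoint[OF s0(2)])
  have 01: "A0 \<inter> B1 = {}"
  proof (rule ccontr)
    assume "\<not> ?thesis"
    then obtain y where "y \<in> A0" "y \<in> B1" by blast
    then have "y = tip ?b ?e1" using sub segs_meet_at_tip[OF s0(1,2,4,3), of y] s0(3) by (metis subsetD)
    then show False using tip_notin_other_arm[OF s0(2), of ?b] \<open>y \<in> B1\<close> unfolding B1_def by simp
  qed
  have 12: "A1 \<inter> B2 = {}"
  proof (rule ccontr)
    assume "\<not> ?thesis"
    then obtain y where "y \<in> A1" "y \<in> B2" by blast
    then have "y = tip (\<not> ?b) ?e1" using sub segs_meet_at_tip[OF s1(1,2,4,3), of y] by (metis subsetD)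
    then show False using tip_notin_other_arm[OF s0(2), of "\<not> ?b"] \<open>y \<in> A1\<close> unfolding A1_def by simp
  qed
  have 02: "A0 \<inter> B2 = {}"
  proof -
    consider "Suc i < l" | "l \<le> i" | "l = Suc i" by linarith
    then show ?thesis
    proof cases
      case 1
      have "up ?b ?e1 ?e0" "up (\<not> ?b) ?e2 ?e1" using dn[of i] dn[of "Suc i"] 1 assms b1 by auto
      then have "seg ?e2 \<inter> seg ?e0 = {}" using zigzag_disjoint[of "\<not> ?b" ?e2 ?e1 ?e0] by simp
      then show ?thesis using sub by blast
    next
      case 2
      have "up ?b ?e0 ?e1" "up (\<not> ?b) ?e1 ?e2" using upw[of i] upw[of "Suc i"] 2 assms b1 by auto
      from zigzag_disjoint[OF this] show ?thesis using sub by blast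
    next
      case 3
      have "up ?b ?e1 ?e0" "up (\<not> ?b) ?e1 ?e2" using dn[of i] upw[of "Suc i"] 3 assms b1 by auto
      from valley_arms_disjoint[OF this] show ?thesis unfolding A0_def B2_def .
    qed
  qed
  show ?thesis unfolding h using 11 01 12 02 by blast
qed

text \<open>If hooks \<open>i\<close> and \<open>j\<close> met, then hook \<open>i\<close> and the
  hooks from \<open>i + 2\<close> to \<open>j\<close> would form a connected set. By induction on
  the distance this set meets hook \<open>i + 1\<close> only at its two ends, which
  \<open>no_loop\<close> forbids.\<close>

lemma hook_disjoint: "i + 2 \<le> j \<Longrightarrow> j < m \<Longrightarrow> hook i \<inter> hook j = {}"
proof (induction "j - i" arbitrary: i j rule: less_induct)
  case less
  show ?case
  proof (rule ccontr)
    assume ne: "hook i \<inter> hook j \<noteq> {}"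
    have compact: "compact (hook t)" and pc: "path_connected (hook t)" for t
      unfolding hook_def by (intro compact_Un compact_segment) (intro path_connected_Un; auto)
    define n where "n = j - (i + 2)"
    have j: "j = i + 2 + n" using less.prems by (simp add: n_def)
    define U where "U = (\<Union>t\<in>{i + 2..i + 2 + n}. hook t)"
    define K where "K = hook i \<union> U"
    have "path_connected U" unfolding U_def
    proof (rule path_connected_chain)
      show "hook t \<inter> hook (Suc t) \<noteq> {}" if "i + 2 \<le> t" "t < i + 2 + n" for t
        using hook_consecutive[of t] that less.prems j by simp
    qed (rule pc)
    moreover have "j \<in> {i + 2..i + 2 + n}" by (simp add: j)
    then have "hook j \<subseteq> U" unfolding U_def by (rule UN_upper)
    then have "hook i \<inter> U \<noteq> {}" using ne by blast
    ultimately have pcK: "path_connected K" unfolding K_def by (intro path_connected_Un pc)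
    have compK: "compact K" unfolding K_def U_def by (intro compact_Un compact_UN compact) auto
    have hs: "hook t \<subseteq> \<Union>(seg ` S)" if "t < m" for t
      using arm_segment_subset[OF chain_step(1)[OF that], of "bb t"] arm_segment_subset[OF chain_step(2)[OF that], of "bb t"]
        chain_step(1-3)[OF that] unfolding hook_def by auto
    have KS: "K \<subseteq> \<Union>(seg ` S)" unfolding K_def U_def
      using less.prems j by (intro Un_least UN_least hs) auto
    have c1: "hook i \<inter> hook (Suc i) = {z (ed (Suc i))}" using hook_consecutive[of i] less.prems by simp
    have c2: "hook (Suc i) \<inter> hook (i + 2) = {z (ed (Suc (Suc i)))}"
      using hook_consecutive[of "Suc i"] less.prems by simp
    have c3: "hook (Suc i) \<inter> hook t = {}" if "i + 3 \<le> t" "t \<le> j" for t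
      using less.hyps[of t "Suc i"] that less.prems by simp
    have UU: "U = hook (i + 2) \<union> (\<Union>t\<in>{i + 3..j}. hook t)"
    proof -
      have "{i + 2..i + 2 + n} = insert (i + 2) {i + 3..j}" unfolding j by auto
      then show ?thesis unfolding U_def by simp
    qed
    have "hook (Suc i) \<inter> (\<Union>t\<in>{i + 3..j}. hook t) = {}" by (simp add: Int_UN_distrib c3)
    then have KV: "K \<inter> hook (Suc i) = {z (ed (Suc i)), z (ed (Suc (Suc i)))}"
      unfolding K_def UU using c1 c2 by blast
    have si: "Suc i < m" using less.prems by simp
    note st = chain_step[OF si]
    from st(5) show False
    proof
      assume "up (bb (Suc i)) (ed (Suc (Suc i))) (ed (Suc i))"
      then show False
        by (rule no_loop[OF _ _ compK pcK KS]) (use KV st(3) in \<open>auto simp: hook_def\<close>)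
    next
      assume "up (bb (Suc i)) (ed (Suc i)) (ed (Suc (Suc i)))"
      then show False
        by (rule no_loop[OF _ _ compK pcK KS]) (use KV st(3) in \<open>auto simp: hook_def\<close>)
    qed
  qed
qed

text \<open>From three steps on, the first and last hooks would share the touching point of the
  repeated edge. A closed chain of two steps consists of edges with both ends in common.\<close>

lemma chain_not_closed:
  assumes "0 < m"
  shows "ed 0 \<noteq> ed m"
proof
  assume eq: "ed 0 = ed m"
  consider "m = 1" | "m = 2" | "3 \<le> m" using assms by linarith
  then show False
  proof cases
    case 1
    then show False using chain_step(4)[of 0] eq by simp
  next
    case 2
    have "tip (bb 0) (ed 0) = tip (bb 0) (ed 1)" "tip (\<not> bb 0) (ed 1) = tip (\<not> bb 0) (ed 0)" "ed 0 \<noteq> ed 1"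
      using chain_step[of 0] chain_step[of 1] bb[of 0] 2 eq by (auto simp: numeral_2_eq_2)
    then show False by (cases "bb 0") (auto simp: prod_eq_iff)
  next
    case 3
    then have "hook 0 \<inter> hook (m - 1) = {}" by (intro hook_disjoint) auto
    moreover have "z (ed 0) \<in> hook 0" "z (ed m) \<in> hook (m - 1)" using 3 by (auto simp: hook_def)
    ultimately show False using eq by auto
  qed
qed

end

end

section \<open>Weights and the number of touched edges\<close>

context touched_edges
begin

text \<open>Alternation of the ends loses nothing: consecutive steps at the same end merge into one
  by \<open>up_trans\<close>.\<close>

definition upchain :: "bool \<Rightarrow> complex \<times> complex \<Rightarrow> nat \<Rightarrow> (nat \<Rightarrow> complex \<times> complex) \<Rightarrow> bool" where
  "upchain b e n f \<longleftrightarrow> f 0 = e \<and> (\<forall>i<n. up (b = even i) (f i) (f (Suc i)))"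

definition above :: "bool \<Rightarrow> complex \<times> complex \<Rightarrow> (complex \<times> complex) set" where
  "above b e = {g. \<exists>n f. 0 < n \<and> upchain b e n f \<and> f n = g}"

lemma above_subset: "above b e \<subseteq> S"
proof
  fix g assume "g \<in> above b e"
  then obtain n f where nf: "0 < n" "upchain b e n f" "f n = g" by (auto simp: above_def)
  obtain m where m: "n = Suc m" using nf(1) gr0_implies_Suc by blast
  then have "up (b = even m) (f m) (f (Suc m))" using nf(2) by (simp add: upchain_def)
  then show "g \<in> S" using nf m by (simp add: up_def)
qed

lemma finite_above: "finite (above b e)"
  by (rule finite_subset[OF above_subset fin])

lemma not_above_self: "e \<notin> above b e"
proof
  assume "e \<in> above b e"
  then obtain n f where nf: "0 < n" "upchain b e n f" "f n = e" by (auto simp: above_def)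
  have "f 0 \<noteq> f n"
    by (rule chain_not_closed[of "\<lambda>i. b = even i" 0]) (use nf in \<open>auto simp: upchain_def\<close>)
  then show False using nf by (simp add: upchain_def)
qed

text \<open>Two ascents from \<open>e\<close> to the same edge \<open>g\<close> would form a closed
  valley: down along one to \<open>e\<close> and up along the other. The ends alternate at
  \<open>e\<close> too, because one ascent starts at its tail and the other at its head.\<close>

lemma above_disjoint: "above True e \<inter> above False e = {}"
proof (rule ccontr)
  assume "\<not> ?thesis"
  then obtain g where g: "g \<in> above True e" "g \<in> above False e" by blast
  obtain n f where n: "0 < n" "upchain True e n f" and fg: "f n = g" using g(1) unfolding above_def by blast
  obtain k h where k: "0 < k" "upchain False e k h" and hg: "h k = g" using g(2) unfolding above_def by blast
  have eq: "f n = h k" using fg hg by simp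
  define ed where "ed i = (if i \<le> k then h (k - i) else f (i - k))" for i
  have "ed 0 \<noteq> ed (n + k)"
  proof (rule chain_not_closed[of "\<lambda>i. even (i + k)" k])
    fix i assume i: "i < k"
    then have 1: "ed i = h (Suc (k - Suc i))" "ed (Suc i) = h (k - Suc i)"
      by (auto simp: ed_def Suc_diff_Suc)
    have 2: "even (i + k) = (False = even (k - Suc i))" using i by (auto simp: even_diff_nat)
    have "k - Suc i < k" using i by simp
    then show "up (even (i + k)) (ed (Suc i)) (ed i)"
      using k(2) unfolding 1 2 upchain_def by blast
  next
    fix i assume i: "k \<le> i" "i < n + k"
    then have 1: "ed i = f (i - k)" "ed (Suc i) = f (Suc (i - k))"
      using n k by (auto simp: ed_def upchain_def Suc_diff_le)
    have 2: "even (i + k) = (True = even (i - k))" using i by (auto simp: even_diff_nat)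
    have "i - k < n" using i by simp
    then show "up (even (i + k)) (ed i) (ed (Suc i))"
      using n(2) unfolding 1 2 upchain_def by blast
  qed (use n in auto)
  then show False using eq n by (simp add: ed_def)
qed

text \<open>The angular order at an end is transitive because all edges point into one half-plane.
  The proof is the linear relation between three plane vectors, paired with
  \<open>w\<close>.\<close>

lemma up_trans:
  assumes "up b e a" "up b a c"
  shows "up b e c"
proof -
  have t: "tip b e = tip b a" "tip b a = tip b c" "e \<in> S" "a \<in> S" "c \<in> S" using assms by (auto simp: up_def)
  let ?x = "sg b * cross (arm b e) (arm b a)" and ?y = "sg b * cross (arm b a) (arm b c)"
    and ?z = "sg b * cross (arm b e) (arm b c)"
  let ?p = "\<lambda>e. sg b * (w \<bullet> arm b e)"
  have p: "0 < ?p x" if "x \<in> S" for x using pos[OF that] unfolding dir_arm[of x b] by simp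
  have "cross (arm b e) (arm b c) * (w \<bullet> arm b a)
      = cross (arm b e) (arm b a) * (w \<bullet> arm b c) + cross (arm b a) (arm b c) * (w \<bullet> arm b e)"
    by (simp add: cross_def inner_complex_def algebra_simps)
  then have "?z * ?p a = ?x * ?p c + ?y * ?p e" by (simp add: algebra_simps)
  moreover have xy: "0 < ?x" "0 < ?y" using assms by (simp_all only: up_def)
  have "0 < ?x * ?p c" "0 < ?y * ?p e"
    by (rule mult_pos_pos[OF xy(1) p[OF t(5)]], rule mult_pos_pos[OF xy(2) p[OF t(3)]])
  ultimately have "0 < ?z * ?p a" by linarith
  then have "0 < ?z" using p[OF t(4)] by (simp add: zero_less_mult_iff del: if_split)
  then show ?thesis using t by (simp add: up_def)
qed

text \<open>A chain that leaves \<open>a\<close> at the other end is prolonged by \<open>e\<close>;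
  in a chain that leaves \<open>a\<close> at the same end, transitivity lets \<open>e\<close> take
  the place of \<open>a\<close>.\<close>

lemma above_step:
  assumes "up b e a"
  shows "insert a (above True a \<union> above False a) \<subseteq> above b e"
proof -
  have "a \<in> above b e"
    using assms unfolding above_def
    by (auto intro!: exI[of _ 1] exI[of _ "\<lambda>i. if i = 0 then e else a"] simp: upchain_def)
  moreover have "above (\<not> b) a \<subseteq> above b e"
  proof
    fix g assume "g \<in> above (\<not> b) a"
    then obtain n f where nf: "upchain (\<not> b) a n f" "f n = g" by (auto simp: above_def)
    have "upchain b e (Suc n) (case_nat e f)"
      unfolding upchain_def
    proof (intro conjI allI impI)
      fix i assume i: "i < Suc n"
      have "(b = even (Suc j)) = ((\<not> b) = even j)" for j by auto
      then show "up (b = even i) (case_nat e f i) (case_nat e f (Suc i))"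
        using nf assms i by (cases i) (auto simp: upchain_def)
    qed simp
    then show "g \<in> above b e" using nf unfolding above_def
      by (intro CollectI exI[of _ "Suc n"] exI[of _ "case_nat e f"]) simp
  qed
  moreover have "above b a \<subseteq> above b e"
  proof
    fix g assume "g \<in> above b a"
    then obtain n f where nf: "0 < n" "upchain b a n f" "f n = g" by (auto simp: above_def)
    have "up b a (f (Suc 0))" using nf by (auto simp: upchain_def)
    then have "up b e (f (Suc 0))" using up_trans assms by blast
    then have "upchain b e n (f(0 := e))" using nf unfolding upchain_def by auto
    then show "g \<in> above b e" using nf unfolding above_def
      by (intro CollectI exI[of _ n] exI[of _ "f(0 := e)"]) simp
  qed
  ultimately show ?thesis by (cases b) auto
qed

definition weight :: "complex \<times> complex \<Rightarrow> nat" where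
  "weight e = 1 + card (above True e) + card (above False e)"

lemma weight_eq: "weight e = card (insert e (above True e \<union> above False e))"
proof -
  have "card (above True e \<union> above False e) = card (above True e) + card (above False e)"
    by (intro card_Un_disjoint finite_above above_disjoint)
  moreover have "card (insert e (above True e \<union> above False e)) = Suc (card (above True e \<union> above False e))"
    by (intro card_insert_disjoint) (auto simp: finite_above not_above_self)
  ultimately show ?thesis by (simp add: weight_def)
qed

lemma weight_le: "e \<in> S \<Longrightarrow> weight e \<le> card S"
  unfolding weight_eq by (intro card_mono fin insert_subsetI Un_least above_subset)

lemma weight_step: "up b e a \<Longrightarrow> weight a \<le> card (above b e)"
  unfolding weight_eq by (intro card_mono above_step finite_above)

definition halving :: "bool \<Rightarrow> (complex \<times> complex) set" where
  "halving b = {e \<in> S. \<forall>a. up b e a \<longrightarrow> 2 * weight a \<le> weight e}"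

text \<open>
  The edges above \<open>e\<close> at its tail and those above \<open>e\<close> at its head are disjoint, so that one of
  the two families has at most half of the weight of \<open>e\<close>.
\<close>

lemma halving_cover: "S = halving True \<union> halving False"
proof
  show "S \<subseteq> halving True \<union> halving False"
  proof
    fix e assume "e \<in> S"
    show "e \<in> halving True \<union> halving False"
    proof (rule ccontr)
      assume "e \<notin> halving True \<union> halving False"
      then obtain a c where "up True e a" "up False e c" "weight e < 2 * weight a" "weight e < 2 * weight c"
        using \<open>e \<in> S\<close> by (auto simp: halving_def not_le)
      then show False using weight_step[of True e a] weight_step[of False e c] by (simp add: weight_def)
    qed
  qed
qed (auto simp: halving_def)

text \<open>The edges at a common end are linearly ordered by \<open>up\<close>, and in
  \<open>halving b\<close> each step upwards at least halves the weight. The rounded logarithms of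
  the weights are therefore distinct.\<close>

lemma card_halving_at_tip:
  "card {e \<in> halving b. tip b e = p} \<le> nat \<lfloor>log 2 (card S)\<rfloor> + 1"
proof -
  let ?H = "{e \<in> halving b. tip b e = p}" and ?l = "\<lambda>e. nat \<lfloor>log 2 (weight e)\<rfloor>"
  have w1: "1 \<le> weight e" for e by (simp add: weight_def)
  have lt: "?l a < ?l e" if "e \<in> ?H" "up b e a" for e a
  proof -
    have "2 * weight a \<le> weight e" using that unfolding halving_def by blast
    then have "log 2 (2 * weight a) \<le> log 2 (weight e)" using w1[of a] w1[of e]
      by (subst log_le_cancel_iff) (auto simp: le_nat_iff)
    then have "log 2 (weight a) + 1 \<le> log 2 (weight e)" using w1[of a] by (simp add: log_mult)
    then have "\<lfloor>log 2 (weight a)\<rfloor> + 1 \<le> \<lfloor>log 2 (weight e)\<rfloor>" by linarith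
    moreover have "0 \<le> \<lfloor>log 2 (weight a)\<rfloor>" using w1[of a] by (simp add: le_nat_iff)
    ultimately show ?thesis by linarith
  qed
  have "inj_on ?l ?H"
  proof (rule inj_onI, rule ccontr)
    fix e a assume ea: "e \<in> ?H" "a \<in> ?H" "?l e = ?l a" "e \<noteq> a"
    then have mem: "e \<in> S" "a \<in> S" "tip b e = tip b a" by (auto simp: halving_def)
    from gp[OF mem(1,2) ea(4) mem(3)] have "up b e a \<or> up b a e"
      using mem cross_commute[of "arm b a" "arm b e"] unfolding up_def by (auto simp: not_less)
    then show False using lt[of e a] lt[of a e] ea by auto
  qed
  moreover have "?l ` ?H \<subseteq> {..nat \<lfloor>log 2 (card S)\<rfloor>}"
  proof
    fix x assume "x \<in> ?l ` ?H"
    then obtain e where e: "e \<in> S" "x = ?l e" by (auto simp: halving_def)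
    have "log 2 (weight e) \<le> log 2 (card S)" using weight_le[OF e(1)] w1[of e]
      by (subst log_le_cancel_iff) auto
    then show "x \<in> {..nat \<lfloor>log 2 (card S)\<rfloor>}" using e by (auto intro!: nat_mono floor_mono)
  qed
  ultimately have "card ?H \<le> card {..nat \<lfloor>log 2 (card S)\<rfloor>}"
    by (intro card_inj_on_le[of ?l]) auto
  then show ?thesis by simp
qed

lemma card_edges_le:
  assumes P: "finite P" "fst ` S \<subseteq> P" "snd ` S \<subseteq> P" and S: "S \<noteq> {}"
  shows "real (card S) \<le> 2 * card P * (2 * log 2 (card P) + 1)"
proof -
  have "card (halving b) \<le> card P * (nat \<lfloor>log 2 (card S)\<rfloor> + 1)" for b
  proof -
    have "halving b \<subseteq> (\<Union>p\<in>P. {e \<in> halving b. tip b e = p})"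
    proof
      fix e assume e: "e \<in> halving b"
      then have "e \<in> S" by (simp add: halving_def)
      then have "tip b e \<in> P" using P(2,3) by (cases b) auto
      then show "e \<in> (\<Union>p\<in>P. {e \<in> halving b. tip b e = p})" using e by blast
    qed
    then have "card (halving b) \<le> card (\<Union>p\<in>P. {e \<in> halving b. tip b e = p})"
      using fin P(1) by (intro card_mono finite_UN_I) (auto simp: halving_def)
    also have "\<dots> \<le> (\<Sum>p\<in>P. card {e \<in> halving b. tip b e = p})" by (rule card_UN_le[OF P(1)])
    also have "\<dots> \<le> (\<Sum>p\<in>P. nat \<lfloor>log 2 (card S)\<rfloor> + 1)" by (intro sum_mono card_halving_at_tip)
    finally show ?thesis by simp
  qed
  from this[of True] this[of False] have "card S \<le> 2 * (card P * (nat \<lfloor>log 2 (card S)\<rfloor> + 1))"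
    using card_Un_le[of "halving True" "halving False"] halving_cover by simp
  then have "real (card S) \<le> real (2 * (card P * (nat \<lfloor>log 2 (card S)\<rfloor> + 1)))"
    by (simp only: of_nat_le_iff)
  then have 1: "real (card S) \<le> 2 * (card P * (real (nat \<lfloor>log 2 (card S)\<rfloor>) + 1))"
    by (simp only: of_nat_mult of_nat_add of_nat_numeral of_nat_1)
  have S0: "1 \<le> card S" using S fin by (simp add: Suc_leI card_gt_0_iff)
  \<comment> \<open>The crude quadratic bound on \<open>card S\<close> suffices inside the
    logarithm, where it costs a factor 2.\<close>
  have "S \<subseteq> P \<times> P" using P by force
  then have "card S \<le> card P * card P" using card_mono[of "P \<times> P" S] P by (simp add: card_cartesian_product)
  moreover have P0: "0 < card P" using \<open>S \<subseteq> P \<times> P\<close> S P by (auto simp: card_gt_0_iff)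
  ultimately have "log 2 (card S) \<le> log 2 (real (card P) * real (card P))"
    using S0 by (subst log_le_cancel_iff) (auto simp flip: of_nat_mult)
  also have "\<dots> = 2 * log 2 (card P)" using P0 by (simp add: log_mult)
  finally have "real (nat \<lfloor>log 2 (card S)\<rfloor>) \<le> 2 * log 2 (card P)" using S0 by simp linarith
  then have "card P * (real (nat \<lfloor>log 2 (card S)\<rfloor>) + 1) \<le> card P * (2 * log 2 (card P) + 1)"
    by (intro mult_left_mono) auto
  then show ?thesis using 1 by (simp add: mult.assoc)
qed

end

section \<open>Edges on the boundary of a face\<close>

abbreviation face :: "(complex \<times> complex) set \<Rightarrow> complex \<Rightarrow> complex set" where
  "face Q r \<equiv> connected_component_set (- \<Union>(seg ` Q)) r"

text \<open>Without \<open>e\<close> the face would grow, so its frontier has a point on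
  \<open>e\<close> that no other edge comes near. Each of the two half-discs there is connected and
  avoids all edges, so the face contains a half-disc that it meets.\<close>

lemma face_touches_edge:
  assumes Q: "finite Q" "e \<in> Q" "fst e \<noteq> snd e" and r: "r \<notin> \<Union>(seg ` Q)"
    and meets: "face (Q - {e}) r \<inter> seg e \<noteq> {}"
  shows "\<exists>z s. (s = 1 \<or> s = - 1) \<and> z \<in> open_segment (fst e) (snd e) \<and> z \<notin> \<Union>(seg ` (Q - {e})) \<and>
    (\<exists>\<rho>>0. \<forall>y. dist y z < \<rho> \<longrightarrow> 0 < s * cross (snd e - fst e) (y - z) \<longrightarrow> y \<in> face Q r)"
proof -
  define F where "F = face Q r"
  define Ke where "Ke = face (Q - {e}) r"
  let ?d = "snd e - fst e"
  have clos: "closed (\<Union>(seg ` Q'))" if "Q' \<subseteq> Q" for Q'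
    using that Q(1) finite_subset by (intro closed_Union) auto
  have opF: "open F" unfolding F_def by (intro open_connected_component open_Compl clos) auto
  have opK: "open Ke" unfolding Ke_def by (intro open_connected_component open_Compl clos) auto
  have rF: "r \<in> F" using r by (simp add: F_def)
  have FK: "F \<subseteq> Ke" unfolding F_def Ke_def by (intro connected_component_mono) auto
  have Fsub: "F \<subseteq> - \<Union>(seg ` Q)" unfolding F_def by (rule connected_component_subset)
  have Ksub: "Ke \<subseteq> - \<Union>(seg ` (Q - {e}))" unfolding Ke_def by (rule connected_component_subset)
  have maxF: "T \<subseteq> F" if T: "connected T" "T \<subseteq> - \<Union>(seg ` Q)" "T \<inter> F \<noteq> {}" for T
  proof -
    obtain y where "y \<in> T" "y \<in> F" using T(3) by blast
    then have "T \<subseteq> connected_component_set (- \<Union>(seg ` Q)) y"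
      using T(1,2) by (intro connected_component_maximal)
    also have "\<dots> = F" using \<open>y \<in> F\<close> unfolding F_def by (metis connected_component_eq)
    finally show ?thesis .
  qed
  have "Ke \<inter> F \<noteq> {}" "Ke - F \<noteq> {}" using rF FK meets Fsub Q(2) by (auto simp: Ke_def)
  then have "Ke \<inter> frontier F \<noteq> {}"
    by (intro connected_Int_frontier) (auto simp: Ke_def)
  then obtain z0 where z0: "z0 \<in> Ke" "z0 \<in> closure F" "z0 \<notin> F"
    using opF by (auto simp: frontier_def interior_open)
  obtain \<rho> where \<rho>: "0 < \<rho>" "ball z0 \<rho> \<subseteq> Ke" using opK z0(1) openE by blast
  have ball_e: "ball z0 \<rho> \<inter> \<Union>(seg ` Q) \<subseteq> seg e" using \<rho>(2) Ksub by blast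
  have meetsF: "ball z0 t \<inter> F \<noteq> {}" if "0 < t" for t
    using z0(2) that unfolding closure_approachable by (metis IntI dist_commute empty_iff mem_ball)
  have z0e: "z0 \<in> seg e"
  proof (rule ccontr)
    assume "z0 \<notin> seg e"
    moreover have "z0 \<in> ball z0 \<rho>" using \<rho>(1) by simp
    ultimately have "z0 \<in> - \<Union>(seg ` Q)" using ball_e by blast
    moreover have "open (- \<Union>(seg ` Q))" by (intro open_Compl clos) auto
    ultimately obtain t where "0 < t" "ball z0 t \<subseteq> - \<Union>(seg ` Q)" by (metis openE)
    then have "ball z0 t \<subseteq> F" using meetsF by (intro maxF) auto
    moreover have "z0 \<in> ball z0 t" using \<open>0 < t\<close> by simp
    ultimately show False using z0(3) by blast
  qed
  \<comment> \<open>A nearby point of the face may lie on the line of \<open>e\<close> beyond an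
    endpoint; it is then moved along the normal.\<close>
  obtain y0 where y0: "y0 \<in> F" "y0 \<in> ball z0 \<rho>" "cross ?d (y0 - z0) \<noteq> 0"
  proof -
    obtain y1 where y1: "y1 \<in> ball z0 \<rho> \<inter> F" using meetsF[OF \<rho>(1)] by blast
    show ?thesis
    proof (cases "cross ?d (y1 - z0) = 0")
      case True
      have "open (ball z0 \<rho> \<inter> F)" using opF by auto
      then obtain t where t: "0 < t" "ball y1 t \<subseteq> ball z0 \<rho> \<inter> F" using y1 openE by blast
      let ?v = "\<i> * ?d"
      define s where "s = t / (2 * norm ?d)"
      have nd: "0 < norm ?d" using Q(3) by simp
      have s: "0 < s" using t nd by (simp add: s_def)
      have "norm (s *\<^sub>R ?v) = t / 2" using nd t by (simp add: s_def norm_mult)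
      then have "y1 + s *\<^sub>R ?v \<in> ball y1 t" using t by (simp add: dist_norm)
      moreover have cr: "cross ?d ?v = (norm ?d)\<^sup>2"
        unfolding cmod_power2 by (simp add: cross_def power2_eq_square algebra_simps)
      have "cross ?d (y1 + s *\<^sub>R ?v - z0) = cross ?d (y1 - z0) + s * cross ?d ?v"
        by (simp only: cross_simps add_diff_eq diff_add_eq)
      then have "cross ?d (y1 + s *\<^sub>R ?v - z0) \<noteq> 0" using True cr s nd by simp
      ultimately show ?thesis using t that by blast
    next
      case False
      then show ?thesis using y1 that by blast
    qed
  qed
  define s where "s = sgn (cross ?d (y0 - z0))"
  have s: "s = 1 \<or> s = - 1" "0 < s * cross ?d (y0 - z0)" using y0(3)
    by (auto simp: s_def sgn_real_def)
  define H where "H = ball z0 \<rho> \<inter> {y. 0 < s * cross ?d (y - z0)}"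
  have "convex {y. 0 < s * cross ?d (y - z0)}"
    unfolding convex_alt
  proof (intro ballI allI impI)
    fix x y u assume "x \<in> {y. 0 < s * cross ?d (y - z0)}" "y \<in> {y. 0 < s * cross ?d (y - z0)}" "0 \<le> (u::real) \<and> u \<le> 1"
    then have *: "0 < s * cross ?d (x - z0)" "0 < s * cross ?d (y - z0)" "0 \<le> u" "u \<le> 1" by auto
    have "0 < (1 - u) * (s * cross ?d (x - z0)) + u * (s * cross ?d (y - z0))"
      by (cases "u = 0") (use * in \<open>auto intro!: add_nonneg_pos\<close>)
    also have "\<dots> = s * cross ?d ((1 - u) *\<^sub>R x + u *\<^sub>R y - z0)" by (simp add: algebra_simps)
    finally show "(1 - u) *\<^sub>R x + u *\<^sub>R y \<in> {y. 0 < s * cross ?d (y - z0)}" by (simp only: mem_Collect_eq)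
  qed
  then have "convex H" unfolding H_def by (intro convex_Int convex_ball)
  have line: "cross ?d (y - z0) = 0" if ye: "y \<in> seg e" for y
  proof -
    obtain u v where uv: "y = (1 - u) *\<^sub>R fst e + u *\<^sub>R snd e" "z0 = (1 - v) *\<^sub>R fst e + v *\<^sub>R snd e"
      using ye z0e unfolding closed_segment_def by blast
    have "y - z0 = (u - v) *\<^sub>R ?d" unfolding uv by (simp add: algebra_simps)
    then show ?thesis by (simp only: cross_simps mult_zero_right)
  qed
  have "H \<subseteq> F"
  proof (rule maxF)
    show "connected H" using \<open>convex H\<close> by (rule convex_connected)
    show "H \<subseteq> - \<Union>(seg ` Q)"
    proof (rule subsetI, rule ComplI)
      fix y assume y: "y \<in> H" "y \<in> \<Union>(seg ` Q)"
      then have "y \<in> seg e" using ball_e unfolding H_def by blast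
      then have "cross ?d (y - z0) = 0" by (rule line)
      then show False using y(1) unfolding H_def by (simp only: Int_iff mem_Collect_eq mult_zero_right less_irrefl simp_thms)
    qed
    show "H \<inter> F \<noteq> {}" using y0 s(2) unfolding H_def by blast
  qed
  \<comment> \<open>The point \<open>z0\<close> may be an endpoint of \<open>e\<close>; a relative
    interior point close to it touches the same half-disc.\<close>
  have "z0 \<in> closure (open_segment (fst e) (snd e))" using z0e Q(3) by simp
  then obtain z where z: "z \<in> open_segment (fst e) (snd e)" "dist z z0 < \<rho>"
    using \<rho>(1) unfolding closure_approachable by blast
  have ze: "z \<in> seg e" using z by (auto simp: open_segment_def)
  have "z \<in> ball z0 \<rho>" using z by (simp add: dist_commute)
  then obtain \<sigma> where \<sigma>: "0 < \<sigma>" "ball z \<sigma> \<subseteq> ball z0 \<rho>" using openE[OF open_ball] by metis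
  have zn: "z \<notin> \<Union>(seg ` (Q - {e}))" using \<open>z \<in> ball z0 \<rho>\<close> \<rho>(2) Ksub by blast
  have "y \<in> F" if "dist y z < \<sigma>" "0 < s * cross ?d (y - z)" for y
  proof -
    have "cross ?d (y - z0) = cross ?d (y - z) + cross ?d (z - z0)" by simp
    then have "cross ?d (y - z0) = cross ?d (y - z)" using line[OF ze] by simp
    moreover have "y \<in> ball z \<sigma>" using that by (simp add: dist_commute)
    ultimately have "y \<in> H" using that(2) \<sigma>(2) unfolding H_def by (auto simp only: Int_iff mem_Collect_eq)
    then show ?thesis using \<open>H \<subseteq> F\<close> by blast
  qed
  then show ?thesis using s(1) z(1) zn \<sigma>(1) unfolding F_def by blast
qed

text \<open>Among the vectors \<open>Complex 1 t\<close>, each pair of points excludes at most one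
  value of \<open>t\<close>.\<close>

lemma generic_direction:
  fixes P :: "complex set"
  assumes "finite P"
  shows "\<exists>w. \<forall>a\<in>P. \<forall>b\<in>P. a \<noteq> b \<longrightarrow> w \<bullet> (a - b) \<noteq> 0"
proof -
  let ?bad = "(\<lambda>(a, b). - Re (a - b) / Im (a - b)) ` (P \<times> P)"
  have "finite ?bad" using assms by simp
  from ex_new_if_finite[OF infinite_UNIV_char_0 this] obtain t where t: "t \<notin> ?bad" by (rule exE)
  have "Complex 1 t \<bullet> (a - b) \<noteq> 0" if "a \<in> P" "b \<in> P" "a \<noteq> b" for a b
  proof (cases "Im (a - b) = 0")
    case True
    then have "Re (a - b) \<noteq> 0" using that by (auto simp: complex_eq_iff)
    then show ?thesis using True by (simp add: inner_complex_def)
  next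
    case False
    have "t \<noteq> - Re (a - b) / Im (a - b)" using t that by auto
    then have "t * Im (a - b) \<noteq> - Re (a - b)" using False by (simp add: field_simps)
    then show ?thesis by (simp add: inner_complex_def)
  qed
  then show ?thesis by blast
qed

text \<open>Each edge is directed with the face on its left, which is injective by
  \<open>asym\<close>. A generic \<open>w\<close> splits the directed edges into those along
  \<open>w\<close> and those against it, and \<open>card_edges_le\<close> applies to both families;
  hence 4 in place of 2.\<close>

lemma card_face_edges_le:
  assumes P: "finite P" "Q \<subseteq> P \<times> P" "2 \<le> card P"
    and gen: "\<And>a b c. a \<in> P \<Longrightarrow> b \<in> P \<Longrightarrow> c \<in> P \<Longrightarrow> a \<noteq> b \<Longrightarrow> a \<noteq> c \<Longrightarrow> b \<noteq> c \<Longrightarrow> cross (b - a) (c - a) \<noteq> 0"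
    and asym: "\<And>a b. (a, b) \<in> Q \<Longrightarrow> (b, a) \<notin> Q"
    and r: "r \<notin> \<Union>(seg ` Q)"
    and meets: "\<And>e. e \<in> Q \<Longrightarrow> face (Q - {e}) r \<inter> seg e \<noteq> {}"
  shows "real (card Q) \<le> 4 * card P * (2 * log 2 (card P) + 1)"
proof -
  have finQ: "finite Q" using P finite_subset by blast
  have ne: "fst e \<noteq> snd e" if "e \<in> Q" for e using asym[of "fst e" "snd e"] that by (cases e) auto
  define F where "F = face Q r"
  define G where "G e z s \<longleftrightarrow> (s = 1 \<or> s = - 1) \<and> z \<in> open_segment (fst e) (snd e) \<and> z \<notin> \<Union>(seg ` (Q - {e})) \<and>
    (\<exists>\<rho>>0. \<forall>y. dist y z < \<rho> \<longrightarrow> 0 < s * cross (snd e - fst e) (y - z) \<longrightarrow> y \<in> F)"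
    for e z and s :: real
  have "\<forall>e\<in>Q. \<exists>z s. G e z s"
    unfolding G_def F_def by (intro ballI face_touches_edge finQ ne r meets)
  then obtain z where "\<forall>e\<in>Q. \<exists>s. G e (z e) s" using bchoice[of Q "\<lambda>e z. \<exists>s. G e z s"] by blast
  then obtain s where "\<forall>e\<in>Q. G e (z e) (s e)" using bchoice[of Q "\<lambda>e s. G e (z e) s"] by blast
  then have G: "G e (z e) (s e)" if "e \<in> Q" for e using that by blast
  have zs: "s e = 1 \<or> s e = - 1" "z e \<in> open_segment (fst e) (snd e)" "z e \<notin> \<Union>(seg ` (Q - {e}))"
    "\<exists>\<rho>>0. \<forall>y. dist y (z e) < \<rho> \<longrightarrow> 0 < s e * cross (snd e - fst e) (y - z e) \<longrightarrow> y \<in> F"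
    if "e \<in> Q" for e
    using G[OF that] unfolding G_def by (simp_all only: simp_thms)
  define orient where "orient e = (if s e = 1 then e else prod.swap e)" for e
  have segor: "seg (orient e) = seg e" for e by (auto simp: orient_def closed_segment_commute)
  have oror: "open_segment (fst (orient e)) (snd (orient e)) = open_segment (fst e) (snd e)" for e
    by (auto simp: orient_def open_segment_commute)
  have inj: "inj_on orient Q"
  proof (rule inj_onI)
    fix e e' assume "e \<in> Q" "e' \<in> Q" "orient e = orient e'"
    then show "e = e'" using asym[of "fst e" "snd e"] asym[of "fst e'" "snd e'"]
      by (cases e; cases e') (auto simp: orient_def split: if_splits)
  qed
  define z' where "z' e = z (inv_into Q orient e)" for e
  have z': "z' (orient e) = z e" if "e \<in> Q" for e using inj that by (simp add: z'_def)
  obtain w where w: "\<And>a b. a \<in> P \<Longrightarrow> b \<in> P \<Longrightarrow> a \<noteq> b \<Longrightarrow> w \<bullet> (a - b) \<noteq> 0"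
    using generic_direction[OF P(1)] by blast
  have orP: "fst (orient e) \<in> P" "snd (orient e) \<in> P" "fst (orient e) \<noteq> snd (orient e)" if "e \<in> Q" for e
    using that P(2) ne[OF that] by (auto simp: orient_def)
  define S where "S t = {e \<in> orient ` Q. 0 < (t *\<^sub>R w) \<bullet> (snd e - fst e)}" for t
  have te: "touched_edges (S t) F z' (t *\<^sub>R w)" for t
  proof
    show "finite (S t)" using finQ by (simp add: S_def)
    show "connected F" by (simp add: F_def)
  next
    fix e assume "e \<in> S t"
    then obtain q where q: "q \<in> Q" "e = orient q" by (auto simp: S_def)
    show "F \<inter> seg e = {}"
      unfolding q segor F_def using q(1) connected_component_subset[of "- \<Union>(seg ` Q)" r] by blast
    show "z' e \<in> open_segment (fst e) (snd e)" unfolding q oror using z' zs(2) q(1) by simp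
    show "\<exists>\<rho>>0. \<forall>y. dist y (z' e) < \<rho> \<longrightarrow> 0 < cross (snd e - fst e) (y - z' e) \<longrightarrow> y \<in> F"
    proof -
      have "snd e - fst e = s q *\<^sub>R (snd q - fst q)" using zs(1)[OF q(1)] by (auto simp: q orient_def)
      then have "cross (snd e - fst e) v = s q * cross (snd q - fst q) v" for v by (simp only: cross_simps(10))
      moreover have "z' e = z q" using z'[OF q(1)] q(2) by simp
      ultimately show ?thesis using zs(4)[OF q(1)] by (simp only:)
    qed
    show "0 < t *\<^sub>R w \<bullet> (snd e - fst e)" using \<open>e \<in> S t\<close> by (simp add: S_def)
  next
    fix e e' assume "e \<in> S t" "e' \<in> S t" "e \<noteq> e'"
    then obtain q q' where q: "q \<in> Q" "q' \<in> Q" "e = orient q" "e' = orient q'" "q \<noteq> q'" by (auto simp: S_def)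
    show "z' e \<notin> seg e'" unfolding q segor z'[OF q(1)] using zs(3)[OF q(1)] q by blast
  next
    fix e e' b assume e: "e \<in> S t" "e' \<in> S t" "e \<noteq> e'" and tip: "tip b e = tip b e'"
    have "fst e \<in> P" "snd e \<in> P" "fst e \<noteq> snd e" "fst e' \<in> P" "snd e' \<in> P" "fst e' \<noteq> snd e'"
      using e orP by (auto simp: S_def)
    moreover have "tip (\<not> b) e \<noteq> tip (\<not> b) e'" using e(3) tip by (cases b) (auto simp: prod_eq_iff)
    ultimately show "cross (arm b e) (arm b e') \<noteq> 0"
      using gen[of "tip b e" "tip (\<not> b) e" "tip (\<not> b) e'"] tip unfolding arm_def by (cases b) auto
  qed
  have card1: "real (card (S t)) \<le> 2 * card P * (2 * log 2 (card P) + 1)" for t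
  proof (cases "S t = {}")
    case True
    have "0 \<le> log 2 (card P)" using P(3) by simp
    then show ?thesis using True by simp
  next
    case False
    show ?thesis by (rule touched_edges.card_edges_le[OF te P(1) _ _ False]) (use orP in \<open>auto simp: S_def\<close>)
  qed
  have "orient ` Q \<subseteq> S 1 \<union> S (- 1)"
  proof
    fix e assume e: "e \<in> orient ` Q"
    then have "w \<bullet> (snd e - fst e) \<noteq> 0" using orP w by (metis imageE)
    then show "e \<in> S 1 \<union> S (- 1)" using e by (auto simp: S_def)
  qed
  then have "card (orient ` Q) \<le> card (S 1) + card (S (- 1))"
    using finQ card_mono[of "S 1 \<union> S (- 1)" "orient ` Q"] card_Un_le[of "S 1" "S (- 1)"] by (simp add: S_def)
  then have "real (card Q) \<le> real (card (S 1)) + real (card (S (- 1)))"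
    using card_image[OF inj] by linarith
  then show ?thesis using card1[of 1] card1[of "- 1"] by linarith
qed

section \<open>Sign vectors of points\<close>

lemma sgn_divide_real: "sgn (x / y :: real) = sgn x * sgn y"
  by (cases "y = 0"; cases "x = 0") (auto simp: sgn_real_def zero_less_divide_iff)

text \<open>Every sign vector on the line occurs at a root, midway between two neighbouring roots,
  or at distance 1 beyond an extreme root. The case \<open>i = j\<close> covers the roots
  themselves.\<close>

lemma affine_sign_sample_line:
  fixes \<alpha> \<beta> :: "'k \<Rightarrow> real"
  assumes fin: "finite K" and ex: "\<exists>k\<in>K. \<alpha> k \<noteq> 0"
  shows "\<exists>i\<in>K. \<exists>j\<in>K. \<exists>\<delta>\<in>{-1, 0, 1}. \<alpha> i \<noteq> 0 \<and> \<alpha> j \<noteq> 0 \<and>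
    (\<forall>k\<in>K. sgn (\<alpha> k * ((- \<beta> i / \<alpha> i - \<beta> j / \<alpha> j) / 2 + \<delta>) + \<beta> k) = sgn (\<alpha> k * x + \<beta> k))"
proof -
  define \<rho> where "\<rho> k = - \<beta> k / \<alpha> k" for k
  define Z where "Z = {k \<in> K. \<alpha> k \<noteq> 0}"
  have Z: "finite Z" "Z \<noteq> {}" using fin ex by (auto simp: Z_def)
  have factor: "\<alpha> k * x + \<beta> k = \<alpha> k * (x - \<rho> k)" if "\<alpha> k \<noteq> 0" for k x
    using that by (simp add: \<rho>_def field_simps)
  have same: "sgn (\<alpha> k * x' + \<beta> k) = sgn (\<alpha> k * x + \<beta> k)"
    if "k \<in> K" "\<And>k. k \<in> Z \<Longrightarrow> sgn (x' - \<rho> k) = sgn (x - \<rho> k)" for k x'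
  proof (cases "\<alpha> k = 0")
    case False
    then show ?thesis using that by (simp add: factor sgn_mult Z_def)
  qed simp
  define L where "L = {k \<in> Z. \<rho> k < x}"
  define U where "U = {k \<in> Z. x < \<rho> k}"
  have finLU: "finite L" "finite U" using Z by (auto simp: L_def U_def)
  have key: "\<exists>i\<in>Z. \<exists>j\<in>Z. \<exists>\<delta>\<in>{-1, 0, 1}. \<forall>k\<in>Z. sgn ((\<rho> i + \<rho> j) / 2 + \<delta> - \<rho> k) = sgn (x - \<rho> k)"
  proof (cases "\<exists>k\<in>Z. \<rho> k = x")
    case True
    then obtain i where "i \<in> Z" "\<rho> i = x" by blast
    then show ?thesis by (intro bexI[of _ i] bexI[of _ 0]) auto
  next
    case False
    then have part: "k \<in> L \<or> k \<in> U" if "k \<in> Z" for k using that by (force simp: L_def U_def)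
    have Lmax: "\<exists>i\<in>L. \<forall>k\<in>L. \<rho> k \<le> \<rho> i" if "L \<noteq> {}"
    proof -
      have "Max (\<rho> ` L) \<in> \<rho> ` L" using finLU(1) that by (intro Max_in) auto
      then obtain i where "i \<in> L" "\<rho> i = Max (\<rho> ` L)" by auto
      then show ?thesis using finLU(1) by (intro bexI[of _ i]) auto
    qed
    have Umin: "\<exists>i\<in>U. \<forall>k\<in>U. \<rho> i \<le> \<rho> k" if "U \<noteq> {}"
    proof -
      have "Min (\<rho> ` U) \<in> \<rho> ` U" using finLU(2) that by (intro Min_in) auto
      then obtain i where "i \<in> U" "\<rho> i = Min (\<rho> ` U)" by auto
      then show ?thesis using finLU(2) by (intro bexI[of _ i]) auto
    qed
    have finish: ?thesis if "i \<in> Z" "j \<in> Z" "\<delta> \<in> {-1, 0, 1}"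
      "\<And>k. k \<in> L \<Longrightarrow> \<rho> k < (\<rho> i + \<rho> j) / 2 + \<delta>" "\<And>k. k \<in> U \<Longrightarrow> (\<rho> i + \<rho> j) / 2 + \<delta> < \<rho> k" for i j \<delta>
    proof (intro bexI ballI)
      fix k assume "k \<in> Z"
      from part[OF this] show "sgn ((\<rho> i + \<rho> j) / 2 + \<delta> - \<rho> k) = sgn (x - \<rho> k)"
      proof
        assume k: "k \<in> L"
        then have "\<rho> k < x" by (simp add: L_def)
        then show ?thesis using that(4)[OF k] by simp
      next
        assume k: "k \<in> U"
        then have "x < \<rho> k" by (simp add: U_def)
        then show ?thesis using that(5)[OF k] by simp
      qed
    qed (use that in auto)
    consider "L \<noteq> {}" "U \<noteq> {}" | "L \<noteq> {}" "U = {}" | "L = {}" "U \<noteq> {}"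
      using part Z(2) by blast
    then show ?thesis
    proof cases
      case 1
      obtain i where i: "i \<in> L" "\<And>k. k \<in> L \<Longrightarrow> \<rho> k \<le> \<rho> i" using Lmax 1 by blast
      obtain j where j: "j \<in> U" "\<And>k. k \<in> U \<Longrightarrow> \<rho> j \<le> \<rho> k" using Umin 1 by blast
      have "\<rho> i < \<rho> j" using i(1) j(1) by (simp add: L_def U_def)
      then show ?thesis
        by (intro finish[of i j 0]) (use i j in \<open>force simp: L_def U_def\<close>)+
    next
      case 2
      obtain i where i: "i \<in> L" "\<And>k. k \<in> L \<Longrightarrow> \<rho> k \<le> \<rho> i" using Lmax 2 by blast
      then show ?thesis
        by (intro finish[of i i 1]) (use i 2 in \<open>force simp: L_def\<close>)+
    next
      case 3
      obtain j where j: "j \<in> U" "\<And>k. k \<in> U \<Longrightarrow> \<rho> j \<le> \<rho> k" using Umin 3 by blast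
      then show ?thesis
        by (intro finish[of j j "-1"]) (use j 3 in \<open>force simp: U_def\<close>)+
    qed
  qed
  then obtain i j \<delta> where ij: "i \<in> Z" "j \<in> Z" "\<delta> \<in> {-1, 0, 1}"
    and s: "\<And>k. k \<in> Z \<Longrightarrow> sgn ((\<rho> i + \<rho> j) / 2 + \<delta> - \<rho> k) = sgn (x - \<rho> k)" by blast
  have "sgn (\<alpha> k * ((- \<beta> i / \<alpha> i - \<beta> j / \<alpha> j) / 2 + \<delta>) + \<beta> k) = sgn (\<alpha> k * x + \<beta> k)" if "k \<in> K" for k
    using same[OF that s] by (simp add: \<rho>_def)
  moreover have "i \<in> K" "j \<in> K" "\<alpha> i \<noteq> 0" "\<alpha> j \<noteq> 0" using ij by (auto simp: Z_def)
  ultimately show ?thesis using ij(3) by blast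
qed

locale affine_family =
  fixes a b c :: "'k \<Rightarrow> real"
begin

text \<open>
  Two applications of the one-dimensional sampling lemma, first in \<open>x\<close> and then in \<open>y\<close>, give for every sign vector
  of the family the sample point \<open>y = smpY / smpV\<close>, \<open>x = (smpX1 * y + smpX0) / smpW\<close>, at which the function
  with index \<open>m\<close> has the value \<open>smpN / (smpV * smpW)\<close>.
\<close>

definition "smpW i j = 2 * a i * a j"
definition "smpX1 i j = - (b i * a j + b j * a i)"
definition "smpX0 i j \<delta> = 2 * \<delta> * a i * a j - (c i * a j + c j * a i)"
definition "smpA i j m = a m * smpX1 i j + b m * smpW i j"
definition "smpB i j \<delta> m = a m * smpX0 i j \<delta> + c m * smpW i j"
definition "smpV i j k l = 2 * smpA i j k * smpA i j l"
definition "smpY i j \<delta> k l \<epsilon> = 2 * \<epsilon> * smpA i j k * smpA i j l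
  - (smpB i j \<delta> k * smpA i j l + smpB i j \<delta> l * smpA i j k)"
definition "smpN i j \<delta> k l \<epsilon> m = smpA i j m * smpY i j \<delta> k l \<epsilon> + smpB i j \<delta> m * smpV i j k l"

lemma sample_value:
  assumes W: "smpW i j \<noteq> 0"
  shows "a m * ((smpX1 i j * y + smpX0 i j \<delta>) / smpW i j) + b m * y + c m = (smpA i j m * y + smpB i j \<delta> m) / smpW i j"
  using W by (simp add: smpA_def smpB_def field_simps)

lemma sample_value2:
  assumes V: "smpV i j k l \<noteq> 0"
  shows "smpA i j m * (smpY i j \<delta> k l \<epsilon> / smpV i j k l) + smpB i j \<delta> m = smpN i j \<delta> k l \<epsilon> m / smpV i j k l"
  using V by (simp add: smpN_def field_simps)

text \<open>With \<open>y\<close> fixed, the sample value for \<open>x\<close> is an affine function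
  of \<open>y\<close>. Substituting it leaves a family of functions of \<open>y\<close> that are
  affine up to the common factor \<open>1 / smpW i j\<close>, and this family is sampled
  again.\<close>

lemma sample_complete:
  assumes K: "finite K" "k1 \<in> K" "a k1 \<noteq> 0" "k2 \<in> K" "a k2 = 0" "b k2 \<noteq> 0"
  shows "\<exists>i\<in>K. \<exists>j\<in>K. \<exists>\<delta>\<in>{-1, 0, 1}. \<exists>k\<in>K. \<exists>l\<in>K. \<exists>\<epsilon>\<in>{-1, 0, 1}. smpW i j \<noteq> 0 \<and> smpV i j k l \<noteq> 0 \<and>
    (\<forall>m\<in>K. sgn (a m * x + b m * y + c m) = sgn (smpN i j \<delta> k l \<epsilon> m) * sgn (smpV i j k l) * sgn (smpW i j))"
proof -
  obtain i j \<delta> where ij: "i \<in> K" "j \<in> K" "\<delta> \<in> {-1, 0, 1}" "a i \<noteq> 0" "a j \<noteq> 0"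
    and s1: "\<And>m. m \<in> K \<Longrightarrow> sgn (a m * ((- (b i * y + c i) / a i - (b j * y + c j) / a j) / 2 + \<delta>) + (b m * y + c m))
      = sgn (a m * x + (b m * y + c m))"
    using affine_sign_sample_line[OF K(1), of a "\<lambda>k. b k * y + c k" x] K by blast
  have W: "smpW i j \<noteq> 0" using ij by (simp add: smpW_def)
  have "(- (b i * y + c i) / a i - (b j * y + c j) / a j) / 2 + \<delta> = (smpX1 i j * y + smpX0 i j \<delta>) / smpW i j"
    using ij by (simp add: smpX1_def smpX0_def smpW_def field_simps)
  then have s1': "sgn (a m * x + b m * y + c m) = sgn (smpA i j m * y + smpB i j \<delta> m) * sgn (smpW i j)"
    if "m \<in> K" for m
    using s1[OF that] sample_value[OF W, of m y \<delta>] by (simp only: add.assoc sgn_divide_real)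
  \<comment> \<open>For \<open>k2\<close> the coefficient is \<open>b k2 * smpW i j\<close>, so the
    substituted family is not constant in \<open>y\<close>.\<close>
  have "\<exists>k\<in>K. smpA i j k \<noteq> 0" using K W by (intro bexI[of _ k2]) (auto simp: smpA_def)
  from affine_sign_sample_line[OF K(1) this, of "smpB i j \<delta>" y]
  obtain k l \<epsilon> where kl: "k \<in> K" "l \<in> K" "\<epsilon> \<in> {-1, 0, 1}" "smpA i j k \<noteq> 0" "smpA i j l \<noteq> 0"
    and s2: "\<And>m. m \<in> K \<Longrightarrow> sgn (smpA i j m * ((- smpB i j \<delta> k / smpA i j k - smpB i j \<delta> l / smpA i j l) / 2 + \<epsilon>) + smpB i j \<delta> m)
      = sgn (smpA i j m * y + smpB i j \<delta> m)" by blast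
  have V: "smpV i j k l \<noteq> 0" using kl by (simp add: smpV_def)
  have "(- smpB i j \<delta> k / smpA i j k - smpB i j \<delta> l / smpA i j l) / 2 + \<epsilon> = smpY i j \<delta> k l \<epsilon> / smpV i j k l"
    using kl by (simp add: smpY_def smpV_def field_simps)
  then have s2': "sgn (smpA i j m * y + smpB i j \<delta> m) = sgn (smpN i j \<delta> k l \<epsilon> m) * sgn (smpV i j k l)" if "m \<in> K" for m
    using s2[OF that] sample_value2[OF V, of m \<delta> \<epsilon>] by (simp only: sgn_divide_real)
  show ?thesis
    by (rule bexI[OF _ ij(1)], rule bexI[OF _ ij(2)], rule bexI[OF _ ij(3)], rule bexI[OF _ kl(1)],
        rule bexI[OF _ kl(2)], rule bexI[OF _ kl(3)]) (use W V s1' s2' in auto)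
qed

text \<open>The converse: nonvanishing denominators yield an actual point. Thus the sign vectors can
  be read off from polynomial signs without knowing which samples are needed.\<close>

lemma sample_sound:
  assumes "smpW i j \<noteq> 0" "smpV i j k l \<noteq> 0"
  shows "\<exists>x y. \<forall>m. sgn (a m * x + b m * y + c m) = sgn (smpN i j \<delta> k l \<epsilon> m) * sgn (smpV i j k l) * sgn (smpW i j)"
proof -
  let ?y = "smpY i j \<delta> k l \<epsilon> / smpV i j k l"
  let ?x = "(smpX1 i j * ?y + smpX0 i j \<delta>) / smpW i j"
  have "a m * ?x + b m * ?y + c m = smpN i j \<delta> k l \<epsilon> m / smpV i j k l / smpW i j" for m
    unfolding sample_value[OF assms(1)] sample_value2[OF assms(2)] ..
  then have "sgn (a m * ?x + b m * ?y + c m) = sgn (smpN i j \<delta> k l \<epsilon> m) * sgn (smpV i j k l) * sgn (smpW i j)" for m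
    by (simp only: sgn_divide_real)
  then show ?thesis by blast
qed

end

section \<open>Sign vectors with respect to the given points\<close>

definition pt :: "(nat \<Rightarrow> real) \<Rightarrow> nat \<Rightarrow> complex" where
  "pt x u = Complex (x (2 * u)) (x (2 * u + 1))"

abbreviation Idx :: "nat \<Rightarrow> (nat \<times> nat \<times> nat) set" where
  "Idx n \<equiv> {..<4} \<times> {..<n} \<times> {..<n}"

text \<open>
  The affine functions whose signs are recorded: \<open>j = 0\<close> is the orientation of \<open>u\<close>, \<open>v\<close> and the argument,
  \<open>j = 1\<close> the inner product with \<open>v - u\<close>, and \<open>j = 2\<close>, \<open>j = 3\<close> are the coordinates, which guarantee
  that the family is never degenerate.
\<close>

fun ca :: "(nat \<Rightarrow> real) \<Rightarrow> nat \<times> nat \<times> nat \<Rightarrow> real" where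
  "ca x (j, u, v) = (if j = 0 then x (2 * u + 1) - x (2 * v + 1) else if j = 1 then x (2 * v) - x (2 * u)
     else if j = 2 then 1 else 0)"

fun cb :: "(nat \<Rightarrow> real) \<Rightarrow> nat \<times> nat \<times> nat \<Rightarrow> real" where
  "cb x (j, u, v) = (if j = 0 then x (2 * v) - x (2 * u) else if j = 1 then x (2 * v + 1) - x (2 * u + 1)
     else if j = 2 then 0 else 1)"

fun cc :: "(nat \<Rightarrow> real) \<Rightarrow> nat \<times> nat \<times> nat \<Rightarrow> real" where
  "cc x (j, u, v) = (if j = 0 then (x (2 * v + 1) - x (2 * u + 1)) * x (2 * u) - (x (2 * v) - x (2 * u)) * x (2 * u + 1)
     else if j = 1 then 0 - ((x (2 * v) - x (2 * u)) * x (2 * u) + (x (2 * v + 1) - x (2 * u + 1)) * x (2 * u + 1))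
     else 0)"

definition val :: "(nat \<Rightarrow> real) \<Rightarrow> nat \<times> nat \<times> nat \<Rightarrow> complex \<Rightarrow> real" where
  "val x m y = ca x m * Re y + cb x m * Im y + cc x m"

lemma val_cross: "val x (0, u, v) y = cross (pt x v - pt x u) (y - pt x u)"
  by (simp add: val_def cross_def pt_def algebra_simps)

lemma val_inner: "val x (Suc 0, u, v) y = (pt x v - pt x u) \<bullet> (y - pt x u)"
  by (simp add: val_def inner_complex_def pt_def algebra_simps)

type_synonym signs = "nat \<times> nat \<times> nat \<Rightarrow> real"

definition sv :: "nat \<Rightarrow> (nat \<Rightarrow> real) \<Rightarrow> complex \<Rightarrow> signs" where
  "sv n x y = (\<lambda>m\<in>Idx n. sgn (val x m y))"

definition onseg :: "signs \<Rightarrow> nat \<Rightarrow> nat \<Rightarrow> bool" where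
  "onseg \<sigma> u v \<longleftrightarrow> \<sigma> (0, u, v) = 0 \<and> 0 \<le> \<sigma> (1, u, v) \<and> 0 \<le> \<sigma> (1, v, u)"

lemma sgn_nonneg_iff: "0 \<le> sgn (r :: real) \<longleftrightarrow> 0 \<le> r"
  by (simp add: sgn_real_def)

lemma onseg_iff:
  assumes uv: "u < n" "v < n" and ne: "pt x u \<noteq> pt x v"
  shows "onseg (sv n x y) u v \<longleftrightarrow> y \<in> closed_segment (pt x u) (pt x v)"
proof -
  let ?a = "pt x u" and ?b = "pt x v"
  have os: "onseg (sv n x y) u v \<longleftrightarrow> cross (?b - ?a) (y - ?a) = 0 \<and> 0 \<le> (?b - ?a) \<bullet> (y - ?a) \<and> 0 \<le> (?a - ?b) \<bullet> (y - ?b)"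
    using uv by (simp add: onseg_def sv_def val_cross val_inner sgn_nonneg_iff sgn_zero_iff)
  define d where "d = ?b - ?a"
  have d: "d \<noteq> 0" using ne by (simp add: d_def)
  have dd: "0 < d \<bullet> d" using d by simp
  show ?thesis
  proof
    assume "onseg (sv n x y) u v"
    then have h: "cross d (y - ?a) = 0" "0 \<le> d \<bullet> (y - ?a)" "0 \<le> (- d) \<bullet> (y - ?a - d)"
      unfolding os d_def by (auto simp: algebra_simps)
    define t where "t = (d \<bullet> (y - ?a)) / (d \<bullet> d)"
    have y: "y - ?a = t *\<^sub>R d" unfolding t_def by (rule cross_eq_0_imp_multiple[OF h(1) d])
    have "0 \<le> t" using h dd by (simp add: t_def)
    moreover have "0 \<le> (1 - t) * (d \<bullet> d)" using h(3) unfolding y by (simp add: algebra_simps inner_diff_right)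
    then have "t \<le> 1" using dd by (simp add: zero_le_mult_iff)
    moreover have "y = (1 - t) *\<^sub>R ?a + t *\<^sub>R ?b" using y by (simp add: d_def algebra_simps)
    ultimately show "y \<in> closed_segment ?a ?b" unfolding closed_segment_def by blast
  next
    assume "y \<in> closed_segment ?a ?b"
    then obtain t where t: "0 \<le> t" "t \<le> 1" "y = (1 - t) *\<^sub>R ?a + t *\<^sub>R ?b" unfolding closed_segment_def by blast
    have y1: "y - ?a = t *\<^sub>R d" "y - ?b = (1 - t) *\<^sub>R (- d)" unfolding t(3) d_def by (simp_all add: algebra_simps)
    have "?a - ?b = - d" by (simp add: d_def)
    then show "onseg (sv n x y) u v"
      unfolding os y1 using t dd by (simp flip: d_def)
  qed
qed

section \<open>Recovering a face from sign vectors\<close>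

definition svle :: "nat \<Rightarrow> signs \<Rightarrow> signs \<Rightarrow> bool" where
  "svle n \<sigma> \<tau> \<longleftrightarrow> (\<forall>m\<in>Idx n. \<sigma> m = 0 \<or> \<sigma> m = \<tau> m)"

definition sfree :: "(nat \<times> nat) set \<Rightarrow> signs \<Rightarrow> bool" where
  "sfree Q \<sigma> \<longleftrightarrow> (\<forall>(u, v)\<in>Q. \<not> onseg \<sigma> u v)"

text \<open>The combinatorial counterpart of \<open>face\<close>: a walk through cells off the
  segments of \<open>Q\<close> that passes between comparable sign vectors only, where
  \<open>svle\<close> is the face order. The configuration enters through \<open>\<Sigma>\<close>
  alone.\<close>

definition reach :: "nat \<Rightarrow> signs set \<Rightarrow> (nat \<times> nat) set \<Rightarrow> signs
    \<Rightarrow> signs set" where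
  "reach n \<Sigma> Q \<rho> = {(\<sigma>, \<tau>). \<sigma> \<in> \<Sigma> \<and> \<tau> \<in> \<Sigma> \<and> sfree Q \<sigma> \<and> sfree Q \<tau> \<and> (svle n \<sigma> \<tau> \<or> svle n \<tau> \<sigma>)}\<^sup>* `` {\<rho>}"

lemma val_affine: "val x m ((1 - t) *\<^sub>R y + t *\<^sub>R y') = (1 - t) * val x m y + t * val x m y'"
  by (simp add: val_def algebra_simps)

lemma sgn_add_same: "sgn (r::real) = sgn s \<Longrightarrow> 0 \<le> t \<Longrightarrow> t \<le> 1 \<Longrightarrow> sgn ((1 - t) * r + t * s) = sgn r"
proof -
  assume h: "sgn r = sgn s" "0 \<le> t" "t \<le> 1"
  consider "r = 0" | "0 < r" | "r < 0" by linarith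
  then show ?thesis
  proof cases
    case 1
    then show ?thesis using h by (simp add: sgn_zero_iff)
  next
    case 2
    then have s: "0 < s" using h(1) by (simp add: sgn_real_def split: if_splits)
    have "0 < (1 - t) * r + t * s"
      by (cases "t = 0") (use h s 2 in \<open>auto intro!: add_nonneg_pos\<close>)
    then show ?thesis using 2 by simp
  next
    case 3
    then have s: "s < 0" using h(1) by (simp add: sgn_real_def split: if_splits)
    have "(1 - t) * r + t * s < 0"
    proof (cases "t = 0")
      case False
      have "(1 - t) * r \<le> 0" using h 3 by (simp add: mult_nonneg_nonpos)
      moreover have "t * s < 0" using h s False by (simp add: mult_pos_neg)
      ultimately show ?thesis by linarith
    qed (use 3 in simp)
    then show ?thesis using 3 by simp
  qed
qed

text \<open>A sign common to both ends persists by convexity, and a function that vanishes at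
  \<open>y\<close> takes its sign at \<open>y'\<close> as soon as the segment leaves
  \<open>y\<close>.\<close>

lemma sv_segment:
  assumes le: "svle n (sv n x y) (sv n x y')" and w: "w \<in> closed_segment y y'"
  shows "sv n x w = sv n x y \<or> sv n x w = sv n x y'"
proof -
  obtain t where t: "0 \<le> t" "t \<le> 1" "w = (1 - t) *\<^sub>R y + t *\<^sub>R y'" using w unfolding closed_segment_def by blast
  show ?thesis
  proof (cases "t = 0")
    case True
    then show ?thesis using t by simp
  next
    case False
    have "sgn (val x m w) = sgn (val x m y')" if m: "m \<in> Idx n" for m
    proof (cases "val x m y = 0")
      case True
      then show ?thesis unfolding t(3) val_affine using t False by (simp add: sgn_mult)
    next
      case False
      have "sv n x y m = 0 \<or> sv n x y m = sv n x y' m" using le m unfolding svle_def by blast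
      then have "sgn (val x m y) = sgn (val x m y')" using False m by (simp add: sv_def sgn_zero_iff)
      then show ?thesis unfolding t(3) val_affine using sgn_add_same[OF _ t(1,2)] by simp
    qed
    then have "sv n x w = sv n x y'" unfolding sv_def by (intro restrict_ext) auto
    then show ?thesis ..
  qed
qed

lemma eventually_svle: "eventually (\<lambda>y'. svle n (sv n x y) (sv n x y')) (at y within A)"
proof -
  have "eventually (\<lambda>y'. sv n x y m = 0 \<or> sv n x y m = sv n x y' m) (at y within A)" if m: "m \<in> Idx n" for m
  proof -
    have tend: "(val x m \<longlongrightarrow> val x m y) (at y within A)"
      unfolding val_def by (intro tendsto_intros)
    consider "val x m y = 0" | "0 < val x m y" | "val x m y < 0" by linarith
    then show ?thesis
    proof cases
      case 1
      then show ?thesis using m by (simp add: sv_def)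
    next
      case 2
      have "eventually (\<lambda>y'. 0 < val x m y') (at y within A)" by (rule order_tendstoD(1)[OF tend 2])
      then show ?thesis by eventually_elim (use 2 m in \<open>auto simp: sv_def\<close>)
    next
      case 3
      have "eventually (\<lambda>y'. val x m y' < 0) (at y within A)" by (rule order_tendstoD(2)[OF tend 3])
      then show ?thesis by eventually_elim (use 3 m in \<open>auto simp: sv_def\<close>)
    qed
  qed
  then have "eventually (\<lambda>y'. \<forall>m\<in>Idx n. sv n x y m = 0 \<or> sv n x y m = sv n x y' m) (at y within A)"
    by (intro eventually_ball_finite) auto
  then show ?thesis unfolding svle_def .
qed

text \<open>Within a face, nearby points have comparable sign vectors, so membership in
  \<open>reach\<close> is locally constant on a connected set. Conversely, a step of
  \<open>reach\<close> is realized by a straight segment that meets no edge.\<close>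

lemma face_decode:
  assumes Q: "\<And>u v. (u, v) \<in> Q \<Longrightarrow> u < n \<and> v < n \<and> pt x u \<noteq> pt x v"
    and Qi: "Q' = (\<lambda>(u, v). (pt x u, pt x v)) ` Q" and r: "r \<notin> \<Union>(seg ` Q')"
  shows "y \<in> face Q' r \<longleftrightarrow> sv n x y \<in> reach n (range (sv n x)) Q (sv n x r)"
proof -
  let ?R = "reach n (range (sv n x)) Q (sv n x r)"
  let ?rel = "{(\<sigma>, \<tau>). \<sigma> \<in> range (sv n x) \<and> \<tau> \<in> range (sv n x) \<and> sfree Q \<sigma> \<and> sfree Q \<tau> \<and> (svle n \<sigma> \<tau> \<or> svle n \<tau> \<sigma>)}"
  have free: "sfree Q (sv n x y) \<longleftrightarrow> y \<notin> \<Union>(seg ` Q')" for y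
  proof -
    have "onseg (sv n x y) u v \<longleftrightarrow> y \<in> closed_segment (pt x u) (pt x v)" if "(u, v) \<in> Q" for u v
      using Q[OF that] onseg_iff by blast
    then show ?thesis unfolding sfree_def Qi by fastforce
  qed
  have rbase: "sv n x r \<in> ?R" by (simp add: reach_def)
  show ?thesis
  proof
    assume y: "y \<in> face Q' r"
    have rf: "r \<in> face Q' r" using r by simp
    have sub: "face Q' r \<subseteq> - \<Union>(seg ` Q')" by (rule connected_component_subset)
    have "(sv n x r \<in> ?R) = (sv n x y \<in> ?R)"
    proof (rule connected_local_const[where f = "\<lambda>y. sv n x y \<in> ?R", OF _ rf y])
      show "connected (face Q' r)" by simp
      show "\<forall>a\<in>face Q' r. eventually (\<lambda>b. (sv n x a \<in> ?R) = (sv n x b \<in> ?R)) (at a within face Q' r)"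
      proof
        fix a assume a: "a \<in> face Q' r"
        have "eventually (\<lambda>b. b \<in> face Q' r) (at a within face Q' r)"
          by (auto simp: eventually_at_filter)
        with eventually_svle[of n x a "face Q' r"]
        show "eventually (\<lambda>b. (sv n x a \<in> ?R) = (sv n x b \<in> ?R)) (at a within face Q' r)"
        proof eventually_elim
          case (elim b)
          have "sfree Q (sv n x a)" "sfree Q (sv n x b)" unfolding free using a elim(2) sub by blast+
          then have "(sv n x a, sv n x b) \<in> ?rel" "(sv n x b, sv n x a) \<in> ?rel" using elim(1) by auto
          then show ?case unfolding reach_def by (auto intro: rtrancl_into_rtrancl)
        qed
      qed
    qed
    then show "sv n x y \<in> ?R" using rbase by simp
  next
    have grow: "y' \<in> face Q' r" if g: "y \<in> face Q' r" "sfree Q (sv n x y)" "sfree Q (sv n x y')"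
      "svle n (sv n x y) (sv n x y') \<or> svle n (sv n x y') (sv n x y)" for y y'
    proof -
      have "sfree Q (sv n x w)" if w: "w \<in> closed_segment y y'" for w
      proof -
        from g(4) have "sv n x w = sv n x y \<or> sv n x w = sv n x y'"
          using sv_segment[of n x y y' w] sv_segment[of n x y' y w] w by (auto simp: closed_segment_commute)
        then show ?thesis using g(2,3) by auto
      qed
      then have "closed_segment y y' \<subseteq> - \<Union>(seg ` Q')" unfolding free by blast
      then have "closed_segment y y' \<subseteq> connected_component_set (- \<Union>(seg ` Q')) y"
        by (intro connected_component_maximal) auto
      moreover have "connected_component_set (- \<Union>(seg ` Q')) y = face Q' r"
        using g(1) by (metis connected_component_eq)
      ultimately show ?thesis by auto
    qed
    assume "sv n x y \<in> ?R"
    then have "(sv n x r, sv n x y) \<in> ?rel\<^sup>*" by (simp add: reach_def)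
    \<comment> \<open>The induction must speak of all points with a given sign vector, since
      \<open>reach\<close> moves between vectors and not between points.\<close>
    moreover have "\<forall>y. sv n x y = \<tau> \<longrightarrow> y \<in> face Q' r" if "(sv n x r, \<tau>) \<in> ?rel\<^sup>*" for \<tau>
      using that
    proof (induction rule: rtrancl_induct)
      case base
      have "r \<in> face Q' r" "sfree Q (sv n x r)" using r by (simp_all add: free)
      then show ?case using grow[of r] by (auto simp: svle_def)
    next
      case (step \<sigma> \<tau>)
      then obtain y0 where "\<sigma> = sv n x y0" by auto
      then show ?case using step grow[of y0] by auto
    qed
    ultimately show "y \<in> face Q' r" by blast
  qed
qed

section \<open>Encoding one obstacle\<close>

definition max_edges :: "nat \<Rightarrow> nat" where
  "max_edges n = nat \<lfloor>4 * real n * (2 * log 2 (real n) + 1)\<rfloor>"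

lemma connected_set_encoding:
  assumes n: "2 \<le> n" and inj: "inj_on (pt x) {..<n}"
    and gen: "\<And>a b c. a \<in> pt x ` {..<n} \<Longrightarrow> b \<in> pt x ` {..<n} \<Longrightarrow> c \<in> pt x ` {..<n} \<Longrightarrow>
      a \<noteq> b \<Longrightarrow> a \<noteq> c \<Longrightarrow> b \<noteq> c \<Longrightarrow> cross (b - a) (c - a) \<noteq> 0"
    and R: "connected R" "R \<noteq> {}"
  shows "\<exists>Q \<rho>. Q \<subseteq> {..<n} \<times> {..<n} \<and> card Q \<le> max_edges n \<and> \<rho> \<in> range (sv n x) \<and>
    (\<forall>u<n. \<forall>v<n. u \<noteq> v \<longrightarrow> (closed_segment (pt x u) (pt x v) \<inter> R = {} \<longleftrightarrow>
      (\<forall>\<sigma>\<in>reach n (range (sv n x)) Q \<rho>. \<not> onseg \<sigma> u v)))"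
proof -
  txt \<open>
    A smallest set \<open>Q\<close> of edges that bounds the same face around \<open>R\<close> as all edges that avoid \<open>R\<close>.
    A segment avoids \<open>R\<close> if and only if it avoids this face.
  \<close>
  define EQ where "EQ = {(u, v). u < v \<and> v < n \<and> closed_segment (pt x u) (pt x v) \<inter> R = {}}"
  define im where "im Q = (\<lambda>(u, v). (pt x u, pt x v)) ` Q" for Q :: "(nat \<times> nat) set"
  obtain r where r: "r \<in> R" using R by blast
  have EQsub: "EQ \<subseteq> {..<n} \<times> {..<n}" by (auto simp: EQ_def)
  have finEQ: "finite EQ" using EQsub finite_subset by blast
  have segEQ: "\<Union>(seg ` im Q) \<inter> R = {}" if "Q \<subseteq> EQ" for Q
    using that by (fastforce simp: im_def EQ_def)
  define good where "good Q \<longleftrightarrow> Q \<subseteq> EQ \<and> face (im Q) r = face (im EQ) r" for Q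
  have "good EQ" by (simp add: good_def)
  from ex_has_least_nat[of good, OF this, of card] obtain Q where
    gQ: "good Q" and gmin: "\<forall>Q'. good Q' \<longrightarrow> card Q \<le> card Q'" by blast
  have Q: "Q \<subseteq> EQ" "face (im Q) r = face (im EQ) r" using gQ by (simp_all only: good_def)
  have min: "card Q \<le> card Q'" if "Q' \<subseteq> EQ" "face (im Q') r = face (im EQ) r" for Q'
    using gmin that unfolding good_def by blast
  have finQ: "finite Q" using Q finEQ finite_subset by blast
  have injp: "pt x u = pt x v \<longleftrightarrow> u = v" if "u < n" "v < n" for u v
    using inj that by (auto dest: inj_onD)
  have injpair: "inj_on (\<lambda>(u, v). (pt x u, pt x v)) ({..<n} \<times> {..<n})"
    by (auto intro!: inj_onI simp: injp)
  have rQ: "r \<notin> \<Union>(seg ` im Q')" if "Q' \<subseteq> EQ" for Q' using segEQ[OF that] r by blast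
  \<comment> \<open>An edge that the face without it does not meet could be dropped from
    \<open>Q\<close> without changing the face.\<close>
  have meets: "face (im Q - {e}) r \<inter> seg e \<noteq> {}" if e: "e \<in> im Q" for e
  proof (rule ccontr)
    assume "\<not> ?thesis"
    then have empty: "face (im Q - {e}) r \<inter> seg e = {}" by simp
    obtain q where q: "q \<in> Q" "e = (\<lambda>(u, v). (pt x u, pt x v)) q" using e by (auto simp: im_def)
    have imd: "im Q - {e} = im (Q - {q})"
      unfolding im_def q(2) using injpair Q(1) EQsub q(1)
      by (subst inj_on_image_set_diff[of _ "{..<n} \<times> {..<n}"]) auto
    have "face (im Q - {e}) r \<subseteq> - \<Union>(seg ` im Q)"
      using empty connected_component_subset[of "- \<Union>(seg ` (im Q - {e}))" r] by blast
    moreover have "r \<in> face (im Q - {e}) r" using rQ[OF Q(1)] by auto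
    ultimately have "face (im Q - {e}) r \<subseteq> face (im Q) r"
      by (intro connected_component_maximal) auto
    moreover have "face (im Q) r \<subseteq> face (im Q - {e}) r" by (intro connected_component_mono) auto
    ultimately have "face (im (Q - {q})) r = face (im EQ) r" using Q(2) imd by simp
    then have "card Q \<le> card (Q - {q})" using Q(1) by (intro min) auto
    then show False using q finQ by (metis card_Diff1_less not_less)
  qed
  have cardP: "card (pt x ` {..<n}) = n" using card_image[OF inj] by simp
  have "real (card (im Q)) \<le> 4 * card (pt x ` {..<n}) * (2 * log 2 (card (pt x ` {..<n})) + 1)"
  proof (rule card_face_edges_le)
    show "im Q \<subseteq> pt x ` {..<n} \<times> pt x ` {..<n}" using Q(1) EQsub by (fastforce simp: im_def)
    \<comment> \<open>Pairs in \<open>EQ\<close> are increasing, so no segment occurs in both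
      directions.\<close>
    show "(b, a) \<notin> im Q" if ab: "(a, b) \<in> im Q" for a b
    proof
      assume "(b, a) \<in> im Q"
      then obtain u v u' v' where "(u, v) \<in> Q" "(u', v') \<in> Q" "pt x u = pt x v'" "pt x v = pt x u'"
        using ab by (auto simp: im_def)
      moreover have "u < v" "v < n" "u' < v'" "v' < n" using calculation(1,2) Q(1) by (auto simp: EQ_def)
      ultimately show False using injp[of u v'] injp[of v u'] by simp
    qed
    show "r \<notin> \<Union>(seg ` im Q)" by (rule rQ[OF Q(1)])
  qed (use n cardP gen meets in auto)
  moreover have "card (im Q) = card Q" unfolding im_def
    using injpair Q(1) EQsub by (intro card_image) (blast intro: inj_on_subset)
  ultimately have "real (card Q) \<le> 4 * real n * (2 * log 2 (real n) + 1)" unfolding cardP by simp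
  then have cardQ: "card Q \<le> max_edges n" unfolding max_edges_def by (simp add: le_nat_floor)
  have dec: "y \<in> face (im Q) r \<longleftrightarrow> sv n x y \<in> reach n (range (sv n x)) Q (sv n x r)" for y
  proof (rule face_decode[OF _ _ rQ[OF Q(1)]])
    show "u < n \<and> v < n \<and> pt x u \<noteq> pt x v" if "(u, v) \<in> Q" for u v
      using that Q(1) injp[of u v] by (auto simp: EQ_def)
  qed (simp add: im_def)
  have Rface: "R \<subseteq> face (im Q) r" unfolding Q(2)
    using segEQ[of EQ] r R by (intro connected_component_maximal) auto
  \<comment> \<open>A segment that avoids \<open>R\<close> is one of the segments of
    \<open>EQ\<close> and hence disjoint from their face; the converse holds because
    \<open>R\<close> lies in the face.\<close>
  have "closed_segment (pt x u) (pt x v) \<inter> R = {} \<longleftrightarrow>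
      (\<forall>\<sigma>\<in>reach n (range (sv n x)) Q (sv n x r). \<not> onseg \<sigma> u v)" if uv: "u < n" "v < n" "u \<noteq> v" for u v
  proof -
    have ne: "pt x u \<noteq> pt x v" using injp uv by simp
    have rng: "\<sigma> \<in> range (sv n x)" if "\<sigma> \<in> reach n (range (sv n x)) Q (sv n x r)" for \<sigma>
      using that unfolding reach_def by (auto elim: rtranclE)
    show ?thesis
    proof
      assume em: "closed_segment (pt x u) (pt x v) \<inter> R = {}"
      then have "(min u v, max u v) \<in> EQ" using uv by (auto simp: EQ_def min_def max_def closed_segment_commute)
      then have "(pt x (min u v), pt x (max u v)) \<in> im EQ" unfolding im_def by (intro image_eqI) auto
      then have "closed_segment (pt x (min u v)) (pt x (max u v)) \<subseteq> \<Union>(seg ` im EQ)"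
        using UN_upper[of "(pt x (min u v), pt x (max u v))" "im EQ" seg] by simp
      then have "closed_segment (pt x (min u v)) (pt x (max u v)) \<inter> face (im Q) r = {}"
        unfolding Q(2) using connected_component_subset[of "- \<Union>(seg ` im EQ)" r] by blast
      moreover have sw: "closed_segment (pt x (min u v)) (pt x (max u v)) = closed_segment (pt x u) (pt x v)"
        by (cases "u \<le> v") (simp_all add: min_def max_def closed_segment_commute)
      ultimately have dis: "closed_segment (pt x u) (pt x v) \<inter> face (im Q) r = {}"
        by (simp only: sw)
      show "\<forall>\<sigma>\<in>reach n (range (sv n x)) Q (sv n x r). \<not> onseg \<sigma> u v"
      proof
        fix \<sigma> assume s: "\<sigma> \<in> reach n (range (sv n x)) Q (sv n x r)"
        then obtain y where "\<sigma> = sv n x y" using rng by blast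
        then show "\<not> onseg \<sigma> u v" using s dec[of y] dis onseg_iff[OF uv(1,2) ne, of y] by blast
      qed
    next
      assume no: "\<forall>\<sigma>\<in>reach n (range (sv n x)) Q (sv n x r). \<not> onseg \<sigma> u v"
      show "closed_segment (pt x u) (pt x v) \<inter> R = {}"
      proof (rule ccontr)
        assume "\<not> ?thesis"
        then obtain y where "y \<in> closed_segment (pt x u) (pt x v)" "y \<in> R" by blast
        then show False using no dec[of y] Rface onseg_iff[OF uv(1,2) ne, of y] by blast
      qed
    qed
  qed
  then show ?thesis using cardQ Q(1) EQsub by (intro exI[of _ Q] exI[of _ "sv n x r"]) auto
qed

section \<open>Graphs with few obstacles\<close>

lemma mpoly_smult: "mpoly k d f \<Longrightarrow> mpoly k d (\<lambda>x. c * f x)"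
  using mpoly_mult[OF mpoly_const[of k 0 c]] by simp

lemma mpoly_coeffs_affine:
  assumes "m \<in> Idx n"
  shows "mpoly (2 * n) 2 (\<lambda>x. ca x m)" "mpoly (2 * n) 2 (\<lambda>x. cb x m)" "mpoly (2 * n) 2 (\<lambda>x. cc x m)"
proof -
  obtain j u v where m: "m = (j, u, v)" "u < n" "v < n" using assms by auto
  have v: "mpoly (2 * n) d (\<lambda>x. x (2 * u))" "mpoly (2 * n) d (\<lambda>x. x (2 * u + 1))"
    "mpoly (2 * n) d (\<lambda>x. x (2 * v))" "mpoly (2 * n) d (\<lambda>x. x (2 * v + 1))" if "1 \<le> d" for d
    using that m by (auto intro!: mpoly_var)
  have dd: "mpoly (2 * n) (1 + 1) (\<lambda>x. (x (2 * v + 1) - x (2 * u + 1)) * x (2 * u) - (x (2 * v) - x (2 * u)) * x (2 * u + 1))"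
    "mpoly (2 * n) (1 + 1) (\<lambda>x. 0 - ((x (2 * v) - x (2 * u)) * x (2 * u) + (x (2 * v + 1) - x (2 * u + 1)) * x (2 * u + 1)))"
    by (intro mpoly_diff mpoly_add mpoly_mult mpoly_const v order_refl)+
  note dd2 = dd[unfolded one_add_one]
  have mif: "mpoly (2 * n) 2 (\<lambda>x. if b then f x else g x)" if "mpoly (2 * n) 2 f" "mpoly (2 * n) 2 g" for b f g
    using that by (cases b) simp_all
  show "mpoly (2 * n) 2 (\<lambda>x. ca x m)" "mpoly (2 * n) 2 (\<lambda>x. cb x m)"
    unfolding m ca.simps cb.simps by (intro mif mpoly_diff mpoly_const v; simp)+
  show "mpoly (2 * n) 2 (\<lambda>x. cc x m)"
    unfolding m cc.simps by (intro mif mpoly_const dd2)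
qed

definition spol :: "nat \<times> (nat \<times> nat \<times> nat) \<times> (nat \<times> nat \<times> nat) \<times> real \<times> (nat \<times> nat \<times> nat) \<times> (nat \<times> nat \<times> nat)
    \<times> real \<times> (nat \<times> nat \<times> nat) \<Rightarrow> (nat \<Rightarrow> real) \<Rightarrow> real" where
  "spol = (\<lambda>(q, i, j, \<delta>, k, l, \<epsilon>, m) x. if q = 0 then affine_family.smpW (ca x) i j
     else if q = 1 then affine_family.smpV (ca x) (cb x) i j k l
     else affine_family.smpN (ca x) (cb x) (cc x) i j \<delta> k l \<epsilon> m)"

abbreviation shifts :: "real set" where "shifts \<equiv> {-1, 0, 1}"

abbreviation Sidx where
  "Sidx n \<equiv> {..<3::nat} \<times> Idx n \<times> Idx n \<times> shifts \<times> Idx n \<times> Idx n \<times> shifts \<times> Idx n"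

text \<open>Starting from degree 2 for the coefficients, the bounds are 4 for \<open>smpW\<close>,
  \<open>smpX1\<close>, \<open>smpX0\<close>, 6 for \<open>smpA\<close>, \<open>smpB\<close>, 12 for
  \<open>smpV\<close>, \<open>smpY\<close> and 18 for \<open>smpN\<close>.\<close>

lemma mpoly_spol:
  assumes "t \<in> Sidx n"
  shows "mpoly (2 * n) 18 (spol t)"
proof -
  obtain q i j \<delta> k l \<epsilon> m where t: "t = (q, i, j, \<delta>, k, l, \<epsilon>, m)" and
    mem: "i \<in> Idx n" "j \<in> Idx n" "k \<in> Idx n" "l \<in> Idx n" "m \<in> Idx n" using assms by auto
  note af = affine_family.smpW_def affine_family.smpX1_def affine_family.smpX0_def affine_family.smpA_def
    affine_family.smpB_def affine_family.smpV_def affine_family.smpY_def affine_family.smpN_def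
  note co = mpoly_coeffs_affine
  have mul: "mpoly (2 * n) D (\<lambda>x. f x * g x)" if "mpoly (2 * n) d f" "mpoly (2 * n) e g" "D = d + e" for D d e f g
    using mpoly_mult[OF that(1,2)] that(3) by simp
  have W: "mpoly (2 * n) 4 (\<lambda>x. affine_family.smpW (ca x) i j)"
    unfolding af by (rule mul[OF mpoly_smult[OF co(1)] co(1)]) (use mem in auto)
  have X1: "mpoly (2 * n) 4 (\<lambda>x. affine_family.smpX1 (ca x) (cb x) i j)"
  proof -
    have "mpoly (2 * n) 4 (\<lambda>x. 0 - (cb x i * ca x j + cb x j * ca x i))"
      by (intro mpoly_diff mpoly_add mpoly_const mul[OF co(2) co(1)]) (use mem in auto)
    then show ?thesis unfolding af by simp
  qed
  have X0: "mpoly (2 * n) 4 (\<lambda>x. affine_family.smpX0 (ca x) (cc x) i j \<delta>)"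
    unfolding af
    by (intro mpoly_diff mpoly_add mul[OF mpoly_smult[OF co(1)] co(1)] mul[OF co(3) co(1)]) (use mem in auto)
  have A: "mpoly (2 * n) 6 (\<lambda>x. affine_family.smpA (ca x) (cb x) i j k)" if "k \<in> Idx n" for k
    unfolding affine_family.smpA_def
    by (intro mpoly_add mul[OF co(1)[OF that] X1] mul[OF co(2)[OF that] W]) auto
  have B: "mpoly (2 * n) 6 (\<lambda>x. affine_family.smpB (ca x) (cc x) i j \<delta> k)" if "k \<in> Idx n" for k
    unfolding affine_family.smpB_def
    by (intro mpoly_add mul[OF co(1)[OF that] X0] mul[OF co(3)[OF that] W]) auto
  have V: "mpoly (2 * n) 12 (\<lambda>x. affine_family.smpV (ca x) (cb x) i j k l)"
    unfolding affine_family.smpV_def by (rule mul[OF mpoly_smult[OF A] A]) (use mem in auto)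
  have Y: "mpoly (2 * n) 12 (\<lambda>x. affine_family.smpY (ca x) (cb x) (cc x) i j \<delta> k l \<epsilon>)"
    unfolding affine_family.smpY_def
    by (intro mpoly_diff mpoly_add mul[OF mpoly_smult[OF A] A] mul[OF B A]) (use mem in auto)
  have N: "mpoly (2 * n) 18 (\<lambda>x. affine_family.smpN (ca x) (cb x) (cc x) i j \<delta> k l \<epsilon> m)"
    unfolding affine_family.smpN_def
    by (intro mpoly_add mul[OF A[OF mem(5)] Y] mul[OF B[OF mem(5)] V]) auto
  have "mpoly (2 * n) 18 (\<lambda>x. affine_family.smpW (ca x) i j)" "mpoly (2 * n) 18 (\<lambda>x. affine_family.smpV (ca x) (cb x) i j k l)"
    by (rule mpoly_mono[OF W], simp, simp) (rule mpoly_mono[OF V], simp, simp)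
  then show ?thesis using N unfolding t spol_def prod.case
    by (cases "q = 0"; cases "q = 1"; simp only: if_True if_False refl)
qed

definition spat :: "nat \<Rightarrow> (nat \<Rightarrow> real) \<Rightarrow> _ \<Rightarrow> real" where
  "spat n x = (\<lambda>t\<in>Sidx n. sgn (spol t x))"

abbreviation Smp where
  "Smp n \<equiv> Idx n \<times> Idx n \<times> shifts \<times> Idx n \<times> Idx n \<times> shifts"

text \<open>The product of three signs is the sign of \<open>smpN / (smpV * smpW)\<close>. The two
  denominators do not depend on \<open>m\<close>, so their signs are tested at the dummy index
  \<open>(0, 0, 0)\<close>.\<close>

definition faces_of_pattern where
  "faces_of_pattern n \<pi> = (\<lambda>(i, j, \<delta>, k, l, \<epsilon>). \<lambda>m\<in>Idx n. \<pi> (2, i, j, \<delta>, k, l, \<epsilon>, m)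
      * \<pi> (1, i, j, \<delta>, k, l, \<epsilon>, m) * \<pi> (0, i, j, \<delta>, k, l, \<epsilon>, m))
    ` {(i, j, \<delta>, k, l, \<epsilon>) \<in> Smp n. \<pi> (0, i, j, \<delta>, k, l, \<epsilon>, (0, 0, 0)) \<noteq> 0 \<and> \<pi> (1, i, j, \<delta>, k, l, \<epsilon>, (0, 0, 0)) \<noteq> (0 :: real)}"

lemma range_sv:
  assumes n: "1 \<le> n"
  shows "range (sv n x) = faces_of_pattern n (spat n x)"
proof -
  let ?W = "affine_family.smpW (ca x)" and ?V = "affine_family.smpV (ca x) (cb x)"
    and ?N = "affine_family.smpN (ca x) (cb x) (cc x)"
  have p0: "spat n x (0, i, j, \<delta>, k, l, \<epsilon>, m) = sgn (?W i j)" "spat n x (1, i, j, \<delta>, k, l, \<epsilon>, m) = sgn (?V i j k l)"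
    "spat n x (2, i, j, \<delta>, k, l, \<epsilon>, m) = sgn (?N i j \<delta> k l \<epsilon> m)"
    if "(i, j, \<delta>, k, l, \<epsilon>) \<in> Smp n" "m \<in> Idx n" for i j \<delta> k l \<epsilon> m
    using that by (auto simp: spat_def spol_def)
  have z: "(0, 0, 0) \<in> Idx n" using n by auto
  show ?thesis
  proof
    show "range (sv n x) \<subseteq> faces_of_pattern n (spat n x)"
    proof
      fix \<sigma> assume "\<sigma> \<in> range (sv n x)"
      then obtain y where y: "\<sigma> = sv n x y" by blast
      have "\<exists>i\<in>Idx n. \<exists>j\<in>Idx n. \<exists>\<delta>\<in>shifts. \<exists>k\<in>Idx n. \<exists>l\<in>Idx n. \<exists>\<epsilon>\<in>shifts. ?W i j \<noteq> 0 \<and> ?V i j k l \<noteq> 0 \<and>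
        (\<forall>m\<in>Idx n. sgn (ca x m * Re y + cb x m * Im y + cc x m) = sgn (?N i j \<delta> k l \<epsilon> m) * sgn (?V i j k l) * sgn (?W i j))"
        \<comment> \<open>The two coordinate functions serve as the nondegenerate members of the
          family.\<close>
        by (rule affine_family.sample_complete[where ?k1.0 = "(2, 0, 0)" and ?k2.0 = "(3, 0, 0)"]) (use n in auto)
      then obtain i j \<delta> k l \<epsilon> where mem: "i \<in> Idx n" "j \<in> Idx n" "\<delta> \<in> shifts" "k \<in> Idx n" "l \<in> Idx n" "\<epsilon> \<in> shifts"
        and nz: "?W i j \<noteq> 0" "?V i j k l \<noteq> 0"
        and sg: "\<forall>m\<in>Idx n. sgn (val x m y) = sgn (?N i j \<delta> k l \<epsilon> m) * sgn (?V i j k l) * sgn (?W i j)"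
        unfolding val_def[symmetric] by (elim bexE conjE) (rule that)
      have s: "(i, j, \<delta>, k, l, \<epsilon>) \<in> Smp n" by (intro SigmaI mem)
      show "\<sigma> \<in> faces_of_pattern n (spat n x)" unfolding faces_of_pattern_def
      proof (rule image_eqI[where x = "(i, j, \<delta>, k, l, \<epsilon>)"])
        show "\<sigma> = (case (i, j, \<delta>, k, l, \<epsilon>) of (i, j, \<delta>, k, l, \<epsilon>) \<Rightarrow> \<lambda>m\<in>Idx n. spat n x (2, i, j, \<delta>, k, l, \<epsilon>, m)
            * spat n x (1, i, j, \<delta>, k, l, \<epsilon>, m) * spat n x (0, i, j, \<delta>, k, l, \<epsilon>, m))"
          unfolding y sv_def prod.case by (intro restrict_ext) (simp only: bspec[OF sg] p0[OF s])
        show "(i, j, \<delta>, k, l, \<epsilon>) \<in> {(i, j, \<delta>, k, l, \<epsilon>) \<in> Smp n. spat n x (0, i, j, \<delta>, k, l, \<epsilon>, (0, 0, 0)) \<noteq> 0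
            \<and> spat n x (1, i, j, \<delta>, k, l, \<epsilon>, (0, 0, 0)) \<noteq> 0}"
          unfolding mem_Collect_eq prod.case p0[OF s z] sgn_zero_iff by (intro conjI s nz)
      qed
    qed
    show "faces_of_pattern n (spat n x) \<subseteq> range (sv n x)"
    proof
      fix \<sigma> assume "\<sigma> \<in> faces_of_pattern n (spat n x)"
      then obtain q where q: "q \<in> {(i, j, \<delta>, k, l, \<epsilon>) \<in> Smp n. spat n x (0, i, j, \<delta>, k, l, \<epsilon>, (0, 0, 0)) \<noteq> 0
            \<and> spat n x (1, i, j, \<delta>, k, l, \<epsilon>, (0, 0, 0)) \<noteq> 0}" and \<sigma>q: "\<sigma> = (\<lambda>(i, j, \<delta>, k, l, \<epsilon>). \<lambda>m\<in>Idx n. spat n x (2, i, j, \<delta>, k, l, \<epsilon>, m)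
            * spat n x (1, i, j, \<delta>, k, l, \<epsilon>, m) * spat n x (0, i, j, \<delta>, k, l, \<epsilon>, m)) q"
        unfolding faces_of_pattern_def by (elim imageE) (rule that)
      obtain i j \<delta> k l \<epsilon> where qq: "q = (i, j, \<delta>, k, l, \<epsilon>)" by (rule prod_cases6)
      note q' = q[unfolded qq mem_Collect_eq prod.case]
      note s = q'[THEN conjunct1] and nz = q'[THEN conjunct2, THEN conjunct1] q'[THEN conjunct2, THEN conjunct2]
      have \<sigma>: "\<sigma> = (\<lambda>m\<in>Idx n. spat n x (2, i, j, \<delta>, k, l, \<epsilon>, m)
            * spat n x (1, i, j, \<delta>, k, l, \<epsilon>, m) * spat n x (0, i, j, \<delta>, k, l, \<epsilon>, m))"
        using \<sigma>q unfolding qq prod.case .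
      have "?W i j \<noteq> 0" "?V i j k l \<noteq> 0" using nz unfolding p0[OF s z] sgn_zero_iff .
      from affine_family.sample_sound[OF this, of "cc x" \<delta> \<epsilon>] obtain a b where
        ab: "\<And>m. sgn (ca x m * a + cb x m * b + cc x m) = sgn (?N i j \<delta> k l \<epsilon> m) * sgn (?V i j k l) * sgn (?W i j)" by blast
      have "\<sigma> = sv n x (Complex a b)"
        unfolding \<sigma> sv_def val_def complex.sel by (intro restrict_ext) (simp only: ab p0[OF s])
      then show "\<sigma> \<in> range (sv n x)" by blast
    qed
  qed
qed

lemma card_Idx: "card (Idx n) = 4 * (n * n)"
  by (simp add: card_cartesian_product)

lemma card_shifts: "card shifts = 3"
  by simp

lemma finite_range_sv:
  assumes "1 \<le> n"
  shows "finite (range (sv n x))" "card (range (sv n x)) \<le> 9 * (4 * (n * n)) ^ 4"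
proof -
  let ?D = "{(i, j, \<delta>, k, l, \<epsilon>) \<in> Smp n. spat n x (0, i, j, \<delta>, k, l, \<epsilon>, (0, 0, 0)) \<noteq> 0 \<and> spat n x (1, i, j, \<delta>, k, l, \<epsilon>, (0, 0, 0)) \<noteq> 0}"
  have sub: "?D \<subseteq> Smp n" by auto
  have fin: "finite (Smp n)" by auto
  have finD: "finite ?D" using finite_subset[OF sub fin] .
  show "finite (range (sv n x))" unfolding range_sv[OF assms] faces_of_pattern_def by (rule finite_imageI[OF finD])
  have "card (range (sv n x)) \<le> card ?D" unfolding range_sv[OF assms] faces_of_pattern_def by (rule card_image_le[OF finD])
  also have "\<dots> \<le> card (Smp n)" by (rule card_mono[OF fin sub])
  also have "\<dots> = 9 * (4 * (n * n)) ^ 4"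
    unfolding card_cartesian_product card_Idx[unfolded card_cartesian_product] card_shifts
    by (simp add: power4_eq_xxxx)
  finally show "card (range (sv n x)) \<le> 9 * (4 * (n * n)) ^ 4" .
qed

text \<open>By \<open>range_sv\<close> the set of sign vectors is a function of the signs of the
  \<open>spol\<close>. The number of these polynomials, \<open>27 * (4 * (n * n)) ^ 5\<close>, comes
  from three kinds, two shifts with three values each, and five indices.\<close>

lemma card_face_structures:
  assumes n: "1 \<le> n"
  shows "finite (range (\<lambda>x. range (sv n x)))"
    "card (range (\<lambda>x. range (sv n x))) \<le> ((2 * n + 2) * (2 * (2 * (27 * (4 * (n * n)) ^ 5) * 18 + 2 * (2 * n)))) ^ (2 * n + 1)"
proof -
  have fin: "finite (Sidx n)" by auto
  have k: "1 \<le> 2 * n" using n by simp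
  have pow5: "3 * (A * (A * (3 * (A * (A * (3 * A)))))) = 27 * A ^ 5" for A :: nat
  proof -
    have "A ^ 5 = A * (A * (A * (A * A)))" by (simp add: eval_nat_numeral)
    then show ?thesis by simp
  qed
  have cardT: "card (Sidx n) = 27 * (4 * (n * n)) ^ 5"
    unfolding card_cartesian_product card_Idx[unfolded card_cartesian_product] card_shifts card_lessThan by (rule pow5)
  note b = card_sign_patterns_le[OF k fin, of 18 spol, OF mpoly_spol, unfolded cardT, folded spat_def]
  have eq: "range (\<lambda>x. range (sv n x)) = faces_of_pattern n ` range (\<lambda>x. spat n x)"
    unfolding range_sv[OF n] image_image ..
  show "finite (range (\<lambda>x. range (sv n x)))" unfolding eq using b(1) by (rule finite_imageI)
  have "card (range (\<lambda>x. range (sv n x))) \<le> card (range (\<lambda>x. spat n x))"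
    unfolding eq using b(1) by (rule card_image_le)
  also note b(2)
  finally show "card (range (\<lambda>x. range (sv n x))) \<le> ((2 * n + 2) * (2 * (2 * (27 * (4 * (n * n)) ^ 5) * 18 + 2 * (2 * n)))) ^ (2 * n + 1)" .
qed

section \<open>From obstacles to codes\<close>

lemma card_small_subsets:
  assumes "finite A"
  shows "finite {Q. Q \<subseteq> A \<and> card Q \<le> K}" "card {Q. Q \<subseteq> A \<and> card Q \<le> K} \<le> (card A + 1) ^ K"
proof -
  \<comment> \<open>A subset is coded by an enumeration, padded with \<open>None\<close> to the
    fixed length \<open>K\<close>.\<close>
  let ?F = "PiE {..<K} (\<lambda>_. insert None (Some ` A))"
  have finF: "finite ?F" using assms by (intro finite_PiE) auto
  have cardF: "card ?F = (card A + 1) ^ K"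
    using assms by (simp add: card_PiE card_insert_if card_image image_iff)
  have sub: "{Q. Q \<subseteq> A \<and> card Q \<le> K} \<subseteq> (\<lambda>f. {a. Some a \<in> f ` {..<K}}) ` ?F"
  proof
    fix Q assume "Q \<in> {Q. Q \<subseteq> A \<and> card Q \<le> K}"
    then have Q: "Q \<subseteq> A" "card Q \<le> K" by auto
    have "finite Q" using Q assms finite_subset by blast
    then obtain g where g: "bij_betw g {0..<card Q} Q" using ex_bij_betw_nat_finite by blast
    define f where "f = (\<lambda>i\<in>{..<K}. if i < card Q then Some (g i) else None)"
    have gA: "g i \<in> A" if "i < card Q" for i using g Q that by (auto simp: bij_betw_def)
    have "f \<in> ?F" using gA by (auto simp: f_def)
    moreover have "Q = {a. Some a \<in> f ` {..<K}}"
    proof (intro set_eqI iffI)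
      fix a assume "a \<in> Q"
      then have "a \<in> g ` {0..<card Q}" using g by (simp add: bij_betw_def)
      then obtain i where "i < card Q" "a = g i" by auto
      then show "a \<in> {a. Some a \<in> f ` {..<K}}" using Q(2) by (auto simp: f_def image_iff intro!: bexI[of _ i])
    next
      fix a assume "a \<in> {a. Some a \<in> f ` {..<K}}"
      then show "a \<in> Q" using g by (auto simp: f_def bij_betw_def split: if_splits)
    qed
    ultimately show "Q \<in> (\<lambda>f. {a. Some a \<in> f ` {..<K}}) ` ?F" by blast
  qed
  show "finite {Q. Q \<subseteq> A \<and> card Q \<le> K}" by (rule finite_subset[OF sub finite_imageI[OF finF]])
  have "card {Q. Q \<subseteq> A \<and> card Q \<le> K} \<le> card ((\<lambda>f. {a. Some a \<in> f ` {..<K}}) ` ?F)"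
    by (rule card_mono[OF finite_imageI[OF finF] sub])
  also have "\<dots> \<le> card ?F" by (rule card_image_le[OF finF])
  finally show "card {Q. Q \<subseteq> A \<and> card Q \<le> K} \<le> (card A + 1) ^ K" unfolding cardF .
qed

definition plane :: "point \<Rightarrow> complex" where
  "plane y = Complex (y $ 1) (y $ 2)"

lemma linear_plane: "linear plane"
  by (rule linearI) (simp_all add: plane_def complex_eq_iff)

lemma inj_plane: "inj plane"
  by (rule injI) (simp add: plane_def vec_eq_iff forall_2)

lemma plane_eq_iff: "plane a = plane b \<longleftrightarrow> a = b"
  using inj_plane by (auto dest: injD)

lemma plane_segment: "closed_segment (plane a) (plane b) = plane ` closed_segment a b"
  by (rule closed_segment_linear_image[OF linear_plane])

lemma general_position_cross:
  assumes gp: "general_position A" and mem: "a \<in> A" "b \<in> A" "c \<in> A" and ne: "a \<noteq> b" "a \<noteq> c" "b \<noteq> c"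
  shows "cross (plane b - plane a) (plane c - plane a) \<noteq> 0"
proof
  assume 0: "cross (plane b - plane a) (plane c - plane a) = 0"
  define d where "d = plane b - plane a"
  have d: "d \<noteq> 0" using ne by (simp add: d_def plane_eq_iff)
  have lin: "plane (x - y) = plane x - plane y" "plane (r *\<^sub>R x) = r *\<^sub>R plane x" for x y r
    by (simp_all add: plane_def complex_eq_iff)
  define t where "t = (d \<bullet> (plane c - plane a)) / (d \<bullet> d)"
  have "plane c - plane a = t *\<^sub>R d"
    unfolding t_def by (rule cross_eq_0_imp_multiple[OF 0[folded d_def] d])
  then have "plane (c - a) = plane (t *\<^sub>R (b - a))" by (simp add: lin d_def)
  then have "c - a = t *\<^sub>R (b - a)" by (simp only: plane_eq_iff)
  then have c: "c = a + t *\<^sub>R (b - a)" by (simp add: algebra_simps)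
  have "collinear {a, b, c}"
    unfolding collinear_def
  proof (rule exI[of _ "b - a"], intro ballI)
    fix x y assume "x \<in> {a, b, c}" "y \<in> {a, b, c}"
    then obtain r s where "x = a + r *\<^sub>R (b - a)" "y = a + s *\<^sub>R (b - a)"
      using c by (metis add.right_neutral add_diff_cancel_left' diff_add_cancel insertE scaleR_one scaleR_zero_left singletonD add.commute)
    then have "x - y = (r - s) *\<^sub>R (b - a)" by (simp only: scaleR_left_diff_distrib add_diff_cancel_left)
    then show "\<exists>k. x - y = k *\<^sub>R (b - a)" by blast
  qed
  then show False using gp mem ne unfolding general_position_def by blast
qed

lemma coordinates_exist: "\<exists>x. \<forall>u. pt x u = plane (p u)"
  by (intro exI[of _ "\<lambda>k. if even k then p (k div 2) $ 1 else p (k div 2) $ 2"]) (simp add: pt_def plane_def)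

text \<open>Each obstacle is represented by one code, a set of edges and a sign vector. No
  coordinates enter, so counting codes bounds the number of graphs.\<close>

definition decoded_graph :: "nat \<Rightarrow> signs set \<Rightarrow> nat
    \<Rightarrow> (nat \<Rightarrow> (nat \<times> nat) set \<times> signs) \<Rightarrow> nat set set" where
  "decoded_graph n \<Sigma> h f = {{u, v} | u v. u < n \<and> v < n \<and> u \<noteq> v \<and>
     (\<forall>i<h. \<forall>\<sigma>\<in>reach n \<Sigma> (fst (f i)) (snd (f i)). \<not> onseg \<sigma> u v)}"

lemma labeled_graph_eqI:
  assumes "E \<in> labeled_graphs n" and "\<And>u v. u < n \<Longrightarrow> v < n \<Longrightarrow> u \<noteq> v \<Longrightarrow> {u, v} \<in> E \<longleftrightarrow> P u v"
  shows "E = {{u, v} | u v. u < n \<and> v < n \<and> u \<noteq> v \<and> P u v}"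
proof (intro set_eqI iffI)
  fix e assume e: "e \<in> E"
  then have "e \<subseteq> {..<n}" "card e = 2" using assms(1) by (auto simp: labeled_graphs_def)
  then obtain u v where "e = {u, v}" "u \<noteq> v" "u < n" "v < n" by (auto simp: card_2_iff)
  then show "e \<in> {{u, v} | u v. u < n \<and> v < n \<and> u \<noteq> v \<and> P u v}" using assms(2) e by blast
next
  fix e assume "e \<in> {{u, v} | u v. u < n \<and> v < n \<and> u \<noteq> v \<and> P u v}"
  then show "e \<in> E" using assms(2) by blast
qed

lemma obstacles_decoding:
  assumes n: "2 \<le> n" and E: "E \<in> labeled_graphs n" "admits_obstacles n h E"
  shows "\<exists>x. \<exists>f \<in> PiE {..<h} (\<lambda>_. {Q. Q \<subseteq> {..<n} \<times> {..<n} \<and> card Q \<le> max_edges n} \<times> range (sv n x)).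
    E = decoded_graph n (range (sv n x)) h f"
proof -
  obtain p Obs sides where rep: "obstacle_representation n E p Obs sides" and h: "card Obs = h"
    using E(2) by (auto simp: admits_obstacles_def)
  have fin: "finite Obs" and inj: "inj_on p {..<n}" and poly: "\<And>R. R \<in> Obs \<Longrightarrow> polygonal_region R (sides R)"
    and gp: "general_position (p ` {..<n} \<union> (\<Union>R\<in>Obs. \<Union>(sides R)))"
    and adj: "\<And>u v. u < n \<Longrightarrow> v < n \<Longrightarrow> u \<noteq> v \<Longrightarrow> {u, v} \<in> E \<longleftrightarrow> (\<forall>R\<in>Obs. closed_segment (p u) (p v) \<inter> R = {})"
    using rep unfolding obstacle_representation_def by blast+
  obtain x where x: "\<And>u. pt x u = plane (p u)" using coordinates_exist by blast
  obtain ob where ob: "bij_betw ob {0..<h} Obs" using ex_bij_betw_nat_finite[OF fin] h by blast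
  have injx: "inj_on (pt x) {..<n}" using inj unfolding inj_on_def x plane_eq_iff .
  have gen: "cross (b - a) (c - a) \<noteq> 0" if mem: "a \<in> pt x ` {..<n}" "b \<in> pt x ` {..<n}" "c \<in> pt x ` {..<n}"
    and ne: "a \<noteq> b" "a \<noteq> c" "b \<noteq> c" for a b c
  proof -
    obtain i j k where ijk: "i < n" "j < n" "k < n" and abc: "a = plane (p i)" "b = plane (p j)" "c = plane (p k)"
      using mem x by auto
    show ?thesis unfolding abc
      by (rule general_position_cross[OF gp]) (use ijk ne abc in auto)
  qed
  let ?S = "range (sv n x)"
  have enc: "\<exists>Q \<rho>. Q \<subseteq> {..<n} \<times> {..<n} \<and> card Q \<le> max_edges n \<and> \<rho> \<in> ?S \<and>
    (\<forall>u<n. \<forall>v<n. u \<noteq> v \<longrightarrow> (closed_segment (p u) (p v) \<inter> R = {} \<longleftrightarrow> (\<forall>\<sigma>\<in>reach n ?S Q \<rho>. \<not> onseg \<sigma> u v)))"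
    if R: "R \<in> Obs" for R
  proof -
    have "connected R" "R \<noteq> {}" using poly[OF R] by (auto simp: polygonal_region_def)
    then have "connected (plane ` R)" "plane ` R \<noteq> {}"
      using linear_plane linear_continuous_on linear_conv_bounded_linear by (auto intro!: connected_continuous_image)
    from connected_set_encoding[OF n injx gen this] show ?thesis
      unfolding x plane_segment image_Int[OF inj_plane, symmetric] image_is_empty by simp
  qed
  define G where "G R q \<longleftrightarrow> fst q \<subseteq> {..<n} \<times> {..<n} \<and> card (fst q) \<le> max_edges n \<and> snd q \<in> ?S \<and>
    (\<forall>u<n. \<forall>v<n. u \<noteq> v \<longrightarrow> (closed_segment (p u) (p v) \<inter> R = {} \<longleftrightarrow> (\<forall>\<sigma>\<in>reach n ?S (fst q) (snd q). \<not> onseg \<sigma> u v)))"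
    for R q
  have "\<forall>R\<in>Obs. \<exists>q. G R q"
  proof
    fix R assume "R \<in> Obs"
    from enc[OF this] obtain Q \<rho> where "G R (Q, \<rho>)" unfolding G_def fst_conv snd_conv by blast
    then show "\<exists>q. G R q" by blast
  qed
  then obtain g where g: "\<forall>R\<in>Obs. G R (g R)" using bchoice[of Obs G] by blast
  define f where "f = (\<lambda>i\<in>{..<h}. g (ob i))"
  have Oi: "ob i \<in> Obs" if "i < h" for i using ob that by (auto simp: bij_betw_def)
  have Gf: "G (ob i) (f i)" if "i < h" for i using g Oi[OF that] that by (simp add: f_def)
  have Obs: "Obs = ob ` {..<h}" using ob by (simp add: bij_betw_def atLeast0LessThan)
  have "f \<in> PiE {..<h} (\<lambda>_. {Q. Q \<subseteq> {..<n} \<times> {..<n} \<and> card Q \<le> max_edges n} \<times> ?S)"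
  proof (rule PiE_I)
    fix i assume "i \<in> {..<h}"
    then have "G (ob i) (f i)" using Gf by simp
    then show "f i \<in> {Q. Q \<subseteq> {..<n} \<times> {..<n} \<and> card Q \<le> max_edges n} \<times> ?S"
      unfolding G_def by (simp add: mem_Times_iff)
  qed (simp add: f_def)
  moreover have "E = decoded_graph n ?S h f" unfolding decoded_graph_def
  proof (rule labeled_graph_eqI[OF E(1)])
    fix u v assume uv: "u < n" "v < n" "u \<noteq> v"
    have "closed_segment (p u) (p v) \<inter> ob i = {} \<longleftrightarrow> (\<forall>\<sigma>\<in>reach n ?S (fst (f i)) (snd (f i)). \<not> onseg \<sigma> u v)"
      if "i < h" for i using Gf[OF that] uv unfolding G_def by blast
    then show "{u, v} \<in> E \<longleftrightarrow> (\<forall>i<h. \<forall>\<sigma>\<in>reach n ?S (fst (f i)) (snd (f i)). \<not> onseg \<sigma> u v)"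
      unfolding adj[OF uv] Obs by auto
  qed
  ultimately show ?thesis by blast
qed

text \<open>The set of sign vectors is chosen once; given it, every obstacle has an independent
  choice of an edge set and of one sign vector.\<close>

lemma card_obstacle_graphs_le:
  assumes n: "2 \<le> n"
  shows "card {E \<in> labeled_graphs n. admits_obstacles n h E} \<le>
    card (range (\<lambda>x. range (sv n x))) * ((n * n + 1) ^ max_edges n * (9 * (4 * (n * n)) ^ 4)) ^ h"
proof -
  let ?QS = "{Q. Q \<subseteq> {..<n} \<times> {..<n} \<and> card Q \<le> max_edges n}"
  let ?SS = "range (\<lambda>x. range (sv n x))"
  have n1: "1 \<le> n" using n by simp
  define im where "im \<Sigma> = decoded_graph n \<Sigma> h ` PiE {..<h} (\<lambda>_. ?QS \<times> \<Sigma>)" for \<Sigma>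
  have finQ: "finite ?QS" and cardQ: "card ?QS \<le> (n * n + 1) ^ max_edges n"
    using card_small_subsets[of "{..<n} \<times> {..<n}" "max_edges n"] by (simp_all add: card_cartesian_product)
  have im: "finite (im \<Sigma>) \<and> card (im \<Sigma>) \<le> ((n * n + 1) ^ max_edges n * (9 * (4 * (n * n)) ^ 4)) ^ h"
    if S: "\<Sigma> \<in> ?SS" for \<Sigma>
  proof -
    have S': "finite \<Sigma>" "card \<Sigma> \<le> 9 * (4 * (n * n)) ^ 4" using S finite_range_sv[OF n1] by auto
    have fin: "finite (PiE {..<h} (\<lambda>_. ?QS \<times> \<Sigma>))" using finQ S' by (intro finite_PiE) auto
    have "card (im \<Sigma>) \<le> card (PiE {..<h} (\<lambda>_. ?QS \<times> \<Sigma>))" unfolding im_def by (rule card_image_le[OF fin])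
    also have "\<dots> = (card ?QS * card \<Sigma>) ^ h" by (simp add: card_PiE card_cartesian_product)
    also have "\<dots> \<le> ((n * n + 1) ^ max_edges n * (9 * (4 * (n * n)) ^ 4)) ^ h"
      by (intro power_mono mult_le_mono cardQ S') auto
    finally show ?thesis using fin by (simp add: im_def)
  qed
  have finSS: "finite ?SS" by (rule card_face_structures[OF n1])
  have "{E \<in> labeled_graphs n. admits_obstacles n h E} \<subseteq> (\<Union>\<Sigma>\<in>?SS. im \<Sigma>)"
  proof
    fix E assume "E \<in> {E \<in> labeled_graphs n. admits_obstacles n h E}"
    then obtain x f where "f \<in> PiE {..<h} (\<lambda>_. ?QS \<times> range (sv n x))" "E = decoded_graph n (range (sv n x)) h f"
      using obstacles_decoding[OF n] by blast
    then have "E \<in> im (range (sv n x))" unfolding im_def by blast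
    then show "E \<in> (\<Union>\<Sigma>\<in>?SS. im \<Sigma>)" by blast
  qed
  then have "card {E \<in> labeled_graphs n. admits_obstacles n h E} \<le> card (\<Union>\<Sigma>\<in>?SS. im \<Sigma>)"
    using finSS im by (intro card_mono finite_UN_I) auto
  also have "\<dots> \<le> (\<Sum>\<Sigma>\<in>?SS. card (im \<Sigma>))" by (rule card_UN_le[OF finSS])
  also have "\<dots> \<le> (\<Sum>\<Sigma>\<in>?SS. ((n * n + 1) ^ max_edges n * (9 * (4 * (n * n)) ^ 4)) ^ h)"
    using im by (intro sum_mono) auto
  finally show ?thesis by simp
qed

section \<open>Graphs with few sides\<close>

text \<open>No endpoint lies on the line of the other segment, so every intersection is a proper
  crossing: each line separates the ends of the other segment.\<close>

lemma segments_meet_iff: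
  assumes "cross (b - a) (c - a) \<noteq> 0" "cross (b - a) (d - a) \<noteq> 0"
    "cross (d - c) (a - c) \<noteq> 0" "cross (d - c) (b - c) \<noteq> 0"
  shows "closed_segment a b \<inter> closed_segment c d \<noteq> {} \<longleftrightarrow>
    cross (b - a) (c - a) * cross (b - a) (d - a) < 0 \<and> cross (d - c) (a - c) * cross (d - c) (b - c) < 0"
proof -
  have separated: "r * s < 0" if "(1 - t) * r + t * s = 0" "0 \<le> t" "t \<le> 1" "r \<noteq> 0" "s \<noteq> 0" for r s t :: real
  proof (rule ccontr)
    assume "\<not> r * s < 0"
    then have rs: "0 < r * s" using that(4,5) by (simp add: not_less less_le)
    have "0 \<le> t * (r * s)" "0 \<le> (1 - t) * (r * r)" using that rs by simp_all
    moreover have "(1 - t) * (r * r) + t * (r * s) = 0"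
      using arg_cong[OF that(1), of "\<lambda>z. r * z"] by (simp add: algebra_simps)
    ultimately have "t * (r * s) = 0" "(1 - t) * (r * r) = 0" by linarith+
    then show False using that(4,5) by auto
  qed
  have ratio: "0 \<le> r / (r - s) \<and> r / (r - s) \<le> 1" if "r * s < 0" for r s :: real
    using that by (auto simp: mult_less_0_iff divide_simps)
  show ?thesis
  proof
    assume "closed_segment a b \<inter> closed_segment c d \<noteq> {}"
    then obtain z where "z \<in> closed_segment a b" "z \<in> closed_segment c d" by blast
    then obtain t s where t: "z = (1 - t) *\<^sub>R a + t *\<^sub>R b" "0 \<le> t" "t \<le> 1"
      and s: "z = (1 - s) *\<^sub>R c + s *\<^sub>R d" "0 \<le> s" "s \<le> 1"
      unfolding closed_segment_def by blast
    have "(1 - s) * cross (b - a) (c - a) + s * cross (b - a) (d - a) = cross (b - a) (z - a)"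
      unfolding s(1) cross_def by (simp add: algebra_simps)
    also have "\<dots> = 0" unfolding t(1) cross_def by (simp add: algebra_simps)
    finally have 1: "(1 - s) * cross (b - a) (c - a) + s * cross (b - a) (d - a) = 0" .
    have "(1 - t) * cross (d - c) (a - c) + t * cross (d - c) (b - c) = cross (d - c) (z - c)"
      unfolding t(1) cross_def by (simp add: algebra_simps)
    also have "\<dots> = 0" unfolding s(1) cross_def by (simp add: algebra_simps)
    finally have 2: "(1 - t) * cross (d - c) (a - c) + t * cross (d - c) (b - c) = 0" .
    show "cross (b - a) (c - a) * cross (b - a) (d - a) < 0 \<and> cross (d - c) (a - c) * cross (d - c) (b - c) < 0"
      using separated[OF 1 s(2,3) assms(1,2)] separated[OF 2 t(2,3) assms(3,4)] ..
  next
    define o1 o2 o3 o4 where o: "o1 = cross (b - a) (c - a)" "o2 = cross (b - a) (d - a)"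
      "o3 = cross (d - c) (a - c)" "o4 = cross (d - c) (b - c)"
    assume "cross (b - a) (c - a) * cross (b - a) (d - a) < 0 \<and> cross (d - c) (a - c) * cross (d - c) (b - c) < 0"
    then have neg: "o1 * o2 < 0" "o3 * o4 < 0" by (simp_all only: o)
    have D: "o3 - o4 = o2 - o1" unfolding o cross_def by (simp add: algebra_simps)
    have ne: "o1 - o2 \<noteq> 0" using neg(1) by (auto simp: mult_less_0_iff)
    define t s where "t = o3 / (o3 - o4)" and "s = o1 / (o1 - o2)"
    have t: "t = - o3 / (o1 - o2)" unfolding t_def D by (metis minus_diff_eq minus_divide_divide minus_divide_left)
    \<comment> \<open>Any three plane vectors satisfy a linear relation whose coefficients are their
      mutual cross products; it yields the crossing parameters \<open>s\<close> and
      \<open>t\<close>.\<close>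
    have id: "(o1 - o2) *\<^sub>R (c - a) + o1 *\<^sub>R (d - c) + o3 *\<^sub>R (b - a) = 0"
      unfolding o cross_def by (rule complex_eqI) (simp_all add: algebra_simps)
    have "(1 / (o1 - o2)) *\<^sub>R ((o1 - o2) *\<^sub>R (c - a) + o1 *\<^sub>R (d - c) + o3 *\<^sub>R (b - a)) = 0" unfolding id by simp
    then have "(c - a) + s *\<^sub>R (d - c) - t *\<^sub>R (b - a) = 0"
      unfolding t s_def using ne by (simp add: scaleR_add_right)
    then have "(1 - s) *\<^sub>R c + s *\<^sub>R d = (1 - t) *\<^sub>R a + t *\<^sub>R b" by (simp add: algebra_simps)
    moreover have "(1 - s) *\<^sub>R c + s *\<^sub>R d \<in> closed_segment c d"
      unfolding closed_segment_def using ratio[OF neg(1)] by (auto simp: s_def)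
    moreover have "(1 - t) *\<^sub>R a + t *\<^sub>R b \<in> closed_segment a b"
      unfolding closed_segment_def using ratio[OF neg(2)] by (auto simp: t_def)
    ultimately show "closed_segment a b \<inter> closed_segment c d \<noteq> {}" by auto
  qed
qed

section \<open>Order types and the decoding by sides\<close>

fun orient :: "nat \<times> nat \<times> nat \<Rightarrow> (nat \<Rightarrow> real) \<Rightarrow> real" where
  "orient (i, j, k) x = (x (2 * j) - x (2 * i)) * (x (2 * k + 1) - x (2 * i + 1))
     - (x (2 * j + 1) - x (2 * i + 1)) * (x (2 * k) - x (2 * i))"

lemma orient_cross: "orient (i, j, k) x = cross (pt x j - pt x i) (pt x k - pt x i)"
  by (simp add: pt_def cross_def)

abbreviation triples :: "nat \<Rightarrow> (nat \<times> nat \<times> nat) set" where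
  "triples N \<equiv> {..<N} \<times> {..<N} \<times> {..<N}"

lemma mpoly_orient:
  assumes "t \<in> triples N"
  shows "mpoly (2 * N) 2 (orient t)"
proof -
  obtain i j k where t: "t = (i, j, k)" "i < N" "j < N" "k < N" using assms by auto
  have "mpoly (2 * N) (1 + 1) (\<lambda>x. (x (2 * j) - x (2 * i)) * (x (2 * k + 1) - x (2 * i + 1))
     - (x (2 * j + 1) - x (2 * i + 1)) * (x (2 * k) - x (2 * i)))"
    by (intro mpoly_diff mpoly_mult mpoly_var) (use t in simp_all)
  moreover have "orient t = (\<lambda>x. (x (2 * j) - x (2 * i)) * (x (2 * k + 1) - x (2 * i + 1))
     - (x (2 * j + 1) - x (2 * i + 1)) * (x (2 * k) - x (2 * i)))"
    unfolding t(1) by (rule ext) (rule orient.simps)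
  ultimately show ?thesis by (simp only: one_add_one)
qed

definition order_type :: "nat \<Rightarrow> (nat \<Rightarrow> real) \<Rightarrow> signs" where
  "order_type N x = (\<lambda>t\<in>triples N. sgn (orient t x))"

lemma card_order_types:
  assumes N: "1 \<le> N"
  shows "finite (range (order_type N))"
    "card (range (order_type N)) \<le> ((2 * N + 2) * (2 * (2 * N ^ 3 * 2 + 2 * (2 * N)))) ^ (2 * N + 1)"
proof -
  have fin: "finite (triples N)" by auto
  have k: "1 \<le> 2 * N" using N by simp
  have c: "card (triples N) = N ^ 3" by (simp add: card_cartesian_product power3_eq_cube)
  have o: "range (order_type N) = range (\<lambda>x. \<lambda>t\<in>triples N. sgn (orient t x))"
    by (rule arg_cong[where f = range]) (simp add: fun_eq_iff order_type_def)
  note b = card_sign_patterns_le[OF k fin, of 2 orient, OF mpoly_orient, folded o, unfolded c]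
  show "finite (range (order_type N))" by (rule b(1))
  show "card (range (order_type N)) \<le> ((2 * N + 2) * (2 * (2 * N ^ 3 * 2 + 2 * (2 * N)))) ^ (2 * N + 1)" by (rule b(2))
qed

text \<open>Repetitions permit a fixed number of indices although the number of points or sides is
  merely bounded.\<close>

lemma enumeration_with_repetition:
  assumes "finite W" "W \<noteq> {}" "card W \<le> N"
  shows "\<exists>q. q ` {..<N} = W"
proof -
  obtain g where g: "bij_betw g {0..<card W} W" using ex_bij_betw_nat_finite[OF assms(1)] by blast
  obtain w where w: "w \<in> W" using assms(2) by blast
  have im: "g ` {..<card W} = W" using g by (simp add: bij_betw_def atLeast0LessThan)
  have "(\<lambda>i. if i < card W then g i else w) ` {..<N} = W"
  proof (intro equalityI subsetI)
    fix y assume "y \<in> (\<lambda>i. if i < card W then g i else w) ` {..<N}"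
    then show "y \<in> W" using im w by auto
  next
    fix y assume "y \<in> W"
    then obtain i where "i < card W" "y = g i" using im by auto
    then show "y \<in> (\<lambda>i. if i < card W then g i else w) ` {..<N}" using assms(3) by (intro image_eqI[of _ _ i]) auto
  qed
  then show ?thesis by blast
qed

definition crossing :: "signs \<Rightarrow> nat \<Rightarrow> nat \<Rightarrow> nat \<Rightarrow> nat \<Rightarrow> bool" where
  "crossing \<omega> i j k l \<longleftrightarrow> \<omega> (i, j, k) * \<omega> (i, j, l) < 0 \<and> \<omega> (k, l, i) * \<omega> (k, l, j) < 0"

text \<open>
  \<open>Z\<close> is the set of vertices that lie in an obstacle; for the others, meeting an obstacle means
  crossing one of its sides.
\<close>

definition graph_of_sides :: "nat \<Rightarrow> nat \<Rightarrow> signs \<Rightarrow> (nat \<Rightarrow> nat) \<Rightarrow> (nat \<Rightarrow> nat \<times> nat)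
    \<Rightarrow> nat set \<Rightarrow> nat set set" where
  "graph_of_sides n s \<omega> \<pi> f Z = {{u, v} | u v. u < n \<and> v < n \<and> u \<noteq> v \<and>
     (u \<notin> Z \<and> v \<notin> Z \<and> (\<forall>i<s. \<not> crossing \<omega> (\<pi> u) (\<pi> v) (fst (f i)) (snd (f i))))}"

text \<open>There are at most \<open>s\<close> distinct sides and so at most \<open>2 * s\<close>
  vertices of obstacles, which explains \<open>N\<close>. For ends outside \<open>Z\<close>, general
  position makes every contact with a side a proper crossing, and the order type decides it.\<close>

lemma sides_decoding:
  assumes n: "1 \<le> n" and s: "1 \<le> s" and E: "E \<in> labeled_graphs n" "admits_total_sides n s E"
    and N: "N = n + 2 * s"
  shows "\<exists>\<omega>\<in>range (order_type N). \<exists>\<pi>\<in>PiE {..<n} (\<lambda>_. {..<N}). \<exists>f\<in>PiE {..<s} (\<lambda>_. {..<N} \<times> {..<N}).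
    \<exists>Z\<in>Pow {..<n}. E = graph_of_sides n s \<omega> \<pi> f Z"
proof -
  obtain p Obs sides where rep: "obstacle_representation n E p Obs sides" and sum: "(\<Sum>R\<in>Obs. card (sides R)) = s"
    using E(2) by (auto simp: admits_total_sides_def)
  have fin: "finite Obs" and inj: "inj_on p {..<n}" and poly: "\<And>R. R \<in> Obs \<Longrightarrow> polygonal_region R (sides R)"
    and gp: "general_position (p ` {..<n} \<union> (\<Union>R\<in>Obs. \<Union>(sides R)))"
    and adj: "\<And>u v. u < n \<Longrightarrow> v < n \<Longrightarrow> u \<noteq> v \<Longrightarrow> {u, v} \<in> E \<longleftrightarrow> (\<forall>R\<in>Obs. closed_segment (p u) (p v) \<inter> R = {})"
    using rep unfolding obstacle_representation_def by blast+
  define D where "D = (\<Union>R\<in>Obs. sides R)"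
  define W where "W = p ` {..<n} \<union> \<Union>D"
  have gpW: "general_position W"
  proof -
    have "\<Union>D = (\<Union>R\<in>Obs. \<Union>(sides R))" unfolding D_def by blast
    then show ?thesis using gp by (simp only: W_def)
  qed
  have finS: "finite (sides R)" and card2: "\<And>e. e \<in> sides R \<Longrightarrow> card e = 2"
    and closed: "closed R" and fr: "frontier R = (\<Union>e\<in>sides R. convex hull e)" if "R \<in> Obs" for R
    using poly[OF that] by (auto simp: polygonal_region_def compact_imp_closed)
  have finD: "finite D" unfolding D_def using fin finS by blast
  have card2D: "card e = 2" if "e \<in> D" for e using that card2 unfolding D_def by blast
  have cardD: "card D \<le> s" unfolding D_def sum[symmetric] by (rule card_UN_le[OF fin])
  have D0: "D \<noteq> {}"
  proof
    assume "D = {}"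
    then have "(\<Sum>R\<in>Obs. card (sides R)) = 0" by (intro sum.neutral) (auto simp: D_def)
    then show False using sum s by simp
  qed
  have finV: "finite (\<Union>D)" using finD card2D by (intro finite_Union) (auto intro: card_ge_0_finite)
  have "card (\<Union>D) \<le> (\<Sum>e\<in>D. card e)" using card_UN_le[OF finD, of "\<lambda>e. e"] by simp
  also have "\<dots> \<le> 2 * s" using card2D cardD by simp
  finally have "card (\<Union>D) \<le> 2 * s" .
  moreover have "card (p ` {..<n}) \<le> n" using card_image_le[of "{..<n}" p] by simp
  ultimately have cardW: "card W \<le> N" unfolding W_def N using card_Un_le[of "p ` {..<n}" "\<Union>D"] by linarith
  have finW: "finite W" unfolding W_def using finV by simp
  have "p 0 \<in> W" unfolding W_def using n by auto
  then obtain q where q: "q ` {..<N} = W" using enumeration_with_repetition[OF finW _ cardW] by blast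
  obtain g where g: "g ` {..<s} = D" using enumeration_with_repetition[OF finD D0 cardD] by blast
  obtain x where x: "\<And>i. pt x i = plane (q i)" using coordinates_exist by blast
  have "\<forall>u\<in>{..<n}. \<exists>i. i < N \<and> q i = p u"
  proof
    fix u assume "u \<in> {..<n}"
    then have "p u \<in> q ` {..<N}" unfolding q W_def by blast
    then show "\<exists>i. i < N \<and> q i = p u" by auto
  qed
  then obtain \<pi>' where \<pi>': "\<And>u. u < n \<Longrightarrow> \<pi>' u < N \<and> q (\<pi>' u) = p u" using bchoice[of "{..<n}" "\<lambda>u i. i < N \<and> q i = p u"] by auto
  have "\<forall>i\<in>{..<s}. \<exists>c. fst c < N \<and> snd c < N \<and> fst c \<noteq> snd c \<and> q (fst c) \<noteq> q (snd c) \<and> g i = {q (fst c), q (snd c)}"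
  proof
    fix i assume "i \<in> {..<s}"
    then have gi: "g i \<in> D" using g by blast
    then obtain a b where ab: "g i = {a, b}" "a \<noteq> b" using card2D[OF gi] by (auto simp: card_2_iff)
    then have "a \<in> q ` {..<N}" "b \<in> q ` {..<N}" using gi unfolding q W_def by auto
    then obtain k l where "k < N" "l < N" "a = q k" "b = q l" by blast
    then show "\<exists>c. fst c < N \<and> snd c < N \<and> fst c \<noteq> snd c \<and> q (fst c) \<noteq> q (snd c) \<and> g i = {q (fst c), q (snd c)}"
      using ab by (intro exI[of _ "(k, l)"]) auto
  qed
  from bchoice[OF this] obtain f' where f': "\<And>i. i < s \<Longrightarrow> fst (f' i) < N \<and> snd (f' i) < N \<and> q (fst (f' i)) \<noteq> q (snd (f' i)) \<and>
    g i = {q (fst (f' i)), q (snd (f' i))}" by auto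
  define \<pi> where "\<pi> = (\<lambda>u\<in>{..<n}. \<pi>' u)"
  define f where "f = (\<lambda>i\<in>{..<s}. f' i)"
  define Z where "Z = {u \<in> {..<n}. \<exists>R\<in>Obs. p u \<in> R}"
  have \<pi>: "\<pi> u < N" "q (\<pi> u) = p u" if "u < n" for u using \<pi>'[OF that] that by (simp_all add: \<pi>_def)
  have f: "fst (f i) < N" "snd (f i) < N" "q (fst (f i)) \<noteq> q (snd (f i))" "g i = {q (fst (f i)), q (snd (f i))}"
    if "i < s" for i using f'[OF that] that by (simp_all add: f_def)
  have hull_sub: "convex hull e \<subseteq> R" if "R \<in> Obs" "e \<in> sides R" for R e
    using frontier_subset_closed[OF closed[OF that(1)]] fr[OF that(1)] that(2) by blast
  \<comment> \<open>A segment that starts outside a region and meets it must meet the frontier,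
    which is the union of the sides.\<close>
  have meets: "(\<exists>R\<in>Obs. closed_segment (p u) (p v) \<inter> R \<noteq> {}) \<longleftrightarrow> (\<exists>e\<in>D. closed_segment (p u) (p v) \<inter> convex hull e \<noteq> {})"
    if u: "u < n" "u \<notin> Z" for u v
  proof
    assume "\<exists>R\<in>Obs. closed_segment (p u) (p v) \<inter> R \<noteq> {}"
    then obtain R where R: "R \<in> Obs" "closed_segment (p u) (p v) \<inter> R \<noteq> {}" by blast
    have "p u \<in> closed_segment (p u) (p v) - R" using u R(1) by (auto simp: Z_def)
    then have "closed_segment (p u) (p v) - R \<noteq> {}" by blast
    then have "closed_segment (p u) (p v) \<inter> frontier R \<noteq> {}" using R(2) by (intro connected_Int_frontier) auto
    then show "\<exists>e\<in>D. closed_segment (p u) (p v) \<inter> convex hull e \<noteq> {}" unfolding fr[OF R(1)] D_def using R(1) by blast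
  next
    assume "\<exists>e\<in>D. closed_segment (p u) (p v) \<inter> convex hull e \<noteq> {}"
    then show "\<exists>R\<in>Obs. closed_segment (p u) (p v) \<inter> R \<noteq> {}" unfolding D_def using hull_sub by blast
  qed
  have notin: "p u \<notin> e" if "u < n" "u \<notin> Z" "e \<in> D" for u e
  proof
    assume "p u \<in> e"
    then have "p u \<in> convex hull e" by (rule hull_inc)
    then show False using that hull_sub unfolding D_def Z_def by blast
  qed
  have cr: "crossing (order_type N x) (\<pi> u) (\<pi> v) (fst (f i)) (snd (f i)) \<longleftrightarrow> closed_segment (p u) (p v) \<inter> convex hull (g i) \<noteq> {}"
    if uv: "u < n" "v < n" "u \<noteq> v" "u \<notin> Z" "v \<notin> Z" and i: "i < s" for u v i
  proof -
    let ?c = "q (fst (f i))" and ?d = "q (snd (f i))"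
    have gi: "g i \<in> D" using g i by blast
    \<comment> \<open>A vertex of an obstacle belongs to the obstacle, so points outside
      \<open>Z\<close> differ from all of them.\<close>
    have ne: "p u \<noteq> p v" "p u \<noteq> ?c" "p u \<noteq> ?d" "p v \<noteq> ?c" "p v \<noteq> ?d" "?c \<noteq> ?d"
      using inj uv notin[OF _ _ gi] f[OF i] by (auto simp: inj_on_def)
    have mem: "p u \<in> W" "p v \<in> W" "?c \<in> W" "?d \<in> W" using \<pi> f[OF i] uv q by (auto simp: W_def)
    have nz: "cross (plane (p v) - plane (p u)) (plane ?c - plane (p u)) \<noteq> 0"
      "cross (plane (p v) - plane (p u)) (plane ?d - plane (p u)) \<noteq> 0"
      "cross (plane ?d - plane ?c) (plane (p u) - plane ?c) \<noteq> 0"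
      "cross (plane ?d - plane ?c) (plane (p v) - plane ?c) \<noteq> 0"
      by (intro general_position_cross[OF gpW] mem ne ne[symmetric])+
    have prods: "order_type N x (j, k, l) * order_type N x (j, k, m) < 0 \<longleftrightarrow> orient (j, k, l) x * orient (j, k, m) x < 0"
      if "j < N" "k < N" "l < N" "m < N" for j k l m
      using that by (simp add: order_type_def sgn_mult[symmetric] del: orient.simps)
    have "crossing (order_type N x) (\<pi> u) (\<pi> v) (fst (f i)) (snd (f i)) \<longleftrightarrow>
      closed_segment (plane (p u)) (plane (p v)) \<inter> closed_segment (plane ?c) (plane ?d) \<noteq> {}"
      unfolding crossing_def prods[OF \<pi>(1)[OF uv(1)] \<pi>(1)[OF uv(2)] f(1,2)[OF i]]
        prods[OF f(1,2)[OF i] \<pi>(1)[OF uv(1)] \<pi>(1)[OF uv(2)]] orient_cross x \<pi>(2)[OF uv(1)] \<pi>(2)[OF uv(2)]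
      using segments_meet_iff[OF nz] ..
    also have "\<dots> \<longleftrightarrow> closed_segment (p u) (p v) \<inter> closed_segment ?c ?d \<noteq> {}"
      unfolding plane_segment image_Int[OF inj_plane, symmetric] image_is_empty ..
    finally show ?thesis unfolding f(4)[OF i] segment_convex_hull .
  qed
  have "E = graph_of_sides n s (order_type N x) \<pi> f Z" unfolding graph_of_sides_def
  proof (rule labeled_graph_eqI[OF E(1)])
    fix u v assume uv: "u < n" "v < n" "u \<noteq> v"
    show "{u, v} \<in> E \<longleftrightarrow> u \<notin> Z \<and> v \<notin> Z \<and> (\<forall>i<s. \<not> crossing (order_type N x) (\<pi> u) (\<pi> v) (fst (f i)) (snd (f i)))"
    proof (cases "u \<in> Z \<or> v \<in> Z")
      case True
      then obtain R where R: "R \<in> Obs" "p u \<in> R \<or> p v \<in> R" unfolding Z_def by blast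
      then have "closed_segment (p u) (p v) \<inter> R \<noteq> {}" using ends_in_segment[of "p u" "p v"] by blast
      then have "\<exists>R\<in>Obs. closed_segment (p u) (p v) \<inter> R \<noteq> {}" using R(1) by blast
      then show ?thesis using True adj[OF uv] by blast
    next
      case False
      then have nZ: "u \<notin> Z" "v \<notin> Z" by auto
      have "{u, v} \<in> E \<longleftrightarrow> \<not> (\<exists>e\<in>D. closed_segment (p u) (p v) \<inter> convex hull e \<noteq> {})"
        unfolding adj[OF uv] meets[OF uv(1) nZ(1), symmetric] by blast
      also have "\<dots> \<longleftrightarrow> (\<forall>i<s. \<not> crossing (order_type N x) (\<pi> u) (\<pi> v) (fst (f i)) (snd (f i)))"
        using cr[OF uv nZ] unfolding g[symmetric] by auto
      finally show ?thesis using nZ by blast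
    qed
  qed
  moreover have "\<pi> \<in> PiE {..<n} (\<lambda>_. {..<N})" using \<pi>(1) by (auto simp: \<pi>_def PiE_iff)
  moreover have "f \<in> PiE {..<s} (\<lambda>_. {..<N} \<times> {..<N})"
    using f(1,2) by (auto simp: PiE_iff mem_Times_iff) (simp add: f_def)
  moreover have "Z \<in> Pow {..<n}" by (auto simp: Z_def)
  ultimately show ?thesis by (intro bexI[of _ "order_type N x"] bexI[of _ \<pi>] bexI[of _ f] bexI[of _ Z]) auto
qed

lemma card_side_graphs_le:
  assumes n: "1 \<le> n" and s: "1 \<le> s" and N: "N = n + 2 * s"
  shows "card {E \<in> labeled_graphs n. admits_total_sides n s E} \<le>
    ((2 * N + 2) * (2 * (2 * N ^ 3 * 2 + 2 * (2 * N)))) ^ (2 * N + 1) * (N ^ n * ((N * N) ^ s * 2 ^ n))"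
proof -
  have N1: "1 \<le> N" using n N by simp
  let ?P = "PiE {..<n} (\<lambda>_. {..<N})" and ?F = "PiE {..<s} (\<lambda>_. {..<N} \<times> {..<N})"
  let ?A = "range (order_type N) \<times> ?P \<times> ?F \<times> Pow {..<n}"
  have fin: "finite ?A" using card_order_types(1)[OF N1] by (intro finite_cartesian_product finite_PiE) auto
  have "{E \<in> labeled_graphs n. admits_total_sides n s E} \<subseteq> (\<lambda>(\<omega>, \<pi>, f, Z). graph_of_sides n s \<omega> \<pi> f Z) ` ?A"
  proof
    fix E assume "E \<in> {E \<in> labeled_graphs n. admits_total_sides n s E}"
    then have "E \<in> labeled_graphs n" "admits_total_sides n s E" by simp_all
    from sides_decoding[OF n s this N] obtain \<omega> \<pi> f Z where
      mem: "\<omega> \<in> range (order_type N)" "\<pi> \<in> ?P" "f \<in> ?F" "Z \<in> Pow {..<n}" and E: "E = graph_of_sides n s \<omega> \<pi> f Z"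
      by (elim bexE) (rule that)
    show "E \<in> (\<lambda>(\<omega>, \<pi>, f, Z). graph_of_sides n s \<omega> \<pi> f Z) ` ?A"
      by (rule image_eqI[of _ _ "(\<omega>, \<pi>, f, Z)"]) (simp_all only: E prod.case mem mem_Times_iff fst_conv snd_conv simp_thms)
  qed
  then have "card {E \<in> labeled_graphs n. admits_total_sides n s E} \<le> card ?A"
    by (rule surj_card_le[OF fin])
  also have "\<dots> = card (range (order_type N)) * (N ^ n * ((N * N) ^ s * 2 ^ n))"
    by (simp add: card_cartesian_product card_PiE card_Pow)
  also have "\<dots> \<le> ((2 * N + 2) * (2 * (2 * N ^ 3 * 2 + 2 * (2 * N)))) ^ (2 * N + 1) * (N ^ n * ((N * N) ^ s * 2 ^ n))"
    by (intro mult_le_mono1 card_order_types(2)[OF N1])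
  finally show ?thesis .
qed

section \<open>Numerical estimates\<close>

lemma natpow_le_powr:
  assumes "card A \<le> b ^ e" "1 \<le> b" "real e * log 2 (real b) \<le> c"
  shows "real (card A) \<le> 2 powr c"
proof -
  have "real (card A) \<le> real b ^ e" using assms(1) by (metis of_nat_le_iff of_nat_power)
  also have "\<dots> = 2 powr (real e * log 2 (real b))"
    using assms(2) by (simp add: powr_powr[symmetric] powr_realpow mult.commute[of "real e"])
  also have "\<dots> \<le> 2 powr c" using assms(3) by simp
  finally show ?thesis .
qed

text \<open>Numerical factors are absorbed by \<open>2 ^ k \<le> n ^ k\<close>, so that only
  exponents of \<open>n\<close> remain: \<open>102 * n\<close>, from
  \<open>34 * (2 * n + 1)\<close>, for the sign vectors and \<open>3 * max_edges n + 20\<close> per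
  obstacle. As \<open>max_edges n\<close> is at most 12 times \<open>n * log 2 n\<close>, the
  coefficients add up to \<open>102 + 36 + 20 = 158\<close>.\<close>

lemma card_obstacle_graphs_powr:
  assumes n: "2 \<le> n" and h: "1 \<le> h"
  shows "real (card {E \<in> labeled_graphs n. admits_obstacles n h E}) \<le> 2 powr (216 * real h * real n * (log 2 (real n))\<^sup>2)"
proof -
  define L where "L = log 2 (real n)"
  let ?K = "max_edges n"
  have L: "1 \<le> L" using n by (simp add: L_def le_log_iff)
  have pw: "2 ^ k \<le> n ^ k" for k using n by (rule power_mono) simp
  have q4: "4 * (n * n) \<le> n ^ 4" using mult_le_mono1[OF pw[of 2], of "n * n"] by (simp add: power4_eq_xxxx power2_eq_square mult.assoc)
  have q5: "(4 * (n * n)) ^ 5 \<le> n ^ 20" using power_mono[OF q4, of 5] by (simp add: power_mult[symmetric])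
  have q44: "(4 * (n * n)) ^ 4 \<le> n ^ 16" using power_mono[OF q4, of 4] by (simp add: power_mult[symmetric])
  have n20: "n \<le> n ^ 20" using n by (intro self_le_power) auto
  have "2 * n + 2 \<le> 4 * n" using n by simp
  also have "\<dots> \<le> n ^ 3" using mult_le_mono1[OF pw[of 2], of n] by (simp add: power3_eq_cube power2_eq_square)
  finally have a: "2 * n + 2 \<le> n ^ 3" .
  have "2 * (2 * (27 * (4 * (n * n)) ^ 5) * 18 + 2 * (2 * n)) \<le> 2 ^ 11 * n ^ 20"
  proof -
    have "2 * (2 * (27 * a) * 18 + 2 * (2 * m)) \<le> 2 ^ 11 * c" if "a \<le> c" "m \<le> c" for a m c :: nat using that by simp
    then show ?thesis using q5 n20 .
  qed
  also have "\<dots> \<le> n ^ 11 * n ^ 20" by (intro mult_le_mono1 pw)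
  also have "\<dots> = n ^ 31" by (simp add: power_add[symmetric])
  finally have b: "2 * (2 * (27 * (4 * (n * n)) ^ 5) * 18 + 2 * (2 * n)) \<le> n ^ 31" .
  have n1: "1 \<le> n" using n by simp
  note card_face_structures(2)[OF n1]
  also have "((2 * n + 2) * (2 * (2 * (27 * (4 * (n * n)) ^ 5) * 18 + 2 * (2 * n)))) ^ (2 * n + 1) \<le> (n ^ 3 * n ^ 31) ^ (2 * n + 1)"
    by (intro power_mono mult_le_mono a b) simp
  also have "\<dots> = n ^ (34 * (2 * n + 1))" by (simp only: power_add[symmetric] power_mult) simp
  also have "\<dots> \<le> n ^ (102 * n)" using n by (intro power_increasing) auto
  finally have faces: "card (range (\<lambda>x. range (sv n x))) \<le> n ^ (102 * n)" .
  have "9 * (4 * (n * n)) ^ 4 \<le> n ^ 4 * n ^ 16" using pw[of 4] by (intro mult_le_mono q44) simp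
  then have c: "9 * (4 * (n * n)) ^ 4 \<le> n ^ 20" by (simp add: power_add[symmetric])
  have "n * n + 1 \<le> 2 * (n * n)" using n by simp
  also have "\<dots> \<le> n ^ 3" using mult_le_mono1[OF n, of "n * n"] by (simp add: power3_eq_cube)
  finally have "(n * n + 1) ^ ?K \<le> (n ^ 3) ^ ?K" by (rule power_mono) simp
  then have d: "(n * n + 1) ^ ?K \<le> n ^ (3 * ?K)" by (simp add: power_mult)
  have "card {E \<in> labeled_graphs n. admits_obstacles n h E} \<le> n ^ (102 * n) * (n ^ (3 * ?K) * n ^ 20) ^ h"
    by (rule order_trans[OF card_obstacle_graphs_le[OF n]]) (intro mult_le_mono power_mono faces c d, simp)
  also have "\<dots> = n ^ (102 * n + (3 * ?K + 20) * h)" by (simp only: power_add power_mult)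
  finally have e: "card {E \<in> labeled_graphs n. admits_obstacles n h E} \<le> n ^ (102 * n + (3 * ?K + 20) * h)" .
  have "0 \<le> 4 * real n * (2 * L + 1)" using L by simp
  then have "real ?K \<le> 4 * real n * (2 * L + 1)" unfolding max_edges_def L_def by linarith
  also have "\<dots> \<le> 4 * real n * (3 * L)" using L by (intro mult_left_mono) auto
  finally have K: "real ?K \<le> 12 * (real n * L)" by simp
  have nL: "1 \<le> real n * L" using mult_mono[of 1 "real n" 1 L] n L by simp
  have "real (102 * n + (3 * ?K + 20) * h) = 102 * real n + (3 * real ?K + 20) * real h" by simp
  also have "\<dots> \<le> 102 * (real h * (real n * L)) + (36 * (real n * L) + 20 * (real n * L)) * real h"
  proof (intro add_mono mult_right_mono)
    have "real n * 1 \<le> real n * L" using L by (intro mult_left_mono) auto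
    also have "\<dots> \<le> real h * (real n * L)" using mult_right_mono[of 1 "real h" "real n * L"] h nL by simp
    finally show "102 * real n \<le> 102 * (real h * (real n * L))" by simp
  qed (use K nL in linarith)+
  also have "\<dots> \<le> 216 * real h * real n * L" using L by (simp add: algebra_simps)
  finally have "real (102 * n + (3 * ?K + 20) * h) * L \<le> 216 * real h * real n * L * L"
    using L by (intro mult_right_mono) auto
  then show ?thesis using natpow_le_powr[OF e n1] unfolding L_def[symmetric] by (simp add: power2_eq_square mult.assoc)
qed

text \<open>With \<open>M = max n s\<close> the argument is at most \<open>3 * M\<close>, and
  \<open>log 2 3 \<le> 2 * log 2 M\<close> gives \<open>log 2 (3 * M) \<le> 3 * log 2 M\<close>;
  hence the factor 9.\<close>

lemma mult_log_sum_le: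
  assumes n: "2 \<le> n" and s: "1 \<le> s"
  shows "real (n + 2 * s) * log 2 (real (n + 2 * s)) \<le> 9 * (real n * log 2 (real n) + real s * log 2 (real s))"
proof -
  define M where "M = max n s"
  have M: "2 \<le> M" "n \<le> M" "s \<le> M" using n by (simp_all add: M_def)
  have lM: "1 \<le> log 2 (real M)" using M by (simp add: le_log_iff)
  have "log 2 3 \<le> (2 :: real)" by (simp add: log_le_iff)
  then have l3: "log 2 3 \<le> 2 * log 2 (real M)" using lM by linarith
  have le: "real (n + 2 * s) \<le> 3 * real M" using M by simp
  have "log 2 (real (n + 2 * s)) \<le> log 2 (3 * real M)" using le n by (subst log_le_cancel_iff) auto
  also have "\<dots> = log 2 3 + log 2 (real M)" using M by (subst log_mult) auto
  finally have "log 2 (real (n + 2 * s)) \<le> 3 * log 2 (real M)" using l3 by linarith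
  then have "real (n + 2 * s) * log 2 (real (n + 2 * s)) \<le> (3 * real M) * (3 * log 2 (real M))"
    using le n by (intro mult_mono) auto
  also have "\<dots> = 9 * (real M * log 2 (real M))" by simp
  also have "real M * log 2 (real M) \<le> real n * log 2 (real n) + real s * log 2 (real s)"
  proof -
    have "0 \<le> real n * log 2 (real n)" "0 \<le> real s * log 2 (real s)" using n s by simp_all
    then show ?thesis unfolding M_def by (simp add: max_def)
  qed
  finally show ?thesis by simp
qed

text \<open>The order types contribute \<open>N ^ (21 * N)\<close>; the indices of the points, the
  sides and the set \<open>Z\<close> contribute \<open>N ^ N\<close> each. The exponent
  \<open>24 * N\<close> and the factor 9 of \<open>mult_log_sum_le\<close> give 216.\<close>

lemma card_side_graphs_powr:
  assumes n: "2 \<le> n" and s: "1 \<le> s"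
  shows "real (card {E \<in> labeled_graphs n. admits_total_sides n s E})
    \<le> 2 powr (216 * (real n * log 2 (real n) + real s * log 2 (real s)))"
proof -
  define N where "N = n + 2 * s"
  have N: "3 \<le> N" "1 \<le> N" "n \<le> N" "2 * s \<le> N" using n s by (simp_all add: N_def)
  have n1: "1 \<le> n" using n by simp
  have sq: "9 \<le> N * N" using mult_le_mono[OF N(1) N(1)] by simp
  have "2 * N + 2 \<le> 3 * N" using N by simp
  also have "\<dots> \<le> N ^ 2" using N by (simp add: power2_eq_square)
  finally have a: "2 * N + 2 \<le> N ^ 2" .
  have "8 * N \<le> N * N * N" using sq by (intro mult_le_mono1) linarith
  then have "8 * N \<le> N ^ 3" by (simp add: power3_eq_cube)
  then have "2 * (2 * N ^ 3 * 2 + 2 * (2 * N)) \<le> 9 * N ^ 3" by simp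
  also have "\<dots> \<le> N * N * N ^ 3" by (rule mult_le_mono1[OF sq])
  also have "\<dots> = N ^ 5" by (simp add: eval_nat_numeral)
  finally have b: "2 * (2 * N ^ 3 * 2 + 2 * (2 * N)) \<le> N ^ 5" .
  have "((2 * N + 2) * (2 * (2 * N ^ 3 * 2 + 2 * (2 * N)))) ^ (2 * N + 1) \<le> (N ^ 2 * N ^ 5) ^ (2 * N + 1)"
    by (intro power_mono mult_le_mono a b) simp
  also have "\<dots> = N ^ (7 * (2 * N + 1))" by (simp only: power_add[symmetric] power_mult) simp
  also have "\<dots> \<le> N ^ (21 * N)" using N by (intro power_increasing) auto
  finally have c: "((2 * N + 2) * (2 * (2 * N ^ 3 * 2 + 2 * (2 * N)))) ^ (2 * N + 1) \<le> N ^ (21 * N)" .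
  have d: "N ^ n \<le> N ^ N" using N by (intro power_increasing) auto
  have "(N * N) ^ s = N ^ (2 * s)" by (simp add: power_mult power2_eq_square)
  also have "\<dots> \<le> N ^ N" using N by (intro power_increasing) auto
  finally have e: "(N * N) ^ s \<le> N ^ N" .
  have "2 ^ n \<le> N ^ n" using N by (intro power_mono) auto
  then have f: "2 ^ n \<le> N ^ N" using d by linarith
  have "card {E \<in> labeled_graphs n. admits_total_sides n s E} \<le> N ^ (21 * N) * (N ^ N * (N ^ N * N ^ N))"
    by (rule order_trans[OF card_side_graphs_le[OF n1 s N_def]]) (intro mult_le_mono c d e f)
  also have "\<dots> = N ^ (24 * N)" by (simp only: power_add[symmetric]) (rule arg_cong[of _ _ "\<lambda>k. N ^ k"], simp)
  finally have "card {E \<in> labeled_graphs n. admits_total_sides n s E} \<le> N ^ (24 * N)" .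
  then show ?thesis
    by (rule natpow_le_powr[OF _ N(2)]) (use mult_log_sum_le[OF n s] in \<open>simp add: N_def algebra_simps\<close>)
qed

text \<open>For \<open>n = 1\<close> the logarithm vanishes and the bound of part (i) is exactly 1,
  so this case is settled by direct counting.\<close>

lemma labeled_graphs_1: "labeled_graphs 1 = {{}}"
proof -
  have "\<not> (e \<subseteq> {..<1} \<and> card e = 2)" for e :: "nat set" using card_mono[of "{..<1::nat}" e] by auto
  then show ?thesis by (simp add: labeled_graphs_def)
qed

lemma card_graphs_1: "real (card {E \<in> labeled_graphs 1. P E}) \<le> 1"
  using card_mono[of "{{}} :: nat set set set" "{E \<in> labeled_graphs 1. P E}"] unfolding labeled_graphs_1 by (simp add: subset_eq)

theorem theorem1:
  "\<exists>C::real. C > 0 \<and>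
     (\<forall>n::nat. n \<ge> 1 \<longrightarrow>
        (\<forall>h::nat. h \<ge> 1 \<longrightarrow>
           real (card {E \<in> labeled_graphs n. admits_obstacles n h E})
             \<le> 2 powr (C * real h * real n * (log 2 (real n))\<^sup>2)) \<and>
        (\<forall>s::nat. s \<ge> 1 \<longrightarrow>
           real (card {E \<in> labeled_graphs n. admits_total_sides n s E})
             \<le> 2 powr (C * (real n * log 2 (real n) + real s * log 2 (real s)))))"
proof (intro exI[of _ 216] conjI allI impI)
  fix n h :: nat assume "1 \<le> n" "1 \<le> h"
  consider "n = 1" | "2 \<le> n" using \<open>1 \<le> n\<close> by linarith
  then show "real (card {E \<in> labeled_graphs n. admits_obstacles n h E}) \<le> 2 powr (216 * real h * real n * (log 2 (real n))\<^sup>2)"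
    using card_graphs_1 card_obstacle_graphs_powr[OF _ \<open>1 \<le> h\<close>] by cases auto
next
  fix n s :: nat assume "1 \<le> n" "1 \<le> s"
  consider "n = 1" | "2 \<le> n" using \<open>1 \<le> n\<close> by linarith
  then show "real (card {E \<in> labeled_graphs n. admits_total_sides n s E})
      \<le> 2 powr (216 * (real n * log 2 (real n) + real s * log 2 (real s)))"
  proof cases
    case 1
    have "0 \<le> real s * log 2 (real s)" using \<open>1 \<le> s\<close> by simp
    then have "1 \<le> 2 powr (216 * (real s * log 2 (real s)))" by (intro ge_one_powr_ge_zero) auto
    then show ?thesis using card_graphs_1[of "admits_total_sides 1 s"] 1 by simp
  qed (rule card_side_graphs_powr[OF _ \<open>1 \<le> s\<close>])
qed simp

end
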